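(* Let $p\ge 2$ be a fixed integer. Consider $n$ nodes in the $\mathsf{GOSSIP}$ model, each node $v$ holding $\mathrm{val}(v)\in\{1,\dots,N\}\cup\{\mathrm{NULL}\}$ with $N=\mathrm{poly}(n)$. If $F_0=O(n^{1/(p-1)})$, then there is an algorithm that, with high probability, obtains an $\ell_p$-sample in $O(\log n)$ rounds.
   Context: $f_i=|\{v:\mathrm{val}(v)=i\}|$, $F_p=\sum_i f_i^p$, $F_0=|\{i:f_i>0\}|$. An $\ell_p$-sample is a value $i\in\{1,\dots,N\}$ output with probability exactly $f_i^p/F_p$ (conditioned on success), known to all nodes. $\mathsf{GOSSIP}$ model ($=\mathsf{GOSSIP}(0)$): in each synchronous round each node $u$ samples a node $t(u)$ uniformly at random independently of the others, and may PUSH an $O(\log n)$-bit message to $t(u)$ or PULL one from $t(u)$, then compute locally. With high probability means with probability $1-1/\mathrm{poly}(n)$. *)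

theory Defs
  imports "HOL-Probability.Probability" "HOL-Library.Landau_Symbols" "HOL-Library.Multiset"
begin

text \<open>
  Nodes are the elements of \<open>{..<n}\<close>; an input assigns a value to each of them, with \<open>None\<close>
  standing for NULL.
\<close>

type_synonym input = "nat \<Rightarrow> nat option"

definition valid_input :: "nat \<Rightarrow> nat \<Rightarrow> input \<Rightarrow> bool" where
  "valid_input n N val \<longleftrightarrow> (\<forall>v<n. val v \<in> insert None (Some ` {1..N}))"

definition freq :: "nat \<Rightarrow> input \<Rightarrow> nat \<Rightarrow> nat" where
  "freq n val i = card {v. v < n \<and> val v = Some i}"

definition moment :: "nat \<Rightarrow> nat \<Rightarrow> nat \<Rightarrow> input \<Rightarrow> nat" where
  "moment p n N val = (\<Sum>i = 1..N. freq n val i ^ p)"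

definition distinct_values :: "nat \<Rightarrow> nat \<Rightarrow> input \<Rightarrow> nat" where
  "distinct_values n N val = card {i \<in> {1..N}. freq n val i > 0}"

type_synonym message = "bool list"

datatype action = Idle | Push message | Pull

text \<open>
  The program run by every node. The nodes are anonymous, and local randomness is discrete: it is
  drawn when the state is initialised and whenever it is updated, so the action and the reply can be
  functions of the state. \<open>reply\<close> is the message handed to every node that pulls in the
  current round. An update sees the multiset of messages pushed to the node and, if the node
  pulled, the message it obtained. \<open>result\<close> is \<open>None\<close> for a node that reports failure.
  As the coins are discrete, only countably many states are reachable, so taking
  \<open>nat\<close> as the state type is no restriction.
\<close>

record 's gossip_algorithm =
  init :: "nat option \<Rightarrow> 's pmf"
  act :: "'s \<Rightarrow> action"
  reply :: "'s \<Rightarrow> message"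
  update :: "'s \<Rightarrow> message multiset \<Rightarrow> message option \<Rightarrow> 's pmf"
  result :: "'s \<Rightarrow> nat option"

definition message_length_bounded :: "nat \<Rightarrow> 's gossip_algorithm \<Rightarrow> bool" where
  "message_length_bounded b A \<longleftrightarrow>
     (\<forall>s. length (reply A s) \<le> b \<and> (\<forall>m. act A s = Push m \<longrightarrow> length m \<le> b))"

text \<open>In the following, \<open>\<sigma>\<close> maps nodes to states and \<open>t u\<close> is the node sampled by \<open>u\<close>.\<close>

definition pushed_messages ::
  "nat \<Rightarrow> 's gossip_algorithm \<Rightarrow> (nat \<Rightarrow> 's) \<Rightarrow> (nat \<Rightarrow> nat) \<Rightarrow> nat \<Rightarrow> message multiset" where
  "pushed_messages n A \<sigma> t u =
     (\<Sum>w<n. case act A (\<sigma> w) of Push m \<Rightarrow> (if t w = u then {#m#} else {#}) | _ \<Rightarrow> {#})"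

definition pulled_message ::
  "'s gossip_algorithm \<Rightarrow> (nat \<Rightarrow> 's) \<Rightarrow> (nat \<Rightarrow> nat) \<Rightarrow> nat \<Rightarrow> message option" where
  "pulled_message A \<sigma> t u =
     (if act A (\<sigma> u) = Pull then Some (reply A (\<sigma> (t u))) else None)"

definition gossip_round :: "nat \<Rightarrow> 's gossip_algorithm \<Rightarrow> (nat \<Rightarrow> 's) \<Rightarrow> (nat \<Rightarrow> 's) pmf" where
  "gossip_round n A \<sigma> =
     bind_pmf (Pi_pmf {..<n} 0 (\<lambda>_. pmf_of_set {..<n}))
       (\<lambda>t. Pi_pmf {..<n} undefined
          (\<lambda>u. update A (\<sigma> u) (pushed_messages n A \<sigma> t u) (pulled_message A \<sigma> t u)))"

primrec gossip_run :: "nat \<Rightarrow> 's gossip_algorithm \<Rightarrow> input \<Rightarrow> nat \<Rightarrow> (nat \<Rightarrow> 's) pmf" where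
  "gossip_run n A val 0 = Pi_pmf {..<n} undefined (\<lambda>u. init A (val u))"
| "gossip_run n A val (Suc T) = bind_pmf (gossip_run n A val T) (gossip_round n A)"

definition all_output :: "nat \<Rightarrow> 's gossip_algorithm \<Rightarrow> nat \<Rightarrow> (nat \<Rightarrow> 's) \<Rightarrow> bool" where
  "all_output n A i \<sigma> \<longleftrightarrow> (\<forall>u<n. result A (\<sigma> u) = Some i)"

definition success :: "nat \<Rightarrow> 's gossip_algorithm \<Rightarrow> (nat \<Rightarrow> 's) \<Rightarrow> bool" where
  "success n A \<sigma> \<longleftrightarrow> (\<exists>i. all_output n A i \<sigma>)"

definition obtains_lp_sample ::
  "nat \<Rightarrow> nat \<Rightarrow> nat \<Rightarrow> 's gossip_algorithm \<Rightarrow> input \<Rightarrow> nat \<Rightarrow> real \<Rightarrow> bool" where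
  "obtains_lp_sample p n N A val T \<epsilon> \<longleftrightarrow>
     \<P>(\<sigma> in measure_pmf (gossip_run n A val T). success n A \<sigma>) \<ge> 1 - \<epsilon> \<and>
     (\<forall>i\<in>{1..N}.
        \<P>(\<sigma> in measure_pmf (gossip_run n A val T). all_output n A i \<sigma> \<bar> success n A \<sigma>)
          = real (freq n val i) ^ p / real (moment p n N val))"

end

theory Submission
  imports Defs "HOL-Real_Asymp.Real_Asymp"
begin

text \<open>
  A node that pulls \<open>p\<close> values and finds them all equal to \<open>i\<close> has performed a trial that succeeds
  with value \<open>i\<close> with probability \<open>(f\<^sub>i / n) ^ p\<close>; by the power mean inequality and the bound on
  \<open>F\<^sub>0\<close>, \<open>O(log n)\<close> trials per node suffice if a constant fraction of the nodes hold a value. All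
  trials are independent, so a successful one that is selected without looking at its value is an
  exact sample.

  To reach a constant density, each value is first replicated: every token is split into exactly
  \<open>2 ^ G\<close> copies that settle on distinct nodes. The exponent \<open>G\<close> comes from an averaging estimate of
  the number of tokens, which is reliable only above about \<open>sqrt n\<close> tokens; a first round of
  replication reaches this range, a second one reaches density \<open>1/4096\<close>. A potential function
  that contracts in expectation shows that spreading takes \<open>O(log n)\<close> rounds.

  Exactness must hold on every run on which all nodes agree, including improbable ones. Nodes that
  notice an irregularity report failure, which makes the whole run fail. The number of tokens is
  conserved on every run, so settled tokens and equal exponents imply that all values were
  replicated equally. Likewise the leader that owns the selected trial creates more than \<open>n / 2\<close>
  tokens, so if all of them settle, there is no second leader and everybody repeats the value
  of the same trial.
\<close>

section \<open>Finitely supported Markov kernels\<close>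

text \<open>Everything after the trials sees the candidates only through the set of nodes that own
  one. The probability that node \<open>l\<close> becomes the accepted leader is therefore a
  function of this pattern, and as the candidate of \<open>l\<close> is independent of the other
  nodes, the law of the output is that of one trial up to a factor that is the same for all values.
  This factor may depend on the exponents that a run happened to use; conditioning on success
  removes it. The obstacle is that no node can see whether all nodes replicated alike. So each node
  remembers its two exponents, and the final broadcast carries those of the leader: a node with
  other exponents rejects the announcement. The threshold \<open>sqrt n\<close> is generous: the
  relative error of averaging \<open>M\<close> tokens is controlled up to probability exp(- M /
  O(log n)), which is below every inverse polynomial once \<open>M\<close> is of order
  \<open>sqrt n\<close>. One replication loses at most a factor 64 against its goal, and two of them
  give 64 * 64 = 4096.\<close>

abbreviation "expect p \<equiv> measure_pmf.expectation p"
abbreviation "prob p \<equiv> measure_pmf.prob p"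

lemma expectation_mono_finite:
  fixes f g :: "'a \<Rightarrow> real"
  assumes "finite (set_pmf p)" "\<And>x. x \<in> set_pmf p \<Longrightarrow> f x \<le> g x"
  shows "expect p f \<le> expect p g"
  using assms by (intro integral_mono_AE integrable_measure_pmf_finite) (auto simp: AE_measure_pmf_iff)

lemma expectation_bind_finite:
  fixes g :: "'b \<Rightarrow> real"
  assumes "finite (set_pmf p)" "\<And>x. x \<in> set_pmf p \<Longrightarrow> finite (set_pmf (f x))"
  shows "expect (bind_pmf p f) g =
    expect p (\<lambda>x. expect (f x) g)"
proof -
  have "expect (bind_pmf p f) g =
      (\<Sum>a\<in>set_pmf p. pmf p a *\<^sub>R expect (f a) g)"
    using assms by (intro pmf_expectation_bind) auto
  also have "\<dots> = expect p (\<lambda>x. expect (f x) g)"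
    using assms(1) by (subst integral_measure_pmf[of "set_pmf p"]) auto
  finally show ?thesis .
qed

lemma prob_bind_pmf:
  "prob (bind_pmf p f) A = expect p (\<lambda>x. prob (f x) A)"
proof -
  have "ennreal (prob (bind_pmf p f) A) =
      (\<integral>\<^sup>+x. ennreal (prob (f x) A) \<partial>measure_pmf p)"
    by (simp add: measure_pmf.emeasure_eq_measure[symmetric])
  also have "\<dots> = ennreal (expect p (\<lambda>x. prob (f x) A))"
    by (rule nn_integral_eq_integral)
      (auto intro!: measure_pmf.integrable_const_bound[where B = 1])
  finally show ?thesis
    by (subst (asm) ennreal_inj) (auto intro!: integral_nonneg)
qed

text \<open>Chaining of stages: missing the intermediate goal \<open>E\<close> costs \<epsilon>, and
  from every reachable state in \<open>E\<close> the continuation costs \<delta>. All failure bounds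
  of composed programs are obtained this way.\<close>

lemma prob_bind_le:
  assumes "prob p {x. \<not> E x} \<le> \<epsilon>"
    and "\<And>x. x \<in> set_pmf p \<Longrightarrow> E x \<Longrightarrow> prob (f x) A \<le> \<delta>" and "\<delta> \<ge> 0"
  shows "prob (bind_pmf p f) A \<le> \<epsilon> + \<delta>"
proof -
  have "prob (bind_pmf p f) A
      \<le> expect p (\<lambda>x. indicator {x. \<not> E x} x + \<delta>)"
    unfolding prob_bind_pmf
  proof (rule integral_mono_AE)
    show "integrable (measure_pmf p) (\<lambda>x. prob (f x) A)"
      by (auto intro!: measure_pmf.integrable_const_bound[where B = 1])
    show "integrable (measure_pmf p) (\<lambda>x. indicator {x. \<not> E x} x + \<delta>)"
      by (auto intro!: measure_pmf.integrable_const_bound[where B = "1 + \<delta>"] simp: indicator_def assms(3))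
    show "AE x in measure_pmf p. prob (f x) A \<le> indicator {x. \<not> E x} x + \<delta>"
      using assms(2,3) by (auto simp: AE_measure_pmf_iff indicator_def add_increasing2)
  qed
  also have "\<dots> = prob p {x. \<not> E x} + \<delta>"
    by (subst Bochner_Integration.integral_add) (auto simp: measure_pmf.emeasure_eq_measure)
  finally show ?thesis using assms(1) by linarith
qed

primrec chain :: "('a \<Rightarrow> 'a pmf) \<Rightarrow> nat \<Rightarrow> 'a \<Rightarrow> 'a pmf" where
  "chain K 0 x = return_pmf x"
| "chain K (Suc T) x = bind_pmf (K x) (chain K T)"

text \<open>The index of \<open>I\<close> counts the rounds still to come, so it runs down from
  \<open>T\<close> to 0; bounds that grow with elapsed time are written in terms of
  \<open>T - j\<close>.\<close>

lemma chain_invariant: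
  assumes "\<And>j x y. I (Suc j) x \<Longrightarrow> y \<in> set_pmf (K x) \<Longrightarrow> I j y" "I T x" "y \<in> set_pmf (chain K T x)"
  shows "I 0 y"
  using assms(2,3) by (induction T arbitrary: x) (auto dest: assms(1))

lemma finite_set_chain:
  assumes "\<And>x. finite (set_pmf (K x))"
  shows "finite (set_pmf (chain K T x))"
  by (induction T arbitrary: x) (auto simp: assms)

text \<open>A supermartingale argument: \<open>\<Phi> j\<close> is the potential to use with
  \<open>j\<close> rounds left. Its dependence on \<open>j\<close> lets the parameter of an
  exponential moment drift from round to round.\<close>

lemma chain_expectation:
  fixes \<Phi> :: "nat \<Rightarrow> 'a \<Rightarrow> real"
  assumes fin: "\<And>x. finite (set_pmf (K x))"
    and inv: "\<And>j x y. I (Suc j) x \<Longrightarrow> y \<in> set_pmf (K x) \<Longrightarrow> I j y"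
    and step: "\<And>j x. I (Suc j) x \<Longrightarrow> expect (K x) (\<Phi> j) \<le> \<Phi> (Suc j) x"
    and "I T x"
  shows "expect (chain K T x) (\<Phi> 0) \<le> \<Phi> T x"
  using assms(4)
proof (induction T arbitrary: x)
  case (Suc T)
  have "expect (chain K (Suc T) x) (\<Phi> 0) =
      expect (K x) (\<lambda>y. expect (chain K T y) (\<Phi> 0))"
    by (simp add: expectation_bind_finite fin finite_set_chain)
  also have "\<dots> \<le> expect (K x) (\<Phi> T)"
    using Suc inv by (intro expectation_mono_finite fin) auto
  also have "\<dots> \<le> \<Phi> (Suc T) x" by (rule step) (rule Suc.prems)
  finally show ?case .
qed simp

lemma markov_finite:
  fixes \<Phi> :: "'a \<Rightarrow> real"
  assumes "finite (set_pmf p)" "\<And>x. x \<in> set_pmf p \<Longrightarrow> \<Phi> x \<ge> 0" "a > 0"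
    and "\<And>x. x \<in> set_pmf p \<Longrightarrow> x \<in> A \<Longrightarrow> \<Phi> x \<ge> a" and "expect p \<Phi> \<le> B"
  shows "prob p A \<le> B / a"
proof -
  have "a * prob p A = expect p (\<lambda>x. a * indicator A x)"
    by simp
  also have "\<dots> \<le> expect p \<Phi>"
    using assms by (intro expectation_mono_finite) (auto simp: indicator_def)
  finally have "a * prob p A \<le> B" using assms(5) by simp
  then show ?thesis using \<open>a > 0\<close> by (simp add: field_simps)
qed

text \<open>Geometric decay of the expected potential, followed by Markov's inequality at the level
  \<open>a\<close> that the bad set forces.\<close>

lemma chain_contraction:
  fixes \<Phi> :: "'a \<Rightarrow> real"
  assumes fin: "\<And>x. finite (set_pmf (K x))"
    and inv: "\<And>x y. I x \<Longrightarrow> y \<in> set_pmf (K x) \<Longrightarrow> I y"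
    and step: "\<And>x. I x \<Longrightarrow> expect (K x) \<Phi> \<le> \<rho> * \<Phi> x"
    and "I x" "\<rho> \<ge> 0"
    and nonneg: "\<And>x. I x \<Longrightarrow> \<Phi> x \<ge> 0" and "a > 0"
    and A: "\<And>x. I x \<Longrightarrow> x \<in> A \<Longrightarrow> \<Phi> x \<ge> a"
  shows "prob (chain K T x) A \<le> \<rho> ^ T * \<Phi> x / a"
proof (rule markov_finite[where \<Phi> = \<Phi>])
  have I: "I y" if "y \<in> set_pmf (chain K T x)" for y
    using chain_invariant[of "\<lambda>_. I" K T x y] inv \<open>I x\<close> that by blast
  show "y \<in> set_pmf (chain K T x) \<Longrightarrow> 0 \<le> \<Phi> y" "y \<in> set_pmf (chain K T x) \<Longrightarrow> y \<in> A \<Longrightarrow> a \<le> \<Phi> y" for y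
    using I nonneg A by auto
  have "expect (chain K T x) ((\<lambda>j x. \<rho> ^ j * \<Phi> x) 0) \<le> (\<lambda>j x. \<rho> ^ j * \<Phi> x) T x"
  proof (rule chain_expectation[where I = "\<lambda>_. I"])
    fix j x assume "I x"
    show "expect (K x) (\<lambda>x. \<rho> ^ j * \<Phi> x) \<le> \<rho> ^ Suc j * \<Phi> x"
      using mult_left_mono[OF step[OF \<open>I x\<close>], of "\<rho> ^ j"] \<open>\<rho> \<ge> 0\<close> by (simp add: mult_ac)
  qed (use fin inv \<open>I x\<close> in auto)
  then show "expect (chain K T x) \<Phi> \<le> \<rho> ^ T * \<Phi> x" by simp
qed (use \<open>a > 0\<close> finite_set_chain[OF fin] in auto)

section \<open>Uniform independent targets\<close>

definition targets :: "nat \<Rightarrow> (nat \<Rightarrow> nat) pmf" where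
  "targets n = Pi_pmf {..<n} 0 (\<lambda>_. pmf_of_set {..<n})"

lemma targets_less: "t \<in> set_pmf (targets n) \<Longrightarrow> u < n \<Longrightarrow> t u < n"
  by (auto simp: targets_def set_Pi_pmf PiE_dflt_def set_pmf_of_set lessThan_empty_iff)

lemma finite_targets: "finite (set_pmf (targets n))"
proof (cases "n = 0")
  case False
  then show ?thesis
    by (auto simp: targets_def set_Pi_pmf set_pmf_of_set lessThan_empty_iff intro!: finite_PiE_dflt)
qed (simp add: targets_def)

lemma integrable_targets [simp]: "integrable (measure_pmf (targets n)) (f :: _ \<Rightarrow> real)"
  by (rule integrable_measure_pmf_finite) (rule finite_targets)

lemma targets_expectation_prod:
  fixes f :: "nat \<Rightarrow> nat \<Rightarrow> real"
  assumes "0 < n" "\<And>w v. w < n \<Longrightarrow> v < n \<Longrightarrow> f w v \<ge> 0"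
  shows "expect (targets n) (\<lambda>t. \<Prod>w<n. f w (t w)) = (\<Prod>w<n. (\<Sum>v<n. f w v) / n)"
  unfolding targets_def
proof (subst expectation_prod_Pi_pmf)
  have ne: "{..<n} \<noteq> {}" using assms(1) by (auto simp: lessThan_empty_iff)
  show "integrable (measure_pmf (pmf_of_set {..<n})) (f x)" for x
    using ne by (intro integrable_measure_pmf_finite) (simp add: set_pmf_of_set)
  show "x \<in> {..<n} \<Longrightarrow> y \<in> set_pmf (pmf_of_set {..<n}) \<Longrightarrow> 0 \<le> f x y" for x y
    using ne assms(2) by (auto simp: set_pmf_of_set)
  show "(\<Prod>x<n. expect (pmf_of_set {..<n}) (f x)) = (\<Prod>w<n. (\<Sum>v<n. f w v) / n)"
    using ne by (simp add: integral_pmf_of_set)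
qed simp

lemma targets_expectation_coord:
  fixes f :: "nat \<Rightarrow> real"
  assumes "u < n"
  shows "expect (targets n) (\<lambda>t. f (t u)) = (\<Sum>v<n. f v) / n"
proof -
  have "expect (targets n) (\<lambda>t. f (t u)) =
      expect (map_pmf (\<lambda>t. t u) (targets n)) f" by simp
  also have "map_pmf (\<lambda>t. t u) (targets n) = pmf_of_set {..<n}"
    using assms by (simp add: targets_def Pi_pmf_component)
  also have "expect (pmf_of_set {..<n}) f = (\<Sum>v<n. f v) / n"
    using assms by (subst integral_pmf_of_set) auto
  finally show ?thesis .
qed

lemma targets_expectation_prod_on:
  fixes f :: "nat \<Rightarrow> nat \<Rightarrow> real"
  assumes "0 < n" "W \<subseteq> {..<n}" "\<And>w v. w \<in> W \<Longrightarrow> v < n \<Longrightarrow> f w v \<ge> 0"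
  shows "expect (targets n) (\<lambda>t. \<Prod>w\<in>W. f w (t w)) = (\<Prod>w\<in>W. (\<Sum>v<n. f w v) / n)"
proof -
  have *: "{..<n} \<inter> W = W" using assms(2) by auto
  have "expect (targets n) (\<lambda>t. \<Prod>w<n. (if w \<in> W then f w (t w) else 1)) =
      (\<Prod>w<n. (\<Sum>v<n. (if w \<in> W then f w v else 1)) / n)"
    using assms by (intro targets_expectation_prod[where f = "\<lambda>w v. if w \<in> W then f w v else 1"]) auto
  also have "\<dots> = (\<Prod>w<n. (if w \<in> W then (\<Sum>v<n. f w v) / n else 1))"
    using assms(1) by (intro prod.cong) auto
  finally show ?thesis using * by (simp add: prod.If_cases)
qed

section \<open>Programs for anonymous nodes\<close>

primrec bits :: "nat \<Rightarrow> nat \<Rightarrow> bool list" where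
  "bits 0 x = []"
| "bits (Suc b) x = odd x # bits b (x div 2)"

primrec number :: "bool list \<Rightarrow> nat" where
  "number [] = 0"
| "number (c # cs) = of_bool c + 2 * number cs"

lemma number_bits: "x < 2 ^ b \<Longrightarrow> number (bits b x) = x"
proof (induction b arbitrary: x)
  case (Suc b)
  then have "number (bits b (x div 2)) = x div 2" by (intro Suc.IH) auto
  then show ?case by simp
qed simp

lemma length_bits: "length (bits b x) = b"
  by (induction b arbitrary: x) auto

text \<open>The length bound quantifies over all states, reachable or not, so numbers are cut off
  before they are sent. Saturation never increases a number and is the identity below
  \<open>2 ^ b\<close>.\<close>

definition trunc :: "nat \<Rightarrow> nat \<Rightarrow> nat" where
  "trunc b x = min x (2 ^ b - 1)"

lemma trunc_id: "x < 2 ^ b \<Longrightarrow> trunc b x = x"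
  by (simp add: trunc_def)

lemma trunc_le: "trunc b x \<le> x"
  by (simp add: trunc_def)

definition msg :: "nat \<Rightarrow> nat \<Rightarrow> message" where
  "msg b x = bits b (trunc b x)"

lemma length_msg: "length (msg b x) = b"
  by (simp add: msg_def length_bits)

lemma number_msg [simp]: "number (msg b x) = trunc b x"
  unfolding msg_def by (rule number_bits) (simp add: trunc_def min_less_iff_disj)

text \<open>
  A token \<open>(v, g)\<close> stands for \<open>2 ^ g\<close> copies of the value \<open>v\<close>, which it becomes by repeated halving.
\<close>

type_synonym token = "nat \<times> nat"

text \<open>\<open>stk\<close> is the stack of tokens, \<open>acc\<close> the number shown to
  pulling nodes, \<open>gs\<close> the replication exponents with the latest first,
  \<open>smp\<close> the samples of the running trial, \<open>cnd\<close> the value of the first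
  successful trial, \<open>prio\<close> the ticket in the election. \<open>ok\<close> records
  whether the stack was settled at the checkpoints.\<close>

record data =
  stk :: "token list"
  acc :: nat
  gs :: "nat list"
  smp :: "nat list"
  cnd :: "nat option"
  prio :: nat
  leader :: bool
  ok :: bool

text \<open>A token of positive exponent is halved: one half is pushed, the other stays on top of
  the stack. A single copy is pushed away unless it is alone, in which case the node keeps it for
  good or until another token arrives.\<close>

fun push_token :: "token list \<Rightarrow> token option" where
  "push_token [] = None"
| "push_token ((v, Suc g) # s) = Some (v, g)"
| "push_token ((v, 0) # s) = (if s = [] then None else Some (v, 0))"

fun kept :: "token list \<Rightarrow> token list" where
  "kept [] = []"
| "kept ((v, Suc g) # s) = (v, g) # s"
| "kept ((v, 0) # s) = (if s = [] then [(v, 0)] else s)"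

text \<open>Valid values lie in \<open>1..N\<close>, so 0 can stand for an empty stack.\<close>

definition top_value :: "token list \<Rightarrow> nat" where
  "top_value s = (case s of [] \<Rightarrow> 0 | x # _ \<Rightarrow> fst x)"

datatype instr = Local "data \<Rightarrow> data pmf" | PullSum | PullMax | Spread | Sample

text \<open>Describes the behaviour in one round; initial states and results belong to the compiled
  program. Sorting makes the order of the arrivals a function of their multiset.\<close>

definition instr_alg :: "nat \<Rightarrow> instr \<Rightarrow> data gossip_algorithm" where
  "instr_alg b I = \<lparr>
     init = \<lambda>_. return_pmf undefined,
     act = \<lambda>d. case I of Local _ \<Rightarrow> Idle
       | Spread \<Rightarrow> (case push_token (stk d) of None \<Rightarrow> Idle | Some x \<Rightarrow> Push (msg b (prod_encode x)))
       | _ \<Rightarrow> Pull,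
     reply = \<lambda>d. msg b (case I of Sample \<Rightarrow> top_value (stk d) | _ \<Rightarrow> acc d),
     update = \<lambda>d ms mo. case I of Local f \<Rightarrow> f d
       | PullSum \<Rightarrow> return_pmf (d\<lparr>acc := acc d + number (the mo)\<rparr>)
       | PullMax \<Rightarrow> return_pmf (d\<lparr>acc := max (acc d) (number (the mo))\<rparr>)
       | Spread \<Rightarrow> return_pmf (d\<lparr>stk :=
           map prod_decode (sorted_list_of_multiset (image_mset number ms)) @ kept (stk d)\<rparr>)
       | Sample \<Rightarrow> return_pmf (d\<lparr>smp := number (the mo) # smp d\<rparr>),
     result = \<lambda>_. None \<rparr>"

definition rnd :: "nat \<Rightarrow> nat \<Rightarrow> instr \<Rightarrow> (nat \<Rightarrow> data) \<Rightarrow> (nat \<Rightarrow> data) pmf" where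
  "rnd n b I = gossip_round n (instr_alg b I)"

primrec exec :: "nat \<Rightarrow> nat \<Rightarrow> instr list \<Rightarrow> (nat \<Rightarrow> data) \<Rightarrow> (nat \<Rightarrow> data) pmf" where
  "exec n b [] \<sigma> = return_pmf \<sigma>"
| "exec n b (I # P) \<sigma> = bind_pmf (rnd n b I \<sigma>) (exec n b P)"

lemma exec_append: "exec n b (P @ Q) \<sigma> = bind_pmf (exec n b P \<sigma>) (exec n b Q)"
  by (induction P arbitrary: \<sigma>) (auto simp: bind_return_pmf bind_assoc_pmf intro!: bind_pmf_cong)

lemma exec_singleton: "exec n b [I] \<sigma> = rnd n b I \<sigma>"
proof -
  have "exec n b [] = return_pmf" by auto
  then show ?thesis by (simp add: bind_return_pmf')
qed

lemma exec_replicate: "exec n b (replicate T I) \<sigma> = chain (rnd n b I) T \<sigma>"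
proof (induction T arbitrary: \<sigma>)
  case (Suc T)
  have "exec n b (replicate T I) = chain (rnd n b I) T" using Suc by auto
  then show ?case by simp
qed simp

section \<open>Compilation of an instruction list into one algorithm\<close>

definition data_tuple where
  "data_tuple d = (stk d, acc d, gs d, smp d, cnd d, prio d, leader d, ok d)"

text \<open>The final algorithm has state type \<open>nat\<close>, so program counter and data are
  packed into one number. Viewing the record as a tuple of countable components makes
  \<open>to_nat\<close> available.\<close>

definition state_code :: "nat \<times> data \<Rightarrow> nat" where
  "state_code x = to_nat (fst x, data_tuple (snd x))"

lemma inj_state_code: "inj state_code"
  by (auto simp: inj_def state_code_def data_tuple_def intro!: data.equality)

definition state_decode :: "nat \<Rightarrow> nat \<times> data" where
  "state_decode = inv state_code"

lemma state_decode_code [simp]: "state_decode (state_code x) = x"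
  by (simp add: state_decode_def inj_state_code)

definition program_alg ::
  "nat \<Rightarrow> instr list \<Rightarrow> (nat option \<Rightarrow> data) \<Rightarrow> (data \<Rightarrow> nat option) \<Rightarrow> nat gossip_algorithm" where
  "program_alg b P start out = \<lparr>
     init = \<lambda>v. return_pmf (state_code (0, start v)),
     act = \<lambda>s. case state_decode s of (k, d) \<Rightarrow>
       (if k < length P then act (instr_alg b (P ! k)) d else Idle),
     reply = \<lambda>s. case state_decode s of (k, d) \<Rightarrow>
       (if k < length P then reply (instr_alg b (P ! k)) d else []),
     update = \<lambda>s ms mo. case state_decode s of (k, d) \<Rightarrow>
       (if k < length P
        then map_pmf (\<lambda>d'. state_code (Suc k, d')) (update (instr_alg b (P ! k)) d ms mo)
        else return_pmf s),
     result = \<lambda>s. out (snd (state_decode s)) \<rparr>"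

lemma message_length_program_alg: "message_length_bounded b (program_alg b P start out)"
  unfolding message_length_bounded_def
  by (auto simp: program_alg_def instr_alg_def length_msg split: prod.splits instr.splits option.splits)

text \<open>\<open>undefined\<close> outside the network agrees with the default of
  \<open>Pi_pmf\<close> in \<open>gossip_round\<close>, so that configurations can be equated as
  functions.\<close>

definition encode_config :: "nat \<Rightarrow> nat \<Rightarrow> (nat \<Rightarrow> data) \<Rightarrow> nat \<Rightarrow> nat" where
  "encode_config n k \<sigma> = (\<lambda>u. if u < n then state_code (k, \<sigma> u) else undefined)"

text \<open>All nodes carry the same counter \<open>k\<close>, so they execute the same instruction;
  targets are always below \<open>n\<close>, hence messages and replies coincide with those of
  \<open>instr_alg\<close>, and the new states differ only by the encoding.\<close>

lemma gossip_round_program_alg: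
  assumes "k < length P"
  shows "gossip_round n (program_alg b P start out) (encode_config n k \<sigma>) =
    map_pmf (encode_config n (Suc k)) (rnd n b (P ! k) \<sigma>)"
proof -
  let ?A = "program_alg b P start out" and ?B = "instr_alg b (P ! k)" and ?\<sigma> = "encode_config n k \<sigma>"
  have act: "act ?A (?\<sigma> u) = act ?B (\<sigma> u)" and reply: "reply ?A (?\<sigma> u) = reply ?B (\<sigma> u)"
    and upd: "update ?A (?\<sigma> u) ms mo = map_pmf (\<lambda>d'. state_code (Suc k, d')) (update ?B (\<sigma> u) ms mo)"
    if "u < n" for u ms mo
    using that assms by (simp_all add: program_alg_def encode_config_def)
  have pushed: "pushed_messages n ?A ?\<sigma> t u = pushed_messages n ?B \<sigma> t u" for t u
    unfolding pushed_messages_def by (intro sum.cong) (auto simp: act)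
  have pulled: "pulled_message ?A ?\<sigma> t u = pulled_message ?B \<sigma> t u" if "u < n" "t u < n" for t u
    using that by (simp add: pulled_message_def act reply)
  have "gossip_round n ?A ?\<sigma> = bind_pmf (targets n) (\<lambda>t. Pi_pmf {..<n} undefined
      (\<lambda>u. map_pmf (\<lambda>d'. state_code (Suc k, d'))
        (update ?B (\<sigma> u) (pushed_messages n ?B \<sigma> t u) (pulled_message ?B \<sigma> t u))))"
    unfolding gossip_round_def targets_def[symmetric]
    by (intro bind_pmf_cong refl Pi_pmf_cong) (auto simp: upd pushed pulled targets_less)
  also have "\<dots> = bind_pmf (targets n) (\<lambda>t. map_pmf (encode_config n (Suc k)) (Pi_pmf {..<n} undefined
      (\<lambda>u. update ?B (\<sigma> u) (pushed_messages n ?B \<sigma> t u) (pulled_message ?B \<sigma> t u))))"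
  proof (intro bind_pmf_cong refl)
    fix t
    let ?q = "\<lambda>u. update ?B (\<sigma> u) (pushed_messages n ?B \<sigma> t u) (pulled_message ?B \<sigma> t u)"
    have "Pi_pmf {..<n} undefined (\<lambda>u. map_pmf (\<lambda>d'. state_code (Suc k, d')) (?q u)) =
      bind_pmf (Pi_pmf {..<n} undefined ?q)
        (\<lambda>f. Pi_pmf {..<n} undefined (\<lambda>u. return_pmf (state_code (Suc k, f u))))"
      unfolding map_pmf_def by (rule Pi_pmf_bind) simp
    then show "Pi_pmf {..<n} undefined (\<lambda>u. map_pmf (\<lambda>d'. state_code (Suc k, d')) (?q u)) =
      map_pmf (encode_config n (Suc k)) (Pi_pmf {..<n} undefined ?q)"
      by (simp add: map_pmf_def encode_config_def)
  qed
  also have "\<dots> = map_pmf (encode_config n (Suc k)) (rnd n b (P ! k) \<sigma>)"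
    by (simp add: rnd_def gossip_round_def targets_def map_bind_pmf)
  finally show ?thesis .
qed

definition start_config :: "nat \<Rightarrow> (nat option \<Rightarrow> data) \<Rightarrow> input \<Rightarrow> nat \<Rightarrow> data" where
  "start_config n start val = (\<lambda>u. if u < n then start (val u) else undefined)"

lemma gossip_run_program_alg:
  "k \<le> length P \<Longrightarrow> gossip_run n (program_alg b P start out) val k =
    map_pmf (encode_config n k) (exec n b (take k P) (start_config n start val))"
proof (induction k)
  case 0
  show ?case
    by (auto simp: program_alg_def encode_config_def start_config_def intro!: arg_cong[where f = return_pmf])
next
  case (Suc k)
  then have "gossip_run n (program_alg b P start out) val (Suc k) =
      bind_pmf (exec n b (take k P) (start_config n start val))
        (\<lambda>\<sigma>. map_pmf (encode_config n (Suc k)) (rnd n b (P ! k) \<sigma>))"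
    by (simp add: bind_map_pmf gossip_round_program_alg)
  also have "\<dots> = map_pmf (encode_config n (Suc k))
      (exec n b (take k P @ [P ! k]) (start_config n start val))"
    by (simp only: exec_append map_bind_pmf exec_singleton)
  also have "take k P @ [P ! k] = take (Suc k) P"
    using Suc.prems by (simp add: take_Suc_conv_app_nth)
  finally show ?case .
qed

lemma all_output_program_alg:
  "all_output n (program_alg b P start out) i (encode_config n k \<sigma>) \<longleftrightarrow> (\<forall>u<n. out (\<sigma> u) = Some i)"
  by (simp add: all_output_def program_alg_def encode_config_def)

subsection \<open>One round of each instruction\<close>

lemma bind_targets_return:
  "bind_pmf (targets n) (\<lambda>t. Pi_pmf {..<n} undefined (\<lambda>u. return_pmf (f t u))) =
   map_pmf (\<lambda>t u. if u < n then f t u else undefined) (targets n)"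
  by (simp add: map_pmf_def)

lemma rnd_Local: "rnd n b (Local f) \<sigma> = Pi_pmf {..<n} undefined (\<lambda>u. f (\<sigma> u))"
  by (simp add: rnd_def gossip_round_def instr_alg_def)

lemma rnd_Local_return:
  "rnd n b (Local (\<lambda>d. return_pmf (f d))) \<sigma> = return_pmf (\<lambda>u. if u < n then f (\<sigma> u) else undefined)"
  by (simp add: rnd_Local)

lemma rnd_PullSum: "rnd n b PullSum \<sigma> = map_pmf (\<lambda>t u. if u < n
    then (\<sigma> u)\<lparr>acc := acc (\<sigma> u) + trunc b (acc (\<sigma> (t u)))\<rparr> else undefined) (targets n)"
  by (simp add: rnd_def gossip_round_def instr_alg_def pulled_message_def targets_def[symmetric] 
    bind_targets_return[symmetric])

lemma rnd_PullMax: "rnd n b PullMax \<sigma> = map_pmf (\<lambda>t u. if u < n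
    then (\<sigma> u)\<lparr>acc := max (acc (\<sigma> u)) (trunc b (acc (\<sigma> (t u))))\<rparr> else undefined) (targets n)"
  by (simp add: rnd_def gossip_round_def instr_alg_def pulled_message_def targets_def[symmetric] 
    bind_targets_return[symmetric])

lemma rnd_Sample: "rnd n b Sample \<sigma> = map_pmf (\<lambda>t u. if u < n
    then (\<sigma> u)\<lparr>smp := trunc b (top_value (stk (\<sigma> (t u)))) # smp (\<sigma> u)\<rparr> else undefined) (targets n)"
  by (simp add: rnd_def gossip_round_def instr_alg_def pulled_message_def targets_def[symmetric] 
    bind_targets_return[symmetric])

definition arrivals :: "nat \<Rightarrow> nat \<Rightarrow> (nat \<Rightarrow> token list) \<Rightarrow> (nat \<Rightarrow> nat) \<Rightarrow> nat \<Rightarrow> token list" where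
  "arrivals n b s t u = map prod_decode (sorted_list_of_multiset
     (\<Sum>w<n. case push_token (s w) of None \<Rightarrow> {#}
        | Some x \<Rightarrow> (if t w = u then {#trunc b (prod_encode x)#} else {#})))"

lemma image_mset_sum: "image_mset f (\<Sum>w\<in>A. g w) = (\<Sum>w\<in>A. image_mset f (g w))"
  by (induction A rule: infinite_finite_induct) auto

lemma rnd_Spread: "rnd n b Spread \<sigma> = map_pmf (\<lambda>t u. if u < n
    then (\<sigma> u)\<lparr>stk := arrivals n b (\<lambda>w. stk (\<sigma> w)) t u @ kept (stk (\<sigma> u))\<rparr> else undefined) (targets n)"
proof -
  have "image_mset number (pushed_messages n (instr_alg b Spread) \<sigma> t u) =
    (\<Sum>w<n. case push_token (stk (\<sigma> w)) of None \<Rightarrow> {#}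
        | Some x \<Rightarrow> (if t w = u then {#trunc b (prod_encode x)#} else {#}))" for t u
    unfolding pushed_messages_def image_mset_sum
    by (intro sum.cong) (auto simp: instr_alg_def split: option.splits)
  then have "rnd n b Spread \<sigma> = bind_pmf (targets n) (\<lambda>t. Pi_pmf {..<n} undefined (\<lambda>u. return_pmf 
      ((\<sigma> u)\<lparr>stk := arrivals n b (\<lambda>w. stk (\<sigma> w)) t u @ kept (stk (\<sigma> u))\<rparr>)))"
    by (simp add: rnd_def gossip_round_def targets_def instr_alg_def arrivals_def)
  then show ?thesis by (simp only: bind_targets_return)
qed

lemma mset_arrivals:
  assumes "\<And>w x. w < n \<Longrightarrow> push_token (s w) = Some x \<Longrightarrow> prod_encode x < 2 ^ b"
  shows "mset (arrivals n b s t u) =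
    (\<Sum>w<n. case push_token (s w) of None \<Rightarrow> {#} | Some x \<Rightarrow> (if t w = u then {#x#} else {#}))"
  unfolding arrivals_def mset_map mset_sorted_list_of_multiset image_mset_sum
  using assms by (intro sum.cong) (auto simp: trunc_id split: option.splits)

section \<open>Broadcasting a maximum\<close>

lemma finite_set_rnd:
  "finite (set_pmf (rnd n b PullMax \<sigma>))" "finite (set_pmf (rnd n b PullSum \<sigma>))"
  "finite (set_pmf (rnd n b Spread \<sigma>))"
  by (simp_all add: rnd_PullMax rnd_PullSum rnd_Spread finite_targets)

text \<open>The potential n / |I| - 1 is 0 exactly when everybody is informed and of order
  \<open>n\<close> at the start, so one contraction covers both the exponential growth and the final
  clean-up. A quadratic upper bound for 1 / (1 + z) reduces the claim to the first two moments of
  \<open>X\<close>, which follow from pairwise independence.\<close>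

lemma informed_expectation:
  fixes I :: "nat set"
  assumes I: "I \<subseteq> {..<n}" "I \<noteq> {}"
  defines "X \<equiv> \<lambda>t. real (card {u. u < n \<and> u \<notin> I \<and> t u \<in> I})"
  shows "expect (targets n) (\<lambda>t. n / (real (card I) + X t) - 1) \<le> 3/4 * (n / card I - 1)"
proof -
  define i where "i = real (card I)"
  define J where "J = {..<n} - I"
  define a where "a = 1 - i / n"
  have fin: "finite I" "finite J" using I finite_subset by (auto simp: J_def)
  have npos: "0 < n" using I by auto
  have ipos: "i > 0" using I fin by (auto simp: i_def card_gt_0_iff)
  have i1: "i \<ge> 1" using I fin by (simp add: i_def Suc_le_eq card_gt_0_iff)
  have i_le: "i \<le> n" using I card_mono[of "{..<n}" I] by (simp add: i_def)
  have cardJ: "real (card J) = n - i"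
    using I fin card_mono[of "{..<n}" I] by (simp add: J_def i_def card_Diff_subset of_nat_diff)
  have X: "X t = (\<Sum>u\<in>J. indicator I (t u))" for t
  proof -
    have "(\<Sum>u\<in>J. indicator I (t u)) = real (card (J \<inter> {u. t u \<in> I}))"
      using fin by (simp add: indicator_def sum.If_cases)
    also have "J \<inter> {u. t u \<in> I} = {u. u < n \<and> u \<notin> I \<and> t u \<in> I}" by (auto simp: J_def)
    finally show ?thesis by (simp add: X_def)
  qed
  have sumI: "(\<Sum>v<n. indicator I v :: real) = i"
    using I by (simp add: indicator_def sum.If_cases i_def Int_absorb1)
  have E1: "expect (targets n) (\<lambda>t. indicator I (t u)) = i / n" if "u \<in> J" for u
    using that by (subst targets_expectation_coord) (auto simp: J_def sumI)
  have EX: "expect (targets n) X = (n - i) * i / n"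
    unfolding X by (subst Bochner_Integration.integral_sum) (auto simp: E1 cardJ)
  have E2: "expect (targets n) (\<lambda>t. indicator I (t u) * indicator I (t v)) =
      (if u = v then i / n else (i / n)\<^sup>2)" if "u \<in> J" "v \<in> J" for u v
  proof (cases "u = v")
    case True
    then show ?thesis using E1[OF that(1)] by (simp flip: indicator_inter_arith)
  next
    case False
    have "expect (targets n) (\<lambda>t. \<Prod>w\<in>{u,v}. indicator I (t w)) =
       (\<Prod>w\<in>{u,v}. (\<Sum>v<n. indicator I v) / n)"
      using that npos by (intro targets_expectation_prod_on) (auto simp: J_def)
    then show ?thesis using False by (simp add: sumI power2_eq_square)
  qed
  have "expect (targets n) (\<lambda>t. (X t)\<^sup>2) =
      (\<Sum>u\<in>J. \<Sum>v\<in>J. if u = v then i / n else (i / n)\<^sup>2)"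
    unfolding X power2_eq_square sum_product
    by (simp add: Bochner_Integration.integral_sum E2[unfolded power2_eq_square] cong: sum.cong)
  also have "\<dots> = (\<Sum>u\<in>J. \<Sum>v\<in>J. (i / n)\<^sup>2 + (if u = v then i / n - (i / n)\<^sup>2 else 0))"
    by (intro sum.cong) auto
  also have "\<dots> = (n - i)\<^sup>2 * (i / n)\<^sup>2 + (n - i) * (i / n - (i / n)\<^sup>2)"
    using fin unfolding cardJ[symmetric] by (simp add: sum.distrib power2_eq_square distrib_left)
  finally have EX2: "expect (targets n) (\<lambda>t. (X t)\<^sup>2) =
    (n - i)\<^sup>2 * (i / n)\<^sup>2 + (n - i) * (i / n - (i / n)\<^sup>2)" .
  have bound: "n / (i + X t) - 1 \<le> (n / i - 1) - n / (2 * i\<^sup>2) * X t + n / (8 * i ^ 3) * (X t)\<^sup>2" for t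
  proof -
    define z where "z = X t / i"
    have z: "z \<ge> 0" using ipos by (simp add: z_def X_def)
    \<comment> \<open>The square of z - 3/2 gives z^2/8 - 3z/8 + 9/32 \<ge> 0, and 9/32 is below
      1/2.\<close>
    have quad: "0 \<le> 1/2 - 3 * z / 8 + z\<^sup>2 / 8" using zero_le_power2[of "z - 3/2"] 
      by (simp add: power2_eq_square algebra_simps)
    have "(1 + z) * (1 - z / 2 + z\<^sup>2 / 8) = 1 + z * (1/2 - 3 * z / 8 + z\<^sup>2 / 8)"
      by (simp add: power2_eq_square field_simps)
    then have "1 \<le> (1 + z) * (1 - z / 2 + z\<^sup>2 / 8)"
      using mult_nonneg_nonneg[OF z quad] by simp
    then have "1 / (1 + z) \<le> 1 - z / 2 + z\<^sup>2 / 8" using z by (simp add: field_simps)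
    then have "(n / i) * (1 / (1 + z)) \<le> (n / i) * (1 - z / 2 + z\<^sup>2 / 8)"
      using ipos by (intro mult_left_mono) auto
    moreover have "(n / i) * (1 / (1 + z)) = n / (i + X t)"
      using ipos by (simp add: z_def field_simps)
    moreover have "(n / i) * (1 - z / 2 + z\<^sup>2 / 8) = n / i - n / (2 * i\<^sup>2) * X t + n / (8 * i ^ 3) * (X t)\<^sup>2"
      using ipos by (simp add: z_def field_simps power2_eq_square power3_eq_cube)
    ultimately show ?thesis by linarith
  qed
  have "expect (targets n) (\<lambda>t. n / (i + X t) - 1)
      \<le> expect (targets n)
        (\<lambda>t. (n / i - 1) - n / (2 * i\<^sup>2) * X t + n / (8 * i ^ 3) * (X t)\<^sup>2)"
    by (intro expectation_mono_finite finite_targets bound)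
  also have "\<dots> = (n / i - 1) - n / (2 * i\<^sup>2) * ((n - i) * i / n) +
      n / (8 * i ^ 3) * ((n - i)\<^sup>2 * (i / n)\<^sup>2 + (n - i) * (i / n - (i / n)\<^sup>2))"
    by (simp add: EX EX2)
  also have "\<dots> = (n / i - 1) * (1/2 + a / 8 * (1 + 1 / i))"
    using ipos npos by (simp add: a_def field_simps power2_eq_square power3_eq_cube)
  \<comment> \<open>Here \<open>a\<close> is at most 1 and 1 + 1/i at most 2, so the factor is at
    most 1/2 + 2/8.\<close>
  also have "\<dots> \<le> (n / i - 1) * (3/4)"
  proof (intro mult_left_mono)
    have "a * (1 + 1 / i) \<le> 1 * 2" using ipos npos i1 i_le
      by (intro mult_mono) (auto simp: a_def field_simps)
    then show "1/2 + a / 8 * (1 + 1 / i) \<le> 3/4" by simp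
    show "0 \<le> n / i - 1" using i_le ipos by (simp add: field_simps)
  qed
  finally show ?thesis by (simp add: i_def mult.commute)
qed

definition informed :: "nat \<Rightarrow> nat \<Rightarrow> (nat \<Rightarrow> data) \<Rightarrow> nat set" where
  "informed n m \<sigma> = {u. u < n \<and> acc (\<sigma> u) = m}"

text \<open>The potential starts below \<open>n\<close>, and a single uninformed node keeps it at
  1/n or more; the quotient of these levels is the factor \<open>n\<close> squared.\<close>

lemma PullMax_informs_all:
  assumes "m < 2 ^ b" and "\<And>u. u < n \<Longrightarrow> acc (\<sigma> u) \<le> m" and "\<exists>u<n. acc (\<sigma> u) = m"
  shows "prob (exec n b (replicate T PullMax) \<sigma>) {\<sigma>'. \<not> (\<forall>u<n. acc (\<sigma>' u) = m)}
    \<le> (3/4) ^ T * (real n)\<^sup>2"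
proof -
  define I where "I = (\<lambda>\<sigma> :: nat \<Rightarrow> data. (\<forall>u<n. acc (\<sigma> u) \<le> m) \<and> (\<exists>u<n. acc (\<sigma> u) = m))"
  define \<Phi> where "\<Phi> = (\<lambda>\<sigma>. n / real (card (informed n m \<sigma>)) - 1)"
  have npos: "0 < n" using assms(3) by auto
  have card_pos: "0 < card (informed n m \<sigma>)" if "I \<sigma>" for \<sigma>
    using that by (auto simp: I_def informed_def card_gt_0_iff)
  have card_le: "card (informed n m \<sigma>) \<le> n" for \<sigma>
    using card_mono[of "{..<n}" "informed n m \<sigma>"] by (auto simp: informed_def)
  have step_eq: "acc (\<sigma>' u) = max (acc (\<sigma> u)) (acc (\<sigma> (t u)))"
    if "I \<sigma>" "t \<in> set_pmf (targets n)" "u < n" "\<sigma>' = (\<lambda>u. if u < n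
      then (\<sigma> u)\<lparr>acc := max (acc (\<sigma> u)) (trunc b (acc (\<sigma> (t u))))\<rparr> else undefined)" for \<sigma> \<sigma>' t u
  proof -
    have "acc (\<sigma> (t u)) \<le> m" using that targets_less by (auto simp: I_def)
    then show ?thesis using that assms(1) by (simp add: trunc_id)
  qed
  have "prob (chain (rnd n b PullMax) T \<sigma>) {\<sigma>'. \<not> (\<forall>u<n. acc (\<sigma>' u) = m)}
      \<le> (3/4) ^ T * \<Phi> \<sigma> / (1 / n)"
  proof (rule chain_contraction[where I = I])
    fix \<sigma> \<sigma>' assume I: "I \<sigma>" and "\<sigma>' \<in> set_pmf (rnd n b PullMax \<sigma>)"
    then obtain t where t: "t \<in> set_pmf (targets n)" and \<sigma>': "\<sigma>' = (\<lambda>u. if u < n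
        then (\<sigma> u)\<lparr>acc := max (acc (\<sigma> u)) (trunc b (acc (\<sigma> (t u))))\<rparr> else undefined)"
      by (auto simp: rnd_PullMax)
    obtain u where u: "u < n" "acc (\<sigma> u) = m" using I by (auto simp: I_def)
    have le: "acc (\<sigma>' v) \<le> m" if "v < n" for v
      using I t that targets_less[OF t that] step_eq[OF I t that \<sigma>'] by (auto simp: I_def)
    moreover have "acc (\<sigma>' u) = m"
      using step_eq[OF I t u(1) \<sigma>'] u(2) le[OF u(1)] by simp
    ultimately show "I \<sigma>'" using u(1) by (auto simp: I_def)
  next
    fix \<sigma> assume I: "I \<sigma>"
    let ?I = "informed n m \<sigma>"
    let ?f = "\<lambda>t u. if u < n
        then (\<sigma> u)\<lparr>acc := max (acc (\<sigma> u)) (trunc b (acc (\<sigma> (t u))))\<rparr> else undefined"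
    have "card (informed n m (?f t)) = card ?I + card {u. u < n \<and> u \<notin> ?I \<and> t u \<in> ?I}"
      if t: "t \<in> set_pmf (targets n)" for t
    proof -
      have "acc (?f t u) = m \<longleftrightarrow> u \<in> ?I \<or> t u \<in> ?I" if u: "u < n" for u
      proof -
        have "acc (\<sigma> u) \<le> m" "acc (\<sigma> (t u)) \<le> m"
          using I t u targets_less[OF t u] by (auto simp: I_def)
        then show ?thesis
          using step_eq[OF I t u refl] u targets_less[OF t u] by (auto simp: informed_def max_def)
      qed
      then have "informed n m (?f t) = ?I \<union> {u. u < n \<and> u \<notin> ?I \<and> t u \<in> ?I}"
        unfolding informed_def[of n m "?f t"] by (auto simp: informed_def)
      moreover have "finite ?I" by (simp add: informed_def)
      ultimately show ?thesis by (subst card_Un_disjoint[symmetric]) auto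
    qed
    then have "expect (rnd n b PullMax \<sigma>) \<Phi> = expect (targets n)
        (\<lambda>t. n / (real (card ?I) + real (card {u. u < n \<and> u \<notin> ?I \<and> t u \<in> ?I})) - 1)"
      unfolding rnd_PullMax integral_map_pmf \<Phi>_def
      by (intro integral_cong_AE) (auto simp: AE_measure_pmf_iff)
    also have "\<dots> \<le> 3/4 * \<Phi> \<sigma>"
      unfolding \<Phi>_def using card_pos[OF I]
      by (intro informed_expectation) (auto simp: informed_def card_gt_0_iff)
    finally show "expect (rnd n b PullMax \<sigma>) \<Phi> \<le> 3/4 * \<Phi> \<sigma>" .
  next
    fix \<sigma> assume I: "I \<sigma>"
    show "0 \<le> \<Phi> \<sigma>" using card_pos[OF I] card_le[of \<sigma>] by (simp add: \<Phi>_def field_simps)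
    assume "\<sigma> \<in> {\<sigma>'. \<not> (\<forall>u<n. acc (\<sigma>' u) = m)}"
    then have "informed n m \<sigma> \<subset> {..<n}" by (auto simp: informed_def)
    then have "card (informed n m \<sigma>) < n" using psubset_card_mono[of "{..<n}"] by auto
    then have "real (card (informed n m \<sigma>)) + 1 \<le> n" by linarith
    then have "(real (card (informed n m \<sigma>)) + 1) / card (informed n m \<sigma>) \<le> n / real (card (informed n m \<sigma>))"
      by (intro divide_right_mono) auto
    then have "n / real (card (informed n m \<sigma>)) \<ge> 1 + 1 / card (informed n m \<sigma>)"
      using card_pos[OF I] by (simp add: add_divide_distrib)
    moreover have "1 / real (card (informed n m \<sigma>)) \<ge> 1 / n"
      using card_pos[OF I] card_le[of \<sigma>] by (simp add: frac_le)
    ultimately show "1 / n \<le> \<Phi> \<sigma>" by (simp add: \<Phi>_def)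
  qed (use assms npos finite_set_rnd in \<open>auto simp: I_def\<close>)
  also have "\<dots> \<le> (3/4) ^ T * (real n)\<^sup>2"
  proof -
    have "I \<sigma>" using assms by (auto simp: I_def)
    then have "real (card (informed n m \<sigma>)) \<ge> 1" using card_pos[of \<sigma>] by linarith
    then have "n / real (card (informed n m \<sigma>)) \<le> n / 1" by (intro divide_left_mono) auto
    then have "\<Phi> \<sigma> \<le> n" by (simp add: \<Phi>_def)
    then have "\<Phi> \<sigma> * n \<le> real n * n" by (intro mult_right_mono) auto
    then show ?thesis by (simp add: power2_eq_square mult.assoc)
  qed
  finally show ?thesis by (simp add: exec_replicate)
qed

text \<open>Overwriting \<open>acc\<close> on both sides says in one equation that all other fields
  are untouched; projections of it are read off with \<open>arg_cong\<close>.\<close>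

lemma PullMax_frame:
  assumes "\<sigma>' \<in> set_pmf (exec n b (replicate T PullMax) \<sigma>)" "u < n"
  shows "(\<sigma>' u)\<lparr>acc := 0\<rparr> = (\<sigma> u)\<lparr>acc := 0\<rparr>"
  using assms(1)
proof (induction T arbitrary: \<sigma>)
  case (Suc T)
  then obtain \<sigma>1 where 1: "\<sigma>1 \<in> set_pmf (rnd n b PullMax \<sigma>)"
    "\<sigma>' \<in> set_pmf (exec n b (replicate T PullMax) \<sigma>1)" by auto
  from 1(1) have "(\<sigma>1 u)\<lparr>acc := 0\<rparr> = (\<sigma> u)\<lparr>acc := 0\<rparr>" using assms(2) by (auto simp: rnd_PullMax)
  with Suc.IH[OF 1(2)] show ?case by simp
qed simp

lemma PullMax_acc_le:
  assumes "\<sigma>' \<in> set_pmf (exec n b (replicate T PullMax) \<sigma>)" "\<And>u. u < n \<Longrightarrow> acc (\<sigma> u) \<le> B" "u < n"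
  shows "acc (\<sigma>' u) \<le> B"
  using assms(1,2)
proof (induction T arbitrary: \<sigma>)
  case (Suc T)
  then obtain \<sigma>1 where 1: "\<sigma>1 \<in> set_pmf (rnd n b PullMax \<sigma>)"
    "\<sigma>' \<in> set_pmf (exec n b (replicate T PullMax) \<sigma>1)" by auto
  have "acc (\<sigma>1 v) \<le> B" if "v < n" for v
    using 1(1) Suc.prems(2) that
    by (auto simp: rnd_PullMax) (meson order.trans targets_less trunc_le)
  with Suc.IH[OF 1(2)] show ?case by blast
qed (use assms in auto)

section \<open>Estimating a sum by averaging\<close>

lemma exp_le_quadratic:
  fixes x :: real
  assumes "\<bar>x\<bar> \<le> 1"
  shows "exp x \<le> 1 + x + x\<^sup>2"
proof (cases "x \<ge> 0")
  case True
  then show ?thesis using exp_bound[of x] assms by simp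
next
  case False
  define a where "a = - x"
  have a: "0 < a" "a \<le> 1" using False assms by (auto simp: a_def)
  have "exp x = inverse (exp a)" by (simp add: a_def exp_minus)
  also have "\<dots> \<le> inverse (1 + a)" using a by (intro le_imp_inverse_le) auto
  also have "\<dots> \<le> 1 - a + a\<^sup>2"
  proof -
    have "1 \<le> (1 - a + a\<^sup>2) * (1 + a)" using a by (simp add: algebra_simps power2_eq_square)
    then show ?thesis using a by (simp add: field_simps)
  qed
  finally show ?thesis by (simp add: a_def)
qed

text \<open>The new sum is half the old one plus half of \<open>n\<close> independent samples, so
  its exponential moment factorises. As y^2 \<le> y on [0,1], the second-order term is charged to
  the sum itself and not to \<open>n\<close>; this yields relative accuracy even for sums far below
  \<open>n\<close>.\<close>

lemma averaging_exp:
  fixes y :: "nat \<Rightarrow> real"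
  assumes "0 < n" "\<And>u. u < n \<Longrightarrow> 0 \<le> y u \<and> y u \<le> 1" "\<bar>\<mu>\<bar> \<le> 2"
  shows "expect (targets n) (\<lambda>t. exp (\<mu> * (\<Sum>u<n. (y u + y (t u)) / 2)))
    \<le> exp ((\<mu> + \<mu>\<^sup>2 / 4) * (\<Sum>u<n. y u))"
proof -
  define S where "S = (\<Sum>u<n. y u)"
  define \<theta> where "\<theta> = \<mu> / 2"
  have th: "\<bar>\<theta>\<bar> \<le> 1" using assms(3) by (simp add: \<theta>_def)
  have "exp (\<mu> * (\<Sum>u<n. (y u + y (t u)) / 2)) = exp (\<theta> * S) * (\<Prod>w<n. exp (\<theta> * y (t w)))" for t
    by (simp add: \<theta>_def S_def flip: exp_sum exp_add)
      (simp add: sum_divide_distrib sum_distrib_left sum.distrib field_simps flip: sum.distrib)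
  then have "expect (targets n) (\<lambda>t. exp (\<mu> * (\<Sum>u<n. (y u + y (t u)) / 2))) =
      exp (\<theta> * S) * (\<Prod>w<n. (\<Sum>v<n. exp (\<theta> * y v)) / n)"
    using assms(1) by (simp add: targets_expectation_prod[where f = "\<lambda>_ v. exp (\<theta> * y v)"])
  also have "(\<Prod>w<n. (\<Sum>v<n. exp (\<theta> * y v)) / n) \<le> (\<Prod>w<n. exp ((\<theta> + \<theta>\<^sup>2) * S / n))"
  proof (intro prod_mono conjI)
    have "(\<Sum>v<n. exp (\<theta> * y v)) \<le> (\<Sum>v<n. 1 + (\<theta> + \<theta>\<^sup>2) * y v)"
    proof (intro sum_mono)
      fix v assume "v \<in> {..<n}"
      then have y: "0 \<le> y v" "y v \<le> 1" using assms(2) by auto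
      have "\<bar>\<theta> * y v\<bar> \<le> 1" using y th by (simp add: abs_mult mult_le_one)
      then have "exp (\<theta> * y v) \<le> 1 + \<theta> * y v + (\<theta> * y v)\<^sup>2" by (rule exp_le_quadratic)
      also have "(\<theta> * y v)\<^sup>2 \<le> \<theta>\<^sup>2 * y v"
        using y mult_left_mono[of "y v * y v" "y v" "\<theta>\<^sup>2"] mult_left_le[of "y v" "y v"]
        by (simp add: power2_eq_square mult_ac)
      finally show "exp (\<theta> * y v) \<le> 1 + (\<theta> + \<theta>\<^sup>2) * y v" by (simp add: algebra_simps)
    qed
    also have "\<dots> = n + (\<theta> + \<theta>\<^sup>2) * S" by (simp add: sum.distrib S_def sum_distrib_left)
    finally have "(\<Sum>v<n. exp (\<theta> * y v)) / n \<le> 1 + (\<theta> + \<theta>\<^sup>2) * S / n"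
      using assms(1) by (simp add: field_simps)
    also have "\<dots> \<le> exp ((\<theta> + \<theta>\<^sup>2) * S / n)" by (rule exp_ge_add_one_self)
    finally show "(\<Sum>v<n. exp (\<theta> * y v)) / n \<le> exp ((\<theta> + \<theta>\<^sup>2) * S / n)" .
  qed (auto intro!: sum_nonneg divide_nonneg_nonneg)
  also have "(\<Prod>w<n. exp ((\<theta> + \<theta>\<^sup>2) * S / n)) = exp ((\<theta> + \<theta>\<^sup>2) * S)"
    using assms(1) by (simp flip: exp_of_nat_mult)
  finally have "expect (targets n) (\<lambda>t. exp (\<mu> * (\<Sum>u<n. (y u + y (t u)) / 2)))
      \<le> exp (\<theta> * S) * exp ((\<theta> + \<theta>\<^sup>2) * S)" by simp
  also have "\<dots> = exp ((\<mu> + \<mu>\<^sup>2 / 4) * S)"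
    by (simp add: \<theta>_def power2_eq_square algebra_simps flip: exp_add)
  finally show ?thesis by (simp add: S_def)
qed

text \<open>The sum of squared deviations from the mean, written such that expectations need only
  the first two moments.\<close>

definition spread_out :: "nat \<Rightarrow> (nat \<Rightarrow> real) \<Rightarrow> real" where
  "spread_out n y = (\<Sum>u<n. (y u)\<^sup>2) - (\<Sum>u<n. y u)\<^sup>2 / n"

lemma spread_out_eq:
  assumes "0 < n"
  shows "spread_out n y = (\<Sum>u<n. (y u - (\<Sum>v<n. y v) / n)\<^sup>2)"
proof -
  define S where "S = (\<Sum>v<n. y v)"
  have "(\<Sum>u<n. (y u - S / n)\<^sup>2) = (\<Sum>u<n. (y u)\<^sup>2 + (S / n)\<^sup>2 - 2 * (S / n) * y u)"
    by (intro sum.cong) (auto simp: power2_eq_square algebra_simps)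
  also have "\<dots> = (\<Sum>u<n. (y u)\<^sup>2) + n * (S / n)\<^sup>2 - 2 * (S / n) * S"
    unfolding sum.distrib sum_subtractf sum_distrib_left[symmetric] by (simp add: S_def)
  also have "\<dots> = (\<Sum>u<n. (y u)\<^sup>2) - S\<^sup>2 / n"
    using assms by (simp add: field_simps power2_eq_square)
  finally show ?thesis by (simp add: spread_out_def S_def)
qed

text \<open>With \<open>Q\<close> the sum of squares and \<open>S\<close> the sum, the expected new
  sum of squares is Q/2 + S^2/(2n). The expectation of \<open>S\<close> is preserved, so its square
  can only grow in expectation, which is the favourable direction.\<close>

lemma averaging_spread_out:
  fixes y :: "nat \<Rightarrow> real"
  assumes "0 < n"
  shows "expect (targets n) (\<lambda>t. spread_out n (\<lambda>u. (y u + y (t u)) / 2))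
    \<le> 1/2 * spread_out n y"
proof -
  define S where "S = (\<Sum>u<n. y u)"
  define Q where "Q = (\<Sum>u<n. (y u)\<^sup>2)"
  define S' where "S' = (\<lambda>t. \<Sum>u<n. (y u + y (t u)) / 2)"
  let ?E = "expect (targets n)"
  have "?E (\<lambda>t. ((y u + y (t u)) / 2)\<^sup>2) = (y u)\<^sup>2 / 4 + y u * S / (2 * n) + Q / (4 * n)" if "u < n" for u
  proof -
    have "?E (\<lambda>t. ((y u + y (t u)) / 2)\<^sup>2) = (\<Sum>v<n. ((y u + y v) / 2)\<^sup>2) / n"
      by (rule targets_expectation_coord[OF that])
    also have "(\<Sum>v<n. ((y u + y v) / 2)\<^sup>2) = (\<Sum>v<n. (y u)\<^sup>2 / 4 + y u / 2 * y v + (y v)\<^sup>2 / 4)"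
      by (intro sum.cong) (auto simp: power2_eq_square field_simps)
    also have "\<dots> = n * ((y u)\<^sup>2 / 4) + y u / 2 * S + Q / 4"
      unfolding sum.distrib sum_distrib_left[symmetric] sum_divide_distrib[symmetric]
      by (simp add: S_def Q_def)
    finally show ?thesis using assms by (simp add: field_simps)
  qed
  then have "?E (\<lambda>t. \<Sum>u<n. ((y u + y (t u)) / 2)\<^sup>2) = (\<Sum>u<n. (y u)\<^sup>2 / 4 + y u * S / (2 * n) + Q / (4 * n))"
    by (subst Bochner_Integration.integral_sum) auto
  also have "\<dots> = Q / 4 + S * S / (2 * n) + Q / 4"
    using assms by (simp add: sum.distrib S_def Q_def flip: sum_divide_distrib sum_distrib_right)
  finally have E2: "?E (\<lambda>t. \<Sum>u<n. ((y u + y (t u)) / 2)\<^sup>2) = Q / 2 + S\<^sup>2 / (2 * n)"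
    by (simp add: power2_eq_square)
  have "?E (\<lambda>t. (y u + y (t u)) / 2) = y u / 2 + S / (2 * n)" if "u < n" for u
  proof -
    have "?E (\<lambda>t. (y u + y (t u)) / 2) = (\<Sum>v<n. (y u + y v) / 2) / n"
      by (rule targets_expectation_coord[OF that])
    also have "\<dots> = y u / 2 + S / (2 * n)"
      using assms by (simp add: sum.distrib S_def field_simps flip: sum_divide_distrib)
    finally show ?thesis .
  qed
  then have "?E S' = (\<Sum>u<n. y u / 2 + S / (2 * n))"
    unfolding S'_def by (subst Bochner_Integration.integral_sum) (auto simp: add_divide_distrib mult.commute)
  also have "\<dots> = S" using assms by (simp add: sum.distrib S_def flip: sum_divide_distrib)
  finally have E1: "?E S' = S" .
  \<comment> \<open>Nonnegativity of the variance of \<open>S'\<close>.\<close>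
  have "0 \<le> ?E (\<lambda>t. (S' t - S)\<^sup>2)" by (rule Bochner_Integration.integral_nonneg) simp
  also have "\<dots> = ?E (\<lambda>t. (S' t)\<^sup>2 - 2 * S * S' t + S\<^sup>2)"
    by (simp add: power2_eq_square algebra_simps)
  also have "\<dots> = ?E (\<lambda>t. (S' t)\<^sup>2) - S\<^sup>2" by (simp add: E1 power2_eq_square)
  finally have "S\<^sup>2 \<le> ?E (\<lambda>t. (S' t)\<^sup>2)" by simp
  moreover have "?E (\<lambda>t. spread_out n (\<lambda>u. (y u + y (t u)) / 2)) =
      Q / 2 + S\<^sup>2 / (2 * n) - ?E (\<lambda>t. (S' t)\<^sup>2) / n"
    by (simp add: spread_out_def E2 S'_def)
  ultimately have "?E (\<lambda>t. spread_out n (\<lambda>u. (y u + y (t u)) / 2)) \<le> Q / 2 + S\<^sup>2 / (2 * n) - S\<^sup>2 / n"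
    by (simp add: divide_right_mono)
  also have "\<dots> = 1/2 * spread_out n y"
    by (simp add: spread_out_def S_def Q_def field_simps)
  finally show ?thesis .
qed

text \<open>Nodes add the pulled number instead of averaging, to stay within the integers; after
  \<open>r\<close> rounds all numbers carry the common factor \<open>2 ^ r\<close>.\<close>

definition average :: "nat \<Rightarrow> (nat \<Rightarrow> data) \<Rightarrow> nat \<Rightarrow> real" where
  "average r \<sigma> u = acc (\<sigma> u) / 2 ^ r"

lemma PullSum_step:
  assumes "r < b" "\<forall>u<n. acc (\<sigma> u) \<le> 2 ^ r" "\<sigma>' \<in> set_pmf (rnd n b PullSum \<sigma>)"
  shows "\<forall>u<n. acc (\<sigma>' u) \<le> 2 ^ Suc r"
proof (intro allI impI)
  fix u assume u: "u < n"
  from assms(3) obtain t where t: "t \<in> set_pmf (targets n)"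
    and \<sigma>': "acc (\<sigma>' u) = acc (\<sigma> u) + trunc b (acc (\<sigma> (t u)))"
    using u by (auto simp: rnd_PullSum)
  have "acc (\<sigma> u) \<le> 2 ^ r" "trunc b (acc (\<sigma> (t u))) \<le> 2 ^ r"
    using assms(2) u targets_less[OF t u] trunc_le[of b "acc (\<sigma> (t u))"] by (auto intro: order.trans)
  then show "acc (\<sigma>' u) \<le> 2 ^ Suc r" using \<sigma>' by simp
qed

text \<open>Transfers one-round facts about real averages to the protocol. The condition on
  \<open>F\<close> confines it to the coordinates of actual nodes, where \<open>r < b\<close> rules
  out truncation.\<close>

lemma PullSum_expectation:
  assumes "r < b" "\<forall>u<n. acc (\<sigma> u) \<le> 2 ^ r"
    and F: "\<And>y z. (\<And>u. u < n \<Longrightarrow> y u = z u) \<Longrightarrow> F y = (F z :: real)"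
  shows "expect (rnd n b PullSum \<sigma>) (\<lambda>\<sigma>'. F (average (Suc r) \<sigma>')) =
    expect (targets n) (\<lambda>t. F (\<lambda>u. (average r \<sigma> u + average r \<sigma> (t u)) / 2))"
  unfolding rnd_PullSum integral_map_pmf
proof (rule integral_cong_AE; (simp add: AE_measure_pmf_iff; intro ballI F)?)
  fix t u assume t: "t \<in> set_pmf (targets n)" and u: "u < n"
  have "acc (\<sigma> (t u)) \<le> 2 ^ r" using assms(2) targets_less[OF t u] by blast
  also have "\<dots> < (2 ^ b :: nat)" using assms(1) by simp
  finally have "trunc b (acc (\<sigma> (t u))) = acc (\<sigma> (t u))" by (rule trunc_id)
  then show "average (Suc r) (\<lambda>u. if u < n then (\<sigma> u)\<lparr>acc := acc (\<sigma> u) + trunc b (acc (\<sigma> (t u)))\<rparr>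
      else undefined) u = (average r \<sigma> u + average r \<sigma> (t u)) / 2"
    using u by (simp add: average_def field_simps)
qed

context
  fixes n b T :: nat and \<sigma> :: "nat \<Rightarrow> data"
  assumes n_pos: "0 < n" and T_pos: "1 \<le> T" and T_b: "T < b"
    and acc_le: "\<forall>u<n. acc (\<sigma> u) \<le> 1"
begin

definition I_sum :: "nat \<Rightarrow> (nat \<Rightarrow> data) \<Rightarrow> bool" where
  "I_sum j \<tau> \<longleftrightarrow> j \<le> T \<and> (\<forall>u<n. acc (\<tau> u) \<le> 2 ^ (T - j))"

lemma I_sum_step: "I_sum (Suc j) \<tau> \<Longrightarrow> \<tau>' \<in> set_pmf (rnd n b PullSum \<tau>) \<Longrightarrow> I_sum j \<tau>'"
  using PullSum_step[of "T - Suc j" b n \<tau> \<tau>'] T_b by (auto simp: I_sum_def simp flip: Suc_diff_Suc)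

lemma I_sum_start: "I_sum T \<sigma>"
  using acc_le by (simp add: I_sum_def)

text \<open>One round turns the parameter \<mu> into at most \<mu> + \<mu>^2/4
  (\<open>averaging_exp\<close>). The sequence is indexed by remaining rounds, so it has to absorb
  this growth from \<open>j\<close> to \<open>Suc j\<close>.\<close>

lemma PullSum_exp_moment:
  fixes \<mu> :: "nat \<Rightarrow> real"
  assumes \<mu>: "\<And>j. j < T \<Longrightarrow> \<bar>\<mu> j\<bar> \<le> 2 \<and> \<mu> j + (\<mu> j)\<^sup>2 / 4 \<le> \<mu> (Suc j)"
  shows "expect (exec n b (replicate T PullSum) \<sigma>) (\<lambda>\<tau>. exp (\<mu> 0 * (\<Sum>u<n. average T \<tau> u)))
    \<le> exp (\<mu> T * (\<Sum>u<n. real (acc (\<sigma> u))))"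
proof -
  let ?\<Phi> = "\<lambda>j \<tau>. exp (\<mu> j * (\<Sum>u<n. average (T - j) \<tau> u))"
  have "expect (chain (rnd n b PullSum) T \<sigma>) (?\<Phi> 0) \<le> ?\<Phi> T \<sigma>"
  proof (rule chain_expectation[where I = I_sum])
    fix j \<tau> assume I: "I_sum (Suc j) \<tau>"
    define r where "r = T - Suc j"
    have r: "Suc r = T - j" "r < b" "j < T" using I T_b by (auto simp: r_def I_sum_def)
    have le: "\<forall>u<n. acc (\<tau> u) \<le> 2 ^ r" using I by (simp add: I_sum_def r_def)
    have "expect (rnd n b PullSum \<tau>) (\<lambda>\<tau>'. exp (\<mu> j * (\<Sum>u<n. average (Suc r) \<tau>' u))) =
      expect (targets n) (\<lambda>t. exp (\<mu> j * (\<Sum>u<n. (average r \<tau> u + average r \<tau> (t u)) / 2)))"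
      by (intro PullSum_expectation[where F = "\<lambda>y. exp (\<mu> j * (\<Sum>u<n. y u))"] r le) simp
    also have "\<dots> \<le> exp ((\<mu> j + (\<mu> j)\<^sup>2 / 4) * (\<Sum>u<n. average r \<tau> u))"
    proof (intro averaging_exp n_pos)
      fix u assume "u < n"
      then have "real (acc (\<tau> u)) \<le> real (2 ^ r)" using le of_nat_le_iff by blast
      then show "0 \<le> average r \<tau> u \<and> average r \<tau> u \<le> 1" by (simp add: average_def)
    qed (use \<mu> r in auto)
    also have "\<dots> \<le> exp (\<mu> (Suc j) * (\<Sum>u<n. average r \<tau> u))"
      using \<mu> r by (auto intro!: mult_right_mono sum_nonneg simp: average_def)
    finally show "expect (rnd n b PullSum \<tau>) (?\<Phi> j) \<le> ?\<Phi> (Suc j) \<tau>"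
      by (simp flip: r(1) r_def)
  qed (use I_sum_step I_sum_start finite_set_rnd in auto)
  then show ?thesis by (simp add: exec_replicate average_def)
qed

lemma PullSum_finite: "finite (set_pmf (exec n b (replicate T PullSum) \<sigma>))"
  by (simp add: exec_replicate finite_set_chain finite_set_rnd)

text \<open>The parameter moves from 1/T to 2/T in steps of 1/T^2, each of which pays for \<mu>^2/4
  because \<mu> \<le> 2/T. Markov's inequality at the level 3K leaves 2K/T - 3K/T in the
  exponent.\<close>

lemma PullSum_upper:
  assumes "(\<Sum>u<n. real (acc (\<sigma> u))) \<le> K"
  shows "prob (exec n b (replicate T PullSum) \<sigma>) {\<tau>. (\<Sum>u<n. average T \<tau> u) > 3 * K} \<le> exp (- K / T)"
proof -
  define \<mu> where "\<mu> j = 1 / real T + real j / (real T)\<^sup>2" for j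
  have "expect (exec n b (replicate T PullSum) \<sigma>) (\<lambda>\<tau>. exp (\<mu> 0 * (\<Sum>u<n. average T \<tau> u)))
    \<le> exp (\<mu> T * (\<Sum>u<n. real (acc (\<sigma> u))))"
  proof (rule PullSum_exp_moment)
    fix j assume "j < T"
    then have "j / (real T)\<^sup>2 \<le> T / (real T)\<^sup>2" by (intro divide_right_mono) auto
    then have le: "0 \<le> \<mu> j" "\<mu> j \<le> 2 / T" using T_pos by (auto simp: \<mu>_def power2_eq_square)
    have "2 / real T \<le> 2" using T_pos by (simp add: field_simps)
    moreover have "(\<mu> j)\<^sup>2 / 4 \<le> (2 / T)\<^sup>2 / 4" using le by (intro divide_right_mono power_mono) auto
    then have "(\<mu> j)\<^sup>2 / 4 \<le> 1 / (real T)\<^sup>2" by (simp add: power_divide)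
    ultimately show "\<bar>\<mu> j\<bar> \<le> 2 \<and> \<mu> j + (\<mu> j)\<^sup>2 / 4 \<le> \<mu> (Suc j)"
      using le by (simp add: \<mu>_def add_divide_distrib)
  qed
  also have "\<mu> T = 2 / T" using T_pos by (simp add: \<mu>_def power2_eq_square)
  also have "exp (2 / T * (\<Sum>u<n. real (acc (\<sigma> u)))) \<le> exp (2 / T * K)"
    using assms T_pos by (auto intro!: divide_right_mono)
  finally have "expect (exec n b (replicate T PullSum) \<sigma>)
      (\<lambda>\<tau>. exp ((\<Sum>u<n. average T \<tau> u) / T)) \<le> exp (2 / T * K)"
    by (simp add: \<mu>_def)
  then have "prob (exec n b (replicate T PullSum) \<sigma>) {\<tau>. (\<Sum>u<n. average T \<tau> u) > 3 * K}
      \<le> exp (2 / T * K) / exp (3 * K / T)"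
    using T_pos by (intro markov_finite[where \<Phi> = "\<lambda>\<tau>. exp ((\<Sum>u<n. average T \<tau> u) / T)"] PullSum_finite)
      (auto intro!: divide_right_mono)
  also have "\<dots> = exp (- K / T)" by (simp add: field_simps flip: exp_diff)
  finally show ?thesis .
qed

text \<open>The same with negative parameters, moving from -1/T to -3/(4T) in steps of 1/(4T^2). The
  level S/2 costs S/(2T), which leaves -S/(4T) in the exponent.\<close>

lemma PullSum_lower:
  defines "S \<equiv> \<Sum>u<n. real (acc (\<sigma> u))"
  shows "prob (exec n b (replicate T PullSum) \<sigma>) {\<tau>. (\<Sum>u<n. average T \<tau> u) < S / 2} \<le> exp (- S / (4 * T))"
proof -
  define \<mu> where "\<mu> j = - 1 / real T + real j / (4 * (real T)\<^sup>2)" for j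
  have S: "S \<ge> 0" by (auto simp: S_def intro!: sum_nonneg)
  have "expect (exec n b (replicate T PullSum) \<sigma>) (\<lambda>\<tau>. exp (\<mu> 0 * (\<Sum>u<n. average T \<tau> u)))
    \<le> exp (\<mu> T * S)"
    unfolding S_def
  proof (rule PullSum_exp_moment)
    fix j assume "j < T"
    then have "j / (4 * (real T)\<^sup>2) \<le> T / (4 * (real T)\<^sup>2)" by (intro divide_right_mono) auto
    also have "\<dots> = 1 / (4 * T)" using T_pos by (simp add: power2_eq_square)
    also have "\<dots> \<le> 1 / T" using T_pos by (simp add: field_simps)
    finally have le: "\<mu> j \<le> 0" "- (1 / T) \<le> \<mu> j" by (auto simp: \<mu>_def)
    have "1 / real T \<le> 1" using T_pos by (simp add: field_simps)
    moreover have "(- \<mu> j)\<^sup>2 / 4 \<le> (1 / T)\<^sup>2 / 4" using le by (intro divide_right_mono power_mono) auto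
    then have "(\<mu> j)\<^sup>2 / 4 \<le> 1 / (4 * (real T)\<^sup>2)" by (simp only: power2_minus) (simp add: power_divide)
    moreover have "\<mu> (Suc j) = \<mu> j + 1 / (4 * (real T)\<^sup>2)" by (simp add: \<mu>_def add_divide_distrib)
    ultimately show "\<bar>\<mu> j\<bar> \<le> 2 \<and> \<mu> j + (\<mu> j)\<^sup>2 / 4 \<le> \<mu> (Suc j)"
      using le by linarith
  qed
  also have "\<mu> T = - 3 / (4 * T)" using T_pos by (simp add: \<mu>_def power2_eq_square field_simps)
  finally have "prob (exec n b (replicate T PullSum) \<sigma>) {\<tau>. (\<Sum>u<n. average T \<tau> u) < S / 2}
      \<le> exp (- 3 / (4 * T) * S) / exp (- S / (2 * T))"
    using T_pos
    by (intro markov_finite[where \<Phi> = "\<lambda>\<tau>. exp (- 1 / real T * (\<Sum>u<n. average T \<tau> u))"] PullSum_finite)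
      (auto simp: \<mu>_def field_simps)
  also have "\<dots> = exp (- S / (4 * T))" using T_pos by (simp add: field_simps flip: exp_diff)
  finally show ?thesis .
qed

text \<open>A node whose scaled average is off by 1/4 contributes at least 1/(16 n^2) to
  \<open>spread_out\<close>, which starts at most at \<open>n\<close> and is halved in expectation
  by every round.\<close>

lemma PullSum_deviation:
  "prob (exec n b (replicate T PullSum) \<sigma>)
     {\<tau>. \<not> (\<forall>u<n. \<bar>n * average T \<tau> u - (\<Sum>u<n. average T \<tau> u)\<bar> < 1/4)} \<le> 16 * real n ^ 3 / 2 ^ T"
proof -
  let ?\<Phi> = "\<lambda>j \<tau>. (1/2) ^ j * spread_out n (average (T - j) \<tau>)"
  have "expect (chain (rnd n b PullSum) T \<sigma>) (?\<Phi> 0) \<le> ?\<Phi> T \<sigma>"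
  proof (rule chain_expectation[where I = I_sum])
    fix j \<tau> assume I: "I_sum (Suc j) \<tau>"
    define r where "r = T - Suc j"
    have r: "Suc r = T - j" "r < b" using I T_b by (auto simp: r_def I_sum_def)
    have le: "\<forall>u<n. acc (\<tau> u) \<le> 2 ^ r" using I by (simp add: I_sum_def r_def)
    have "expect (rnd n b PullSum \<tau>) (\<lambda>\<tau>'. spread_out n (average (Suc r) \<tau>')) =
      expect (targets n) (\<lambda>t. spread_out n (\<lambda>u. (average r \<tau> u + average r \<tau> (t u)) / 2))"
      by (intro PullSum_expectation r le) (simp add: spread_out_def)
    also have "\<dots> \<le> 1/2 * spread_out n (average r \<tau>)"
      by (intro averaging_spread_out n_pos)
    finally have "(1/2) ^ j * expect (rnd n b PullSum \<tau>) (\<lambda>\<tau>'. spread_out n (average (Suc r) \<tau>'))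
      \<le> (1/2) ^ j * (1/2 * spread_out n (average r \<tau>))" by (intro mult_left_mono) auto
    then show "expect (rnd n b PullSum \<tau>) (?\<Phi> j) \<le> ?\<Phi> (Suc j) \<tau>"
      by (simp flip: r(1) r_def)
  qed (use I_sum_step I_sum_start finite_set_rnd in auto)
  then have "expect (exec n b (replicate T PullSum) \<sigma>) (\<lambda>\<tau>. spread_out n (average T \<tau>))
      \<le> (1/2) ^ T * spread_out n (average 0 \<sigma>)" by (simp add: exec_replicate)
  also have "spread_out n (average 0 \<sigma>) \<le> n"
  proof -
    have "(\<Sum>u<n. (real (acc (\<sigma> u)))\<^sup>2) \<le> (\<Sum>u<n. 1)"
      using acc_le by (intro sum_mono) (auto simp: power_le_one)
    then have "(\<Sum>u<n. (real (acc (\<sigma> u)))\<^sup>2) \<le> n" by simp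
    moreover have "0 \<le> (\<Sum>u<n. real (acc (\<sigma> u)))\<^sup>2 / n" by simp
    moreover have "spread_out n (average 0 \<sigma>) =
        (\<Sum>u<n. (real (acc (\<sigma> u)))\<^sup>2) - (\<Sum>u<n. real (acc (\<sigma> u)))\<^sup>2 / n"
      by (simp add: spread_out_def average_def)
    ultimately show ?thesis by linarith
  qed
  finally have E: "expect (exec n b (replicate T PullSum) \<sigma>) (\<lambda>\<tau>. spread_out n (average T \<tau>))
      \<le> (1/2) ^ T * n" by simp
  have "prob (exec n b (replicate T PullSum) \<sigma>)
     {\<tau>. \<not> (\<forall>u<n. \<bar>n * average T \<tau> u - (\<Sum>u<n. average T \<tau> u)\<bar> < 1/4)} \<le> (1/2) ^ T * n / (1 / (16 * (real n)\<^sup>2))"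
  proof (rule markov_finite[OF PullSum_finite _ _ _ E])
    fix \<tau>
    show "0 \<le> spread_out n (average T \<tau>)" using n_pos by (simp add: spread_out_eq sum_nonneg)
    define S where "S = (\<Sum>u<n. average T \<tau> u)"
    assume "\<tau> \<in> {\<tau>. \<not> (\<forall>u<n. \<bar>n * average T \<tau> u - (\<Sum>u<n. average T \<tau> u)\<bar> < 1/4)}"
    then obtain u where u: "u < n" "\<bar>n * average T \<tau> u - S\<bar> \<ge> 1/4" by (force simp: S_def)
    have "n * average T \<tau> u - S = n * (average T \<tau> u - S / n)" using n_pos by (simp add: field_simps)
    then have "1/4 \<le> n * \<bar>average T \<tau> u - S / n\<bar>" using u(2) by (simp add: abs_mult)
    then have "1 / (4 * n) \<le> \<bar>average T \<tau> u - S / n\<bar>" using n_pos by (simp add: field_simps)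
    then have "(1 / (4 * n))\<^sup>2 \<le> \<bar>average T \<tau> u - S / n\<bar>\<^sup>2" by (intro power_mono) auto
    also have "\<dots> \<le> (\<Sum>u<n. (average T \<tau> u - S / n)\<^sup>2)"
      using u(1) by (subst power2_abs, intro member_le_sum) auto
    finally show "1 / (16 * (real n)\<^sup>2) \<le> spread_out n (average T \<tau>)"
      using n_pos by (simp add: spread_out_eq S_def power_divide power_mult_distrib)
  qed (use n_pos in auto)
  also have "\<dots> = 16 * real n ^ 3 / 2 ^ T"
    by (simp add: power_one_over field_simps power2_eq_square power3_eq_cube)
  finally show ?thesis .
qed

end

lemma PullSum_frame:
  assumes "\<sigma>' \<in> set_pmf (exec n b (replicate T PullSum) \<sigma>)" "u < n"
  shows "(\<sigma>' u)\<lparr>acc := 0\<rparr> = (\<sigma> u)\<lparr>acc := 0\<rparr>"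
  using assms(1)
proof (induction T arbitrary: \<sigma>)
  case (Suc T)
  then obtain \<sigma>1 where 1: "\<sigma>1 \<in> set_pmf (rnd n b PullSum \<sigma>)"
    "\<sigma>' \<in> set_pmf (exec n b (replicate T PullSum) \<sigma>1)" by auto
  from 1(1) have "(\<sigma>1 u)\<lparr>acc := 0\<rparr> = (\<sigma> u)\<lparr>acc := 0\<rparr>" using assms(2) by (auto simp: rnd_PullSum)
  with Suc.IH[OF 1(2)] show ?case by simp
qed simp

section \<open>Spreading tokens\<close>

text \<open>The constant weight 1 counts copies, the indicator of a value counts the copies of that
  value. Conservation for every \<open>f\<close> thus keeps track of all values at once.\<close>

definition quota :: "(nat \<Rightarrow> nat) \<Rightarrow> token list \<Rightarrow> nat" where
  "quota f s = (\<Sum>x\<leftarrow>s. f (fst x) * 2 ^ snd x)"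

definition total_quota :: "nat \<Rightarrow> (nat \<Rightarrow> nat) \<Rightarrow> (nat \<Rightarrow> data) \<Rightarrow> nat" where
  "total_quota n f \<sigma> = (\<Sum>u<n. quota f (stk (\<sigma> u)))"

definition settled :: "token list \<Rightarrow> bool" where
  "settled s \<longleftrightarrow> s = [] \<or> (\<exists>v. s = [(v, 0)])"

definition all_settled :: "nat \<Rightarrow> (nat \<Rightarrow> data) \<Rightarrow> bool" where
  "all_settled n \<sigma> \<longleftrightarrow> (\<forall>u<n. settled (stk (\<sigma> u)))"

definition token_bound :: "nat \<Rightarrow> nat \<Rightarrow> token list \<Rightarrow> bool" where
  "token_bound B E s \<longleftrightarrow> (\<forall>x\<in>set s. fst x \<le> B \<and> snd x \<le> E)"

definition tokens_bounded :: "nat \<Rightarrow> nat \<Rightarrow> nat \<Rightarrow> (nat \<Rightarrow> data) \<Rightarrow> bool" where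
  "tokens_bounded n B E \<sigma> \<longleftrightarrow> (\<forall>u<n. token_bound B E (stk (\<sigma> u)))"

definition pushed_quota :: "(nat \<Rightarrow> nat) \<Rightarrow> token list \<Rightarrow> nat" where
  "pushed_quota f s = (case push_token s of None \<Rightarrow> 0 | Some x \<Rightarrow> f (fst x) * 2 ^ snd x)"

lemma quota_split: "quota f s = quota f (kept s) + pushed_quota f s"
  by (cases s rule: kept.cases) (auto simp: quota_def pushed_quota_def)

lemma token_bound_push: "token_bound B E s \<Longrightarrow> push_token s = Some x \<Longrightarrow> fst x \<le> B \<and> snd x \<le> E"
  by (cases s rule: kept.cases) (auto simp: token_bound_def split: if_splits)

lemma token_bound_kept: "token_bound B E s \<Longrightarrow> token_bound B E (kept s)"
  by (cases s rule: kept.cases) (auto simp: token_bound_def split: if_splits)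

lemma sum_mset_sum: "sum_mset (image_mset f (\<Sum>w\<in>A. g w)) = (\<Sum>w\<in>A. sum_mset (image_mset f (g w)))"
  for f :: "'a \<Rightarrow> 'b::comm_monoid_add"
  by (induction A rule: infinite_finite_induct) auto

lemma prod_mset_sum: "prod_mset (image_mset f (\<Sum>w\<in>A. g w)) = (\<Prod>w\<in>A. prod_mset (image_mset f (g w)))"
  for f :: "'a \<Rightarrow> 'b::comm_monoid_mult"
  by (induction A rule: infinite_finite_induct) auto

lemma set_mset_sum: "finite A \<Longrightarrow> set_mset (\<Sum>w\<in>A. g w) = (\<Union>w\<in>A. set_mset (g w))"
  by (induction A rule: finite_induct) auto

locale spreading =
  fixes n b B E :: nat
  assumes n_pos: "0 < n"
    and fits: "\<And>v g. v \<le> B \<Longrightarrow> g \<le> E \<Longrightarrow> prod_encode (v, g) < 2 ^ b"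
begin

lemma mset_arrivals_within:
  assumes "\<forall>w<n. token_bound B E (s w)"
  shows "mset (arrivals n b s t u) =
    (\<Sum>w<n. case push_token (s w) of None \<Rightarrow> {#} | Some x \<Rightarrow> (if t w = u then {#x#} else {#}))"
proof (rule mset_arrivals)
  fix w x assume "w < n" "push_token (s w) = Some x"
  then have "fst x \<le> B \<and> snd x \<le> E" using assms token_bound_push by blast
  then show "prod_encode x < 2 ^ b" using fits[of "fst x" "snd x"] by simp
qed

lemma sum_list_arrivals:
  fixes F :: "token \<Rightarrow> 'a::comm_monoid_add"
  assumes "\<forall>w<n. token_bound B E (s w)"
  shows "(\<Sum>x\<leftarrow>arrivals n b s t u. F x) =
    (\<Sum>w<n. if t w = u then (case push_token (s w) of None \<Rightarrow> 0 | Some x \<Rightarrow> F x) else 0)"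
proof -
  have "(\<Sum>x\<leftarrow>arrivals n b s t u. F x) = sum_mset (image_mset F (mset (arrivals n b s t u)))"
    by (metis mset_map sum_mset_sum_list)
  also have "\<dots> = (\<Sum>w<n. if t w = u then (case push_token (s w) of None \<Rightarrow> 0 | Some x \<Rightarrow> F x) else 0)"
    unfolding mset_arrivals_within[OF assms] sum_mset_sum
    by (intro sum.cong) (auto split: option.splits)
  finally show ?thesis .
qed

lemma prod_list_arrivals:
  fixes F :: "token \<Rightarrow> 'a::comm_monoid_mult"
  assumes "\<forall>w<n. token_bound B E (s w)"
  shows "(\<Prod>x\<leftarrow>arrivals n b s t u. F x) =
    (\<Prod>w<n. if t w = u then (case push_token (s w) of None \<Rightarrow> 1 | Some x \<Rightarrow> F x) else 1)"
proof -
  have "(\<Prod>x\<leftarrow>arrivals n b s t u. F x) = prod_mset (image_mset F (mset (arrivals n b s t u)))"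
    by (metis mset_map prod_mset_prod_list)
  also have "\<dots> = (\<Prod>w<n. if t w = u then (case push_token (s w) of None \<Rightarrow> 1 | Some x \<Rightarrow> F x) else 1)"
    unfolding mset_arrivals_within[OF assms] prod_mset_sum
    by (intro prod.cong) (auto split: option.splits)
  finally show ?thesis .
qed

lemma Spread_obtain:
  assumes "\<sigma>' \<in> set_pmf (rnd n b Spread \<sigma>)"
  obtains t where "t \<in> set_pmf (targets n)"
    "\<And>u. u < n \<Longrightarrow> \<sigma>' u = (\<sigma> u)\<lparr>stk := arrivals n b (\<lambda>w. stk (\<sigma> w)) t u @ kept (stk (\<sigma> u))\<rparr>"
  using assms by (auto simp: rnd_Spread)

lemma Spread_within:
  assumes "tokens_bounded n B E \<sigma>" "\<sigma>' \<in> set_pmf (rnd n b Spread \<sigma>)"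
  shows "tokens_bounded n B E \<sigma>'"
  unfolding tokens_bounded_def
proof (intro allI impI)
  fix u assume u: "u < n"
  have wi: "\<forall>w<n. token_bound B E (stk (\<sigma> w))" using assms(1) by (simp add: tokens_bounded_def)
  obtain t where t: "\<And>u. u < n \<Longrightarrow> stk (\<sigma>' u) = arrivals n b (\<lambda>w. stk (\<sigma> w)) t u @ kept (stk (\<sigma> u))"
    by (rule Spread_obtain[OF assms(2)]) simp
  have "set (arrivals n b (\<lambda>w. stk (\<sigma> w)) t u) = set_mset (mset (arrivals n b (\<lambda>w. stk (\<sigma> w)) t u))" by simp
  also have "\<dots> \<subseteq> {x. \<exists>w<n. push_token (stk (\<sigma> w)) = Some x}"
    unfolding mset_arrivals_within[OF wi] by (subst set_mset_sum) (auto split: option.splits if_splits)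
  finally have arr: "fst x \<le> B \<and> snd x \<le> E" if "x \<in> set (arrivals n b (\<lambda>w. stk (\<sigma> w)) t u)" for x
    using that wi token_bound_push by blast
  have "token_bound B E (kept (stk (\<sigma> u)))" using wi u by (intro token_bound_kept) blast
  then show "token_bound B E (stk (\<sigma>' u))"
    using arr unfolding token_bound_def t[OF u] by auto
qed

text \<open>Every pushed token reaches exactly one node, whatever the targets are. The equation
  holds on all runs and not only with high probability, as exactness requires.\<close>

lemma Spread_quota:
  assumes "tokens_bounded n B E \<sigma>" "\<sigma>' \<in> set_pmf (rnd n b Spread \<sigma>)"
  shows "total_quota n f \<sigma>' = total_quota n f \<sigma>"
proof -
  have wi: "\<forall>w<n. token_bound B E (stk (\<sigma> w))" using assms(1) by (simp add: tokens_bounded_def)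
  obtain t where t: "t \<in> set_pmf (targets n)"
    and \<sigma>': "\<And>u. u < n \<Longrightarrow> stk (\<sigma>' u) = arrivals n b (\<lambda>w. stk (\<sigma> w)) t u @ kept (stk (\<sigma> u))"
    by (rule Spread_obtain[OF assms(2)]) simp
  have "total_quota n f \<sigma>' = (\<Sum>u<n. quota f (arrivals n b (\<lambda>w. stk (\<sigma> w)) t u) + quota f (kept (stk (\<sigma> u))))"
    by (simp add: total_quota_def \<sigma>' quota_def)
  also have "\<dots> = (\<Sum>u<n. \<Sum>w<n. if t w = u then pushed_quota f (stk (\<sigma> w)) else 0) + (\<Sum>u<n. quota f (kept (stk (\<sigma> u))))"
    unfolding sum.distrib quota_def[of f "arrivals _ _ _ _ _"] sum_list_arrivals[OF wi] pushed_quota_def ..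
  also have "(\<Sum>u<n. \<Sum>w<n. if t w = u then pushed_quota f (stk (\<sigma> w)) else 0) =
      (\<Sum>w<n. \<Sum>u<n. if t w = u then pushed_quota f (stk (\<sigma> w)) else 0)" by (rule sum.swap)
  also have "\<dots> = (\<Sum>w<n. pushed_quota f (stk (\<sigma> w)))"
    using targets_less[OF t] by (intro sum.cong) auto
  also have "(\<Sum>w<n. pushed_quota f (stk (\<sigma> w))) + (\<Sum>u<n. quota f (kept (stk (\<sigma> u)))) = total_quota n f \<sigma>"
    by (simp add: total_quota_def quota_split[of f "stk _"] sum.distrib)
  finally show ?thesis .
qed

lemma Spread_invariants:
  assumes "\<sigma>' \<in> set_pmf (exec n b (replicate T Spread) \<sigma>)" "tokens_bounded n B E \<sigma>"
  shows "tokens_bounded n B E \<sigma>'" "total_quota n f \<sigma>' = total_quota n f \<sigma>"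
proof -
  have "(\<lambda>_ \<sigma>'. tokens_bounded n B E \<sigma>' \<and> total_quota n f \<sigma>' = total_quota n f \<sigma>) 0 \<sigma>'"
    using assms Spread_within Spread_quota
    by (intro chain_invariant[where K = "rnd n b Spread" and x = \<sigma> and T = T and y = \<sigma>'
      and I = "\<lambda>_ \<sigma>'. tokens_bounded n B E \<sigma>' \<and> total_quota n f \<sigma>' = total_quota n f \<sigma>"])
      (auto simp: exec_replicate)
  then show "tokens_bounded n B E \<sigma>'" "total_quota n f \<sigma>' = total_quota n f \<sigma>" by auto
qed

end

lemma Spread_frame:
  assumes "\<sigma>' \<in> set_pmf (exec n b (replicate T Spread) \<sigma>)" "u < n"
  shows "(\<sigma>' u)\<lparr>stk := []\<rparr> = (\<sigma> u)\<lparr>stk := []\<rparr>"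
  using assms(1)
proof (induction T arbitrary: \<sigma>)
  case (Suc T)
  then obtain \<sigma>1 where 1: "\<sigma>1 \<in> set_pmf (rnd n b Spread \<sigma>)"
    "\<sigma>' \<in> set_pmf (exec n b (replicate T Spread) \<sigma>1)" by auto
  from 1(1) have "(\<sigma>1 u)\<lparr>stk := []\<rparr> = (\<sigma> u)\<lparr>stk := []\<rparr>" using assms(2) by (auto simp: rnd_Spread)
  with Suc.IH[OF 1(2)] show ?case by simp
qed simp

text \<open>Covers a replication by the factor 1: the tokens may then be too dense for the
  contraction argument, but settled stacks never push.\<close>

lemma Spread_idle:
  assumes "\<sigma>' \<in> set_pmf (exec n b (replicate T Spread) \<sigma>)" "all_settled n \<sigma>" "u < n"
  shows "stk (\<sigma>' u) = stk (\<sigma> u)"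
  using assms(1,2)
proof (induction T arbitrary: \<sigma>)
  case (Suc T)
  then obtain \<sigma>1 where 1: "\<sigma>1 \<in> set_pmf (rnd n b Spread \<sigma>)"
    "\<sigma>' \<in> set_pmf (exec n b (replicate T Spread) \<sigma>1)" by auto
  have none: "push_token (stk (\<sigma> w)) = None" "kept (stk (\<sigma> w)) = stk (\<sigma> w)" if "w < n" for w
    using Suc.prems(2) that by (auto simp: all_settled_def settled_def)
  have none': "(\<Sum>w<n. case push_token (stk (\<sigma> w)) of None \<Rightarrow> {#}
        | Some x \<Rightarrow> (if t w = u then {#trunc b (prod_encode x)#} else {#})) = {#}" for t u
    by (intro sum.neutral) (auto simp: none)
  have arr: "arrivals n b (\<lambda>w. stk (\<sigma> w)) t u = []" for t u
    unfolding arrivals_def none' by simp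
  from 1(1) have eq: "stk (\<sigma>1 w) = stk (\<sigma> w)" if "w < n" for w
    using that by (auto simp: rnd_Spread arr none)
  then have "all_settled n \<sigma>1" using Suc.prems(2) by (simp add: all_settled_def)
  with Suc.IH[OF 1(2)] eq assms(3) show ?case by simp
qed simp

text \<open>
  The weight of a token bounds the work still to be done on the copies it stands for; it is
  inflated by a factor \<open>5/4\<close> for every push that its node has to make before turning to it.
  The stacks are served last in, first out, so that the load of the receiving node does not
  delay a token that arrives.
\<close>

fun potential :: "token list \<Rightarrow> real" where
  "potential [] = 0"
| "potential ((v, g) # s) = (if s = [] \<and> g = 0 then 0 else (5/2) ^ g) + (5/4) ^ Suc g * potential s"

lemma potential_nonneg: "potential s \<ge> 0"
  by (induction s rule: potential.induct) auto

lemma potential_unsettled: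
  assumes "\<not> settled s"
  shows "potential s \<ge> 1"
proof (cases s)
  case (Cons x s')
  obtain v g where x: "x = (v, g)" by (cases x)
  have "(1::real) \<le> (5/2) ^ g" by (rule one_le_power) simp
  moreover have "0 \<le> (5/4) ^ Suc g * potential s'" by (simp add: potential_nonneg)
  moreover have "potential s = (5/2) ^ g + (5/4) ^ Suc g * potential s'"
    using assms Cons x by (auto simp: settled_def)
  ultimately show ?thesis by linarith
qed (use assms in \<open>auto simp: settled_def\<close>)

text \<open>The inflation of an arriving token by those above it is bounded by the product of all
  inflation factors divided by its own. This bound is symmetric in the arrivals and hence computable
  from independent targets.\<close>

lemma potential_append:
  "potential (l @ s) \<le> (\<Prod>x\<leftarrow>l. (5/4) ^ Suc (snd x)) *
     (potential s + (\<Sum>x\<leftarrow>l. (5/2) ^ snd x / (5/4) ^ Suc (snd x)))"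
proof (induction l)
  case (Cons x l)
  define P where "P = (\<Prod>x\<leftarrow>l. (5/4 :: real) ^ Suc (snd x))"
  define R where "R = potential s + (\<Sum>x\<leftarrow>l. (5/2) ^ snd x / (5/4) ^ Suc (snd x))"
  obtain v g where x: "x = (v, g)" by (cases x)
  have "1 \<le> (\<Prod>y\<leftarrow>l'. (5/4 :: real) ^ Suc (snd y))" for l' :: "token list"
  proof (induction l')
    case (Cons y l')
    have "1 * 1 \<le> (5/4 :: real) ^ Suc (snd y) * (\<Prod>y\<leftarrow>l'. (5/4 :: real) ^ Suc (snd y))"
      using Cons by (intro mult_mono one_le_power) auto
    then show ?case by simp
  qed simp
  then have P: "P \<ge> 1" by (simp add: P_def)
  have "potential ((x # l) @ s) \<le> (5/2) ^ g + (5/4) ^ Suc g * potential (l @ s)" by (simp add: x)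
  also have "\<dots> \<le> P * (5/2) ^ g + (5/4) ^ Suc g * (P * R)"
    using Cons P by (intro add_mono mult_left_mono) (auto simp: P_def R_def)
  also have "\<dots> = (5/4) ^ Suc g * P * (R + (5/2) ^ g / (5/4) ^ Suc g)"
    by (simp add: distrib_left)
  finally show ?case by (simp add: x P_def R_def add_ac)
qed simp

section \<open>Contraction of the potential in one round of spreading\<close>

definition push_factor :: "token list \<Rightarrow> real" where
  "push_factor s = (case push_token s of None \<Rightarrow> 1 | Some x \<Rightarrow> (5/4) ^ Suc (snd x))"

definition push_potential :: "token list \<Rightarrow> real" where
  "push_potential s = (case push_token s of None \<Rightarrow> 0 | Some x \<Rightarrow> (5/2) ^ snd x)"

text \<open>Single copies are singled out because pushing them makes no progress by halving; their
  progress is the chance to land alone and settle.\<close>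

definition unit_push :: "token list \<Rightarrow> bool" where
  "unit_push s \<longleftrightarrow> (\<exists>v. push_token s = Some (v, 0))"

text \<open>The origin of the bases: two halves weigh 2 (5/2)^g = 4/5 (5/2)^(g+1), and the inflation
  of what lies below drops by 4/5 with every push. A pushed single copy keeps its weight 1, so it
  needs a discount of 4/5 from elsewhere; \<open>Spread_contraction\<close> supplies it.\<close>

lemma potential_split:
  "potential (kept s) + (if unit_push s then 4/5 else 1) * push_potential s \<le> 4/5 * potential s"
proof (cases s rule: kept.cases)
  case (2 v g s')
  have "potential (kept s) \<le> (5/2) ^ g + (5/4) ^ Suc g * potential s'" using 2 by simp
  moreover have "(if unit_push s then 4/5 else 1) * push_potential s \<le> (5/2) ^ g"
    using 2 by (simp add: push_potential_def)
  ultimately show ?thesis using 2 by (simp add: algebra_simps)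
next
  case (3 v s')
  then show ?thesis by (auto simp: push_potential_def unit_push_def)
qed (auto simp: push_potential_def unit_push_def)

text \<open>The constant 9/32 is determined by exponent 1, where (5/4)^2 = 1 + 2 * 9/32.\<close>

lemma push_factor_le: "push_factor s \<le> 1 + 9/32 * pushed_quota (\<lambda>_. 1) s"
proof -
  have *: "(5/4 :: real) ^ Suc g \<le> 1 + 9/32 * 2 ^ g" for g :: nat
  proof (induction g)
    case (Suc g)
    show ?case
    \<comment> \<open>The step from exponent 0 to 1 is computed directly: the bound at 0 has slack,
      and 5/4 times it would exceed the tight bound at 1.\<close>
    proof (cases g)
      case (Suc h)
      define q :: real where "q = 2 ^ h"
      have "q \<ge> 1" unfolding q_def by (rule one_le_power) simp
      moreover have eq: "2 ^ g = 2 * q" "2 ^ Suc g = 4 * q" using Suc by (auto simp: q_def)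
      ultimately have "5/4 * (1 + 9/32 * 2 ^ g) \<le> 1 + 9/32 * (2::real) ^ Suc g"
        unfolding eq by (simp add: field_simps)
      moreover have "(5/4 :: real) ^ Suc (Suc g) \<le> 5/4 * (1 + 9/32 * 2 ^ g)" using Suc.IH by simp
      ultimately show ?thesis by linarith
    qed (simp add: power2_eq_square)
  qed simp
  show ?thesis using * by (auto simp: push_factor_def pushed_quota_def split: option.split)
qed

lemma push_factor_ge: "1 \<le> push_factor s"
proof -
  have "1 \<le> (5/4 :: real) ^ Suc g" for g by (rule one_le_power) simp
  then show ?thesis by (auto simp: push_factor_def split: option.split)
qed

lemma push_factor_le_quota:
  assumes "push_token s \<noteq> None"
  shows "push_factor s \<le> 5/4 * pushed_quota (\<lambda>_. 1) s"
proof -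
  have "(5/4 :: real) ^ g \<le> 2 ^ g" for g by (rule power_mono) auto
  then show ?thesis using assms by (auto simp: push_factor_def pushed_quota_def)
qed

text \<open>One factor per sender, so that expectations factorise: senders in \<open>A\<close> are
  required to hit \<open>u\<close> and contribute \<open>Z\<close>, all others contribute
  \<open>X\<close> in case they hit \<open>u\<close>.\<close>

definition hits :: "nat \<Rightarrow> (nat \<Rightarrow> real) \<Rightarrow> (nat \<Rightarrow> real) \<Rightarrow> nat set \<Rightarrow> nat \<Rightarrow> (nat \<Rightarrow> nat) \<Rightarrow> real" where
  "hits n X Z A u t = (\<Prod>w<n. if w \<in> A then (if t w = u then Z w else 0) else (if t w = u then X w else 1))"

lemma hits_expectation:
  assumes "u < n" "A \<subseteq> {..<n}" "\<And>w. w < n \<Longrightarrow> X w \<ge> 1" "\<And>w. w \<in> A \<Longrightarrow> Z w \<ge> 0"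
  shows "expect (targets n) (hits n X Z A u)
    \<le> (\<Prod>w\<in>A. Z w / n) * exp ((\<Sum>w<n. X w - 1) / n)"
proof -
  have npos: "0 < n" using assms(1) by simp
  let ?f = "\<lambda>w v. if w \<in> A then (if v = u then Z w else 0) else (if v = u then X w else 1)"
  have "expect (targets n) (hits n X Z A u) = (\<Prod>w<n. (\<Sum>v<n. ?f w v) / n)"
    unfolding hits_def using assms npos
    by (intro targets_expectation_prod) (auto intro: order.trans[OF zero_le_one])
  also have "\<dots> = (\<Prod>w<n. if w \<in> A then Z w / n else 1 + (X w - 1) / n)"
  proof (intro prod.cong refl)
    fix w assume w: "w \<in> {..<n}"
    have "(\<Sum>v<n. if v = u then X w else 1) = (\<Sum>v<n. 1 + (if v = u then X w - 1 else 0))"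
      by (intro sum.cong) auto
    also have "\<dots> = n + (X w - 1)" using assms(1) by (simp add: sum.distrib)
    finally show "(\<Sum>v<n. ?f w v) / n = (if w \<in> A then Z w / n else 1 + (X w - 1) / n)"
      using assms(1) npos by (cases "w \<in> A") (simp_all add: add_divide_distrib diff_divide_distrib)
  qed
  also have "\<dots> = (\<Prod>w\<in>A. Z w / n) * (\<Prod>w\<in>{..<n} - A. 1 + (X w - 1) / n)"
    using assms(2) by (simp add: prod.If_cases Int_absorb1 Diff_eq)
  also have "\<dots> \<le> (\<Prod>w\<in>A. Z w / n) * exp ((\<Sum>w<n. X w - 1) / n)"
  proof (intro mult_left_mono prod_nonneg)
    have "(\<Prod>w\<in>{..<n} - A. 1 + (X w - 1) / n) \<le> (\<Prod>w\<in>{..<n} - A. exp ((X w - 1) / n))"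
      using assms(3) npos by (intro prod_mono) (auto intro!: exp_ge_add_one_self add_nonneg_nonneg)
    also have "\<dots> = exp ((\<Sum>w\<in>{..<n} - A. X w - 1) / n)"
      by (simp add: exp_sum sum_divide_distrib)
    also have "\<dots> \<le> exp ((\<Sum>w<n. X w - 1) / n)"
      using assms(3) by (auto intro!: divide_right_mono sum_mono2)
    finally show "(\<Prod>w\<in>{..<n} - A. 1 + (X w - 1) / n) \<le> exp ((\<Sum>w<n. X w - 1) / n)" .
  qed (use assms(4) in auto)
  finally show ?thesis .
qed

text \<open>A token does not inflate itself: requiring that \<open>w\<close> hits \<open>u\<close>
  and dividing by its own factor leaves 1 at \<open>w\<close>.\<close>

lemma hits_single:
  assumes "w < n" "X w \<noteq> 0"
  shows "hits n X Z {} u t * (if t w = u then 1 / X w else 0) = hits n X (\<lambda>_. 1) {w} u t"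
  using assms unfolding hits_def by (subst (1 2) prod.remove[of _ w]) (auto intro!: prod.cong)

lemma hits_pair:
  assumes "w < n" "w' < n" "w \<noteq> w'"
  shows "hits n X (\<lambda>_. 1) {w} u t * (if t w' = u then 1 else 0) =
    hits n X (\<lambda>v. if v = w' then X w' else 1) {w, w'} u t"
  using assms unfolding hits_def by (subst (1 2) prod.remove[of _ w']) (auto intro!: prod.cong split: if_splits)

lemma hits_nonneg:
  assumes "\<And>w. w < n \<Longrightarrow> X w \<ge> 1" "\<And>w. w \<in> A \<Longrightarrow> Z w \<ge> 0"
  shows "hits n X Z A u t \<ge> 0"
  unfolding hits_def using assms by (intro prod_nonneg) (auto intro: order.trans[OF zero_le_one])

context spreading
begin

text \<open>For a single copy, \<open>c\<close> counts the reasons why it may fail to settle at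
  \<open>u\<close>: a nonempty remaining stack and each further token that lands there. Counting
  instead of testing keeps the bound linear in the events.\<close>

lemma potential_arrivals:
  fixes s :: "nat \<Rightarrow> token list" and t :: "nat \<Rightarrow> nat" and u :: nat
  assumes wi: "\<forall>w<n. token_bound B E (s w)"
  defines "X \<equiv> \<lambda>w. push_factor (s w)"
  defines "c \<equiv> \<lambda>w. if unit_push (s w) then of_bool (kept (s u) \<noteq> []) +
      (\<Sum>w'\<in>{w'. w' < n \<and> w' \<noteq> w \<and> push_token (s w') \<noteq> None}. if t w' = u then 1 else 0) else 1"
  shows "potential (arrivals n b s t u @ kept (s u)) \<le> hits n X X {} u t * potential (kept (s u)) +
    (\<Sum>w<n. push_potential (s w) * (hits n X (\<lambda>_. 1) {w} u t * c w))"
proof -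
  define P where "P = hits n X X {} u t"
  have X1: "X w \<ge> 1" for w by (simp add: X_def push_factor_ge)
  have P: "P \<ge> 0" unfolding P_def by (intro hits_nonneg) (use X1 order.trans[OF zero_le_one] in blast)+
  have pp: "push_potential s' \<ge> 0" for s' by (auto simp: push_potential_def split: option.split)
  have c0: "c w \<ge> 0" for w by (auto simp: c_def intro!: add_nonneg_nonneg sum_nonneg)
  have h0: "hits n X (\<lambda>_. 1) {w} u t \<ge> 0" for w by (intro hits_nonneg X1) auto
  have rhs: "0 \<le> P * potential (kept (s u)) + (\<Sum>w<n. push_potential (s w) * (hits n X (\<lambda>_. 1) {w} u t * c w))"
    by (intro add_nonneg_nonneg mult_nonneg_nonneg sum_nonneg P potential_nonneg pp c0 h0)
  show ?thesis
  \<comment> \<open>The exceptional case is a single copy arriving alone at an empty stack: it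
    settles and the left-hand side vanishes. Otherwise \<open>c w\<close> is at least 1 for every
    token that reaches \<open>u\<close>.\<close>
  proof (cases "\<exists>w<n. unit_push (s w) \<and> t w = u \<and> c w < 1")
    case True
    then obtain w v where w: "w < n" "push_token (s w) = Some (v, 0)" "t w = u" "c w < 1"
      by (auto simp: unit_push_def)
    define J where "J = {w'. w' < n \<and> w' \<noteq> w \<and> push_token (s w') \<noteq> None}"
    have cw: "of_bool (kept (s u) \<noteq> []) + (\<Sum>w'\<in>J. if t w' = u then 1 else 0) < (1 :: real)"
      using w by (simp add: c_def unit_push_def J_def)
    have "0 \<le> (\<Sum>w'\<in>J. if t w' = u then 1 else (0::real))" by (intro sum_nonneg) auto
    with cw have k: "kept (s u) = []" by (auto simp: of_bool_def split: if_splits)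
    have other: "t w' \<noteq> u" if "w' \<in> J" for w'
    proof
      assume "t w' = u"
      then have "1 \<le> (\<Sum>w'\<in>J. if t w' = u then 1 else (0::real))"
        using member_le_sum[of w' J "\<lambda>w'. if t w' = u then 1 else (0::real)"] that by (auto simp: J_def)
      with cw show False by (auto simp: of_bool_def split: if_splits)
    qed
    have "mset (arrivals n b s t u) = (\<Sum>w'<n. if w' = w then {#(v, 0)#} else {#})"
      unfolding mset_arrivals_within[OF wi] using w other
      by (intro sum.cong) (auto simp: J_def split: option.splits)
    also have "\<dots> = {#(v, 0)#}" using w by simp
    finally have "arrivals n b s t u = [(v, 0)]" by simp
    then show ?thesis using rhs k by (simp add: P_def)
  next
    case False
    have c1: "1 \<le> c w" if "w < n" "t w = u" for w
      using False that by (cases "unit_push (s w)") (auto simp: c_def)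
    have "potential (arrivals n b s t u @ kept (s u)) \<le>
        (\<Prod>x\<leftarrow>arrivals n b s t u. (5/4) ^ Suc (snd x)) * (potential (kept (s u)) +
        (\<Sum>x\<leftarrow>arrivals n b s t u. (5/2) ^ snd x / (5/4) ^ Suc (snd x)))"
      by (rule potential_append)
    also have "(\<Prod>x\<leftarrow>arrivals n b s t u. (5/4) ^ Suc (snd x)) = P"
      unfolding prod_list_arrivals[OF wi] P_def hits_def X_def push_factor_def by simp
    also have "(\<Sum>x\<leftarrow>arrivals n b s t u. (5/2) ^ snd x / (5/4) ^ Suc (snd x)) =
        (\<Sum>w<n. push_potential (s w) * (if t w = u then 1 / X w else 0))"
      unfolding sum_list_arrivals[OF wi] X_def push_factor_def push_potential_def
      by (intro sum.cong) (auto split: option.split)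
    also have "P * (potential (kept (s u)) + (\<Sum>w<n. push_potential (s w) * (if t w = u then 1 / X w else 0))) =
        P * potential (kept (s u)) + (\<Sum>w<n. push_potential (s w) * (P * (if t w = u then 1 / X w else 0)))"
      by (simp add: distrib_left sum_distrib_left mult_ac)
    also have "(\<Sum>w<n. push_potential (s w) * (P * (if t w = u then 1 / X w else 0))) =
       (\<Sum>w<n. push_potential (s w) * hits n X (\<lambda>_. 1) {w} u t)"
    proof (intro sum.cong refl)
      fix w assume "w \<in> {..<n}"
      moreover have "X w \<noteq> 0" using X1[of w] by auto
      ultimately have "P * (if t w = u then 1 / X w else 0) = hits n X (\<lambda>_. 1) {w} u t"
        unfolding P_def by (intro hits_single) auto
      then show "push_potential (s w) * (P * (if t w = u then 1 / X w else 0)) =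
        push_potential (s w) * hits n X (\<lambda>_. 1) {w} u t" by simp
    qed
    also have "\<dots> \<le> (\<Sum>w<n. push_potential (s w) * (hits n X (\<lambda>_. 1) {w} u t * c w))"
    proof (intro sum_mono mult_left_mono pp)
      fix w assume w: "w \<in> {..<n}"
      show "hits n X (\<lambda>_. 1) {w} u t \<le> hits n X (\<lambda>_. 1) {w} u t * c w"
      proof (cases "t w = u")
        case True
        then show ?thesis using mult_left_mono[OF c1 h0, of w w] w by simp
      next
        case False
        have "hits n X (\<lambda>_. 1) {w} u t = 0"
          unfolding hits_def using w False by (intro prod_zero) (auto intro!: bexI[of _ w])
        then show ?thesis by simp
      qed
    qed
    finally show ?thesis by (simp add: P_def)
  qed
qed

lemma total_quota_split:
  "total_quota n f \<sigma> = (\<Sum>u<n. quota f (kept (stk (\<sigma> u)))) + (\<Sum>u<n. pushed_quota f (stk (\<sigma> u)))"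
  by (simp add: total_quota_def quota_split[of f "stk _"] sum.distrib)

text \<open>Other arrivals inflate a stack by \<open>F\<close> = 6/5 in expectation, and a single
  copy meets another token with weight at most 4/5 because of the bounded density. With the 4/5 of
  \<open>potential_split\<close> this gives 6/5 * 4/5 = 24/25.\<close>

lemma Spread_contraction:
  assumes wi: "tokens_bounded n B E \<sigma>" and M: "5 * total_quota n (\<lambda>_. 1) \<sigma> \<le> 3 * n"
  shows "expect (rnd n b Spread \<sigma>) (\<lambda>\<sigma>'. \<Sum>u<n. potential (stk (\<sigma>' u)))
    \<le> 24/25 * (\<Sum>u<n. potential (stk (\<sigma> u)))"
proof -
  define s where "s = (\<lambda>w. stk (\<sigma> w))"
  define X where "X = (\<lambda>w. push_factor (s w))"
  define F :: real where "F = 6/5"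
  let ?E = "expect (targets n)"
  let ?q = "\<lambda>w. real (pushed_quota (\<lambda>_. 1) (s w))"
  have wi': "\<forall>w<n. token_bound B E (s w)" using wi by (simp add: tokens_bounded_def s_def)
  have X1: "X w \<ge> 1" for w by (simp add: X_def push_factor_ge)
  have X0: "X w \<ge> 0" for w using X1[of w] by linarith
  have pp: "push_potential s' \<ge> 0" for s' by (auto simp: push_potential_def split: option.split)
  have "(\<Sum>w<n. ?q w) \<le> real (total_quota n (\<lambda>_. 1) \<sigma>)"
    unfolding total_quota_split s_def by (simp flip: of_nat_sum)
  also have "\<dots> \<le> 3/5 * n" using M by linarith
  finally have "(\<Sum>w<n. ?q w) \<le> 3/5 * n" .
  have "(\<Sum>w<n. X w - 1) \<le> (\<Sum>w<n. 9/32 * ?q w)"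
  proof (intro sum_mono)
    fix w show "X w - 1 \<le> 9/32 * ?q w" using push_factor_le[of "s w"] unfolding X_def by linarith
  qed
  also have "\<dots> \<le> 9/32 * (3/5 * n)"
    unfolding sum_distrib_left[symmetric] by (intro mult_left_mono \<open>(\<Sum>w<n. ?q w) \<le> 3/5 * n\<close>) simp
  finally have "(\<Sum>w<n. X w - 1) / n \<le> 27/160" using n_pos by (simp add: field_simps)
  \<comment> \<open>The exponent is 9/32 * 3/5 = 27/160, and its quadratic bound is just below
    6/5.\<close>
  then have "exp ((\<Sum>w<n. X w - 1) / n) \<le> exp (27/160)" by simp
  also have "\<dots> \<le> 1 + 27/160 + (27/160)\<^sup>2" by (rule exp_le_quadratic) simp
  also have "\<dots> \<le> F" by (simp add: F_def power2_eq_square)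
  finally have expF: "exp ((\<Sum>w<n. X w - 1) / n) \<le> F" .
  have hitsE: "?E (hits n X Z A u) \<le> (\<Prod>w\<in>A. Z w / n) * F"
    if "u < n" "A \<subseteq> {..<n}" "\<And>w. w \<in> A \<Longrightarrow> Z w \<ge> 0" for u A Z
  proof -
    have "?E (hits n X Z A u) \<le> (\<Prod>w\<in>A. Z w / n) * exp ((\<Sum>w<n. X w - 1) / n)"
      by (intro hits_expectation that X1)
    also have "\<dots> \<le> (\<Prod>w\<in>A. Z w / n) * F"
      using that expF by (intro mult_left_mono prod_nonneg) auto
    finally show ?thesis .
  qed
  have E0: "?E (hits n X X {} u) \<le> F" if "u < n" for u using hitsE[of u "{}" X] that by simp
  have E1: "?E (hits n X (\<lambda>_. 1) {w} u) \<le> F / n" if "u < n" "w < n" for u w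
    using hitsE[of u "{w}" "\<lambda>_. 1"] that by simp
  have E2: "?E (\<lambda>t. hits n X (\<lambda>_. 1) {w} u t * (if t w' = u then 1 else 0)) \<le> F * X w' / n\<^sup>2"
    if "u < n" "w < n" "w' < n" "w' \<noteq> w" for u w w'
  proof -
    have "?E (\<lambda>t. hits n X (\<lambda>_. 1) {w} u t * (if t w' = u then 1 else 0)) =
        ?E (hits n X (\<lambda>v. if v = w' then X w' else 1) {w, w'} u)"
      using that by (subst hits_pair) auto
    also have "\<dots> \<le> (\<Prod>v\<in>{w, w'}. (if v = w' then X w' else 1) / n) * F"
      using that X0 by (intro hitsE) auto
    finally show ?thesis using that by (simp add: power2_eq_square mult_ac)
  qed
  define c where "c = (\<lambda>u w t. if unit_push (s w) then of_bool (kept (s u) \<noteq> []) +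
      (\<Sum>w'\<in>{w'. w' < n \<and> w' \<noteq> w \<and> push_token (s w') \<noteq> None}. if t w' = u then 1 else 0) else (1 :: real))"
  have Ec: "(\<Sum>u<n. ?E (\<lambda>t. hits n X (\<lambda>_. 1) {w} u t * c u w t)) \<le> F * (if unit_push (s w) then 4/5 else 1)"
    if w: "w < n" for w
  proof (cases "unit_push (s w)")
    case False
    then have "(\<Sum>u<n. ?E (\<lambda>t. hits n X (\<lambda>_. 1) {w} u t * c u w t)) \<le> (\<Sum>u<n. F / n)"
      using w E1 by (intro sum_mono) (auto simp: c_def)
    then show ?thesis using False n_pos by simp
  next
    case True
    define J where "J = {w'. w' < n \<and> w' \<noteq> w \<and> push_token (s w') \<noteq> None}"
    have finJ: "finite J" by (simp add: J_def)
    have "(\<Sum>u<n. ?E (\<lambda>t. hits n X (\<lambda>_. 1) {w} u t * c u w t)) =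
      (\<Sum>u<n. of_bool (kept (s u) \<noteq> []) * ?E (hits n X (\<lambda>_. 1) {w} u) +
        (\<Sum>w'\<in>J. ?E (\<lambda>t. hits n X (\<lambda>_. 1) {w} u t * (if t w' = u then 1 else 0))))"
      using True by (intro sum.cong) (auto simp: c_def J_def distrib_left sum_distrib_left mult.commute
        Bochner_Integration.integral_sum)
    also have "\<dots> \<le> (\<Sum>u<n. of_bool (kept (s u) \<noteq> []) * (F / n) + (\<Sum>w'\<in>J. F * X w' / n\<^sup>2))"
      using w by (intro sum_mono add_mono mult_left_mono E1 E2) (auto simp: J_def)
    also have "\<dots> = F / n * ((\<Sum>u<n. of_bool (kept (s u) \<noteq> [])) + (\<Sum>w'\<in>J. X w'))"
    proof -
      have "(\<Sum>w'\<in>J. F * X w' / n\<^sup>2) = F / n\<^sup>2 * (\<Sum>w'\<in>J. X w')"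
        unfolding sum_distrib_left by (intro sum.cong) auto
      then show ?thesis
        unfolding sum.distrib sum_distrib_right[symmetric] using n_pos
        by (simp add: power2_eq_square field_simps)
    qed
    \<comment> \<open>Occupied stacks and pushing nodes are both counted by the quota. The factor
      5/4 is needed for the pushing nodes; using it twice lets both parts add up to the total
      quota.\<close>
    also have "\<dots> \<le> F / n * (5/4 * (\<Sum>u<n. quota (\<lambda>_. 1) (kept (s u))) + 5/4 * (\<Sum>w<n. ?q w))"
    proof (intro mult_left_mono add_mono)
      have "of_bool (kept (s u) \<noteq> []) \<le> 5/4 * real (quota (\<lambda>_. 1) (kept (s u)))" for u
      proof (cases "kept (s u)")
        case (Cons x xs)
        have "(1::real) \<le> 2 ^ snd x" by (rule one_le_power) simp
        moreover have "0 \<le> real (quota (\<lambda>_. 1) xs)" by simp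
        moreover have "real (quota (\<lambda>_. 1) (kept (s u))) = 2 ^ snd x + real (quota (\<lambda>_. 1) xs)"
          using Cons by (simp add: quota_def)
        moreover have "of_bool (kept (s u) \<noteq> []) = (1::real)" using Cons by simp
        ultimately show ?thesis by linarith
      qed simp
      then show "(\<Sum>u<n. of_bool (kept (s u) \<noteq> [])) \<le> 5/4 * real (\<Sum>u<n. quota (\<lambda>_. 1) (kept (s u)))"
        unfolding of_nat_sum sum_distrib_left by (intro sum_mono) simp
      have "(\<Sum>w'\<in>J. X w') \<le> (\<Sum>w'\<in>J. 5/4 * ?q w')"
        using push_factor_le_quota by (intro sum_mono) (simp add: X_def J_def)
      also have "\<dots> \<le> (\<Sum>w'<n. 5/4 * ?q w')" by (intro sum_mono2) (auto simp: J_def)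
      finally show "(\<Sum>w'\<in>J. X w') \<le> 5/4 * (\<Sum>w<n. ?q w)" by (simp add: sum_distrib_left)
    qed (auto simp: F_def)
    also have "\<dots> = F / n * (5/4 * real (total_quota n (\<lambda>_. 1) \<sigma>))"
      unfolding total_quota_split s_def by (simp add: algebra_simps)
    also have "\<dots> \<le> F / n * (5/4 * (3/5 * n))"
      using M by (intro mult_left_mono) (auto simp: F_def)
    also have "\<dots> \<le> F * (4/5)" using n_pos by (simp add: F_def)
    finally show ?thesis using True by simp
  qed
  have "expect (rnd n b Spread \<sigma>) (\<lambda>\<sigma>'. \<Sum>u<n. potential (stk (\<sigma>' u))) =
      ?E (\<lambda>t. \<Sum>u<n. potential (arrivals n b s t u @ kept (s u)))"
    by (simp add: rnd_Spread s_def)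
  also have "\<dots> \<le> ?E (\<lambda>t. \<Sum>u<n. hits n X X {} u t * potential (kept (s u)) +
    (\<Sum>w<n. push_potential (s w) * (hits n X (\<lambda>_. 1) {w} u t * c u w t)))"
    unfolding X_def c_def
    by (intro expectation_mono_finite finite_targets sum_mono potential_arrivals wi')
  also have "\<dots> = (\<Sum>u<n. ?E (hits n X X {} u) * potential (kept (s u)) +
    (\<Sum>w<n. push_potential (s w) * ?E (\<lambda>t. hits n X (\<lambda>_. 1) {w} u t * c u w t)))"
    by (simp add: Bochner_Integration.integral_sum)
  also have "\<dots> = (\<Sum>u<n. ?E (hits n X X {} u) * potential (kept (s u))) +
    (\<Sum>w<n. push_potential (s w) * (\<Sum>u<n. ?E (\<lambda>t. hits n X (\<lambda>_. 1) {w} u t * c u w t)))"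
    unfolding sum.distrib sum_distrib_left by (subst (2) sum.swap) simp
  also have "\<dots> \<le> (\<Sum>u<n. F * potential (kept (s u))) +
    (\<Sum>w<n. push_potential (s w) * (F * (if unit_push (s w) then 4/5 else 1)))"
    by (intro add_mono sum_mono mult_right_mono mult_left_mono E0 Ec pp potential_nonneg) auto
  also have "\<dots> = F * (\<Sum>u<n. potential (kept (s u)) + (if unit_push (s u) then 4/5 else 1) * push_potential (s u))"
    by (simp add: sum.distrib sum_distrib_left algebra_simps)
  also have "\<dots> \<le> F * (\<Sum>u<n. 4/5 * potential (s u))"
    by (intro mult_left_mono sum_mono potential_split) (simp add: F_def)
  also have "\<dots> = 24/25 * (\<Sum>u<n. potential (stk (\<sigma> u)))"
    unfolding sum_distrib_left[symmetric] by (simp add: F_def s_def)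
  finally show ?thesis .
qed

lemma Spread_settles:
  assumes "tokens_bounded n B E \<sigma>" "5 * total_quota n (\<lambda>_. 1) \<sigma> \<le> 3 * n"
  shows "prob (exec n b (replicate T Spread) \<sigma>) {\<sigma>'. \<not> all_settled n \<sigma>'}
    \<le> (24/25) ^ T * (\<Sum>u<n. potential (stk (\<sigma> u)))"
proof -
  define I where "I = (\<lambda>\<sigma> :: nat \<Rightarrow> data. tokens_bounded n B E \<sigma> \<and> 5 * total_quota n (\<lambda>_. 1) \<sigma> \<le> 3 * n)"
  have "prob (chain (rnd n b Spread) T \<sigma>) {\<sigma>'. \<not> all_settled n \<sigma>'}
      \<le> (24/25) ^ T * (\<lambda>\<sigma>. \<Sum>u<n. potential (stk (\<sigma> u))) \<sigma> / 1"
  proof (rule chain_contraction[where I = I])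
    fix \<sigma> \<sigma>' assume "I \<sigma>" "\<sigma>' \<in> set_pmf (rnd n b Spread \<sigma>)"
    then show "I \<sigma>'" using Spread_within Spread_quota by (auto simp: I_def)
  next
    fix \<sigma> :: "nat \<Rightarrow> data"
    show "0 \<le> (\<Sum>u<n. potential (stk (\<sigma> u)))" by (intro sum_nonneg potential_nonneg)
    assume "\<sigma> \<in> {\<sigma>'. \<not> all_settled n \<sigma>'}"
    then obtain u where u: "u < n" "\<not> settled (stk (\<sigma> u))" by (auto simp: all_settled_def)
    have "1 \<le> potential (stk (\<sigma> u))" by (rule potential_unsettled[OF u(2)])
    also have "\<dots> \<le> (\<Sum>u<n. potential (stk (\<sigma> u)))"
      using u by (intro member_le_sum) (auto simp: potential_nonneg)
    finally show "1 \<le> (\<Sum>u<n. potential (stk (\<sigma> u)))" .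
  qed (use assms finite_set_rnd Spread_contraction in \<open>auto simp: I_def\<close>)
  then show ?thesis by (simp add: exec_replicate)
qed

end

section \<open>Replicating the tokens\<close>

abbreviation det :: "(data \<Rightarrow> data) \<Rightarrow> instr" where
  "det f \<equiv> Local (\<lambda>d. return_pmf (f d))"

definition conf :: "nat \<Rightarrow> (data \<Rightarrow> data) \<Rightarrow> (nat \<Rightarrow> data) \<Rightarrow> nat \<Rightarrow> data" where
  "conf n f \<sigma> = (\<lambda>u. if u < n then f (\<sigma> u) else undefined)"

lemma conf_less [simp]: "u < n \<Longrightarrow> conf n f \<sigma> u = f (\<sigma> u)"
  by (simp add: conf_def)

lemma exec_det: "exec n b (det f # P) \<sigma> = exec n b P (conf n f \<sigma>)"
  by (simp add: rnd_Local_return bind_return_pmf conf_def)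

text \<open>The estimate is raised to \<open>sqrt n\<close>, below which averaging is not trusted.
  The 8 allows for an underestimate by a factor 4 and still aims at no more than n/2 copies;
  \<open>nat\<close> turns negative exponents into 0.\<close>

definition guess :: "nat \<Rightarrow> nat \<Rightarrow> nat \<Rightarrow> nat" where
  "guess n T z = nat \<lfloor>log 2 (n / (8 * max (n * (z / 2 ^ T)) (sqrt n)))\<rfloor>"

definition mark :: "data \<Rightarrow> data" where
  "mark d = d\<lparr>acc := (if stk d = [] then 0 else 1)\<rparr>"

definition set_guess :: "nat \<Rightarrow> nat \<Rightarrow> data \<Rightarrow> data" where
  "set_guess n T d = d\<lparr>acc := guess n T (acc d)\<rparr>"

definition inflate :: "data \<Rightarrow> data" where
  "inflate d = d\<lparr>stk := map (\<lambda>x. (fst x, snd x + acc d)) (stk d), gs := acc d # gs d\<rparr>"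

text \<open>The estimates of different nodes may round to different exponents, so the largest guess
  is broadcast and used by all.\<close>

definition replicate_phase :: "nat \<Rightarrow> nat \<Rightarrow> nat \<Rightarrow> nat \<Rightarrow> instr list" where
  "replicate_phase n Ta Tb Tc = det mark # replicate Ta PullSum @ det (set_guess n Ta) #
     replicate Tb PullMax @ det inflate # replicate Tc Spread"

lemma exec_replicate_phase:
  "exec n b (replicate_phase n Ta Tb Tc) \<sigma> =
     bind_pmf (exec n b (replicate Ta PullSum) (conf n mark \<sigma>))
       (\<lambda>\<sigma>1. bind_pmf (exec n b (replicate Tb PullMax) (conf n (set_guess n Ta) \<sigma>1))
         (\<lambda>\<sigma>2. exec n b (replicate Tc Spread) (conf n inflate \<sigma>2)))"
  unfolding replicate_phase_def exec_det exec_append by (rule refl)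

definition log_nat :: "nat \<Rightarrow> nat" where
  "log_nat n = nat \<lfloor>log 2 n\<rfloor>"

text \<open>The upper bound breaks down only for y < 1, where \<open>nat\<close> yields the exponent
  0.\<close>

lemma two_power_nat_floor_log:
  assumes "y > 0"
  shows "y / 2 \<le> 2 ^ nat \<lfloor>log 2 y\<rfloor>" "nat \<lfloor>log 2 y\<rfloor> = 0 \<or> 2 ^ nat \<lfloor>log 2 y\<rfloor> \<le> y"
proof -
  define k where "k = \<lfloor>log 2 y\<rfloor>"
  have k: "k \<le> log 2 y" "log 2 y < k + 1" by (simp_all add: k_def)
  show "nat k = 0 \<or> 2 ^ nat k \<le> y"
  proof (cases "k \<le> 0")
    case False
    then have "(2::real) ^ nat k = 2 powr k" by (simp add: powr_realpow[symmetric])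
    also have "\<dots> \<le> 2 powr log 2 y" using k by (intro powr_mono) auto
    finally show ?thesis using assms by simp
  qed simp
  have "y = 2 powr log 2 y" using assms by simp
  also have "\<dots> \<le> 2 powr (1 + real (nat k))" using k by (intro powr_mono) linarith+
  also have "\<dots> = 2 * 2 ^ nat k" by (simp add: powr_add powr_realpow)
  finally show "y / 2 \<le> 2 ^ nat k" by simp
qed

lemma guess_le: "0 < n \<Longrightarrow> guess n T z \<le> log_nat n"
proof -
  assume n: "0 < n"
  define e where "e = 8 * max (n * (z / 2 ^ T)) (sqrt n)"
  have "1 \<le> sqrt n" using n by simp
  then have e: "1 \<le> e" unfolding e_def by linarith
  then have "n / e \<le> n / 1" using n by (intro divide_left_mono) auto
  then have "log 2 (n / e) \<le> log 2 n" using n e by simp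
  then show ?thesis unfolding guess_def log_nat_def e_def[symmetric] by (intro nat_mono floor_mono)
qed

lemma two_power_log_nat: "0 < n \<Longrightarrow> 2 ^ log_nat n \<le> n"
proof -
  assume n: "0 < n"
  have "real (2 ^ log_nat n) \<le> n"
    using two_power_nat_floor_log(2)[of n] n unfolding log_nat_def by auto
  then show ?thesis by (simp only: of_nat_le_iff)
qed

lemma quota_inflate: "quota f (stk (inflate d)) = 2 ^ acc d * quota f (stk d)"
  by (simp add: inflate_def quota_def comp_def power_add sum_list_const_mult[symmetric] mult_ac)

text \<open>What survives on arbitrary runs: nodes may end up with different exponents
  \<open>x u\<close>, but the bookkeeping is exact, and \<open>gs\<close> records which exponent was
  used.\<close>

lemma replicate_phase_sure:
  assumes sp: "spreading n b B (E + log_nat n)"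
    and "\<sigma>' \<in> set_pmf (exec n b (replicate_phase n Ta Tb Tc) \<sigma>)" "tokens_bounded n B E \<sigma>"
  shows "\<exists>x. (\<forall>u<n. x u \<le> log_nat n \<and>
        (\<sigma>' u)\<lparr>stk := [], acc := 0\<rparr> = (\<sigma> u)\<lparr>stk := [], acc := 0, gs := x u # gs (\<sigma> u)\<rparr>) \<and>
      tokens_bounded n B (E + log_nat n) \<sigma>' \<and>
      (\<forall>f. total_quota n f \<sigma>' = (\<Sum>u<n. 2 ^ x u * quota f (stk (\<sigma> u))))"
proof -
  interpret spreading n b B "E + log_nat n" by (rule sp)
  from assms(2) obtain \<sigma>1 \<sigma>2 where
    1: "\<sigma>1 \<in> set_pmf (exec n b (replicate Ta PullSum) (conf n mark \<sigma>))" and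
    2: "\<sigma>2 \<in> set_pmf (exec n b (replicate Tb PullMax) (conf n (set_guess n Ta) \<sigma>1))" and
    3: "\<sigma>' \<in> set_pmf (exec n b (replicate Tc Spread) (conf n inflate \<sigma>2))"
    by (auto simp: exec_replicate_phase)
  have f1: "(\<sigma>1 u)\<lparr>acc := 0\<rparr> = (\<sigma> u)\<lparr>acc := 0\<rparr>" if "u < n" for u
    using PullSum_frame[OF 1 that] that by (simp add: mark_def)
  have f2: "(\<sigma>2 u)\<lparr>acc := 0\<rparr> = (\<sigma> u)\<lparr>acc := 0\<rparr>" if "u < n" for u
    using PullMax_frame[OF 2 that] f1[OF that] that by (simp add: set_guess_def)
  have s2: "stk (\<sigma>2 u) = stk (\<sigma> u)" "gs (\<sigma>2 u) = gs (\<sigma> u)" if "u < n" for u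
    using arg_cong[OF f2[OF that], of stk] arg_cong[OF f2[OF that], of gs] by simp_all
  have le: "acc (\<sigma>2 u) \<le> log_nat n" if "u < n" for u
    using n_pos by (intro PullMax_acc_le[OF 2 _ that]) (simp add: set_guess_def guess_le)
  have f3: "(\<sigma>' u)\<lparr>stk := [], acc := 0\<rparr> = (\<sigma> u)\<lparr>stk := [], acc := 0, gs := acc (\<sigma>2 u) # gs (\<sigma> u)\<rparr>"
    if "u < n" for u
  proof -
    have "(\<sigma>' u)\<lparr>stk := []\<rparr> = (\<sigma>2 u)\<lparr>stk := [], gs := acc (\<sigma>2 u) # gs (\<sigma>2 u)\<rparr>"
      using Spread_frame[OF 3 that] that by (simp add: inflate_def)
    then have "(\<sigma>' u)\<lparr>stk := []\<rparr>\<lparr>acc := 0\<rparr> =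
        (\<sigma>2 u)\<lparr>acc := 0\<rparr>\<lparr>stk := [], gs := acc (\<sigma>2 u) # gs (\<sigma>2 u)\<rparr>" by simp
    also have "\<dots> = (\<sigma> u)\<lparr>acc := 0\<rparr>\<lparr>stk := [], gs := acc (\<sigma>2 u) # gs (\<sigma> u)\<rparr>"
      by (simp only: f2[OF that] s2[OF that])
    finally show ?thesis by simp
  qed
  have tb: "tokens_bounded n B (E + log_nat n) (conf n inflate \<sigma>2)"
    using assms(3) le by (fastforce simp: tokens_bounded_def token_bound_def inflate_def s2 intro: add_mono)
  have "total_quota n f \<sigma>' = (\<Sum>u<n. 2 ^ acc (\<sigma>2 u) * quota f (stk (\<sigma> u)))" for f
    unfolding Spread_invariants(2)[OF 3 tb] by (simp add: total_quota_def quota_inflate s2)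
  then show ?thesis
    using f3 le Spread_invariants(1)[OF 3 tb] by (intro exI[of _ "\<lambda>u. acc (\<sigma>2 u)"]) blast
qed

lemma quota_settled: "settled s \<Longrightarrow> quota (\<lambda>_. 1) s = of_bool (s \<noteq> [])"
  by (auto simp: settled_def quota_def)

definition phase_error :: "nat \<Rightarrow> nat \<Rightarrow> nat \<Rightarrow> nat \<Rightarrow> real" where
  "phase_error n Ta Tb Tc = (16 * real n ^ 3 / 2 ^ Ta + 2 * exp (- sqrt n / (256 * real Ta))) +
     ((3/4) ^ Tb * (real n)\<^sup>2 + (24/25) ^ Tc * real n ^ 3)"

text \<open>The lower tail is invoked only if 64 M \<ge> \<open>sqrt n\<close>, where M/(4 Ta) is at
  least \<open>sqrt n\<close>/(256 Ta); for smaller \<open>M\<close> the lower bound is guaranteed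
  by the raised estimate.\<close>

lemma estimate_whp:
  fixes M :: nat
  assumes n_pos: "0 < n" and Ta: "1 \<le> Ta" "Ta < b" and acc_le: "\<forall>u<n. acc (\<sigma> u) \<le> 1"
    and M: "M = (\<Sum>u<n. acc (\<sigma> u))" "M \<ge> 1"
  shows "prob (exec n b (replicate Ta PullSum) \<sigma>)
      {\<tau>. \<not> (\<forall>u<n. M / 4 \<le> max (n * average Ta \<tau> u) (sqrt n) \<and>
        max (n * average Ta \<tau> u) (sqrt n) \<le> 4 * max M (sqrt n))}
    \<le> 16 * real n ^ 3 / 2 ^ Ta + 2 * exp (- sqrt n / (256 * real Ta))"
proof -
  let ?p = "exec n b (replicate Ta PullSum) \<sigma>"
  let ?S = "\<lambda>\<tau>. \<Sum>u<n. average Ta \<tau> u"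
  define K where "K = max (real M) (sqrt n)"
  have sqrt1: "1 \<le> sqrt n" using n_pos by simp
  have MS: "real M = (\<Sum>u<n. real (acc (\<sigma> u)))" using M by simp
  define D where "D = {\<tau>. \<not> (\<forall>u<n. \<bar>n * average Ta \<tau> u - ?S \<tau>\<bar> < 1/4)}"
  define A where "A = {\<tau>. ?S \<tau> > 3 * K}"
  define C where "C = (if 64 * M \<ge> sqrt n then {\<tau>. ?S \<tau> < M / 2} else {})"
  have pD: "prob ?p D \<le> 16 * real n ^ 3 / 2 ^ Ta"
    unfolding D_def using assms by (intro PullSum_deviation) auto
  have "prob ?p A \<le> exp (- K / Ta)"
    unfolding A_def using assms MS by (intro PullSum_upper) (auto simp: K_def)
  also have "\<dots> \<le> exp (- sqrt n / (256 * real Ta))"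
  proof -
    have "sqrt n / (256 * real Ta) \<le> sqrt n / Ta" using Ta by (intro divide_left_mono) auto
    also have "\<dots> \<le> K / Ta" by (intro divide_right_mono) (auto simp: K_def)
    finally show ?thesis by simp
  qed
  finally have pA: "prob ?p A \<le> exp (- sqrt n / (256 * real Ta))" .
  have pC: "prob ?p C \<le> exp (- sqrt n / (256 * real Ta))"
  proof (cases "64 * M \<ge> sqrt n")
    case True
    then have "prob ?p C \<le> exp (- real M / (4 * Ta))"
      unfolding C_def MS using PullSum_lower[OF n_pos Ta acc_le] by (simp add: MS)
    also have "\<dots> \<le> exp (- sqrt n / (256 * real Ta))"
      using True Ta by (simp add: field_simps)
    finally show ?thesis .
  qed (simp add: C_def)
  have "{\<tau>. \<not> (\<forall>u<n. M / 4 \<le> max (n * average Ta \<tau> u) (sqrt n) \<and>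
        max (n * average Ta \<tau> u) (sqrt n) \<le> 4 * max M (sqrt n))} \<subseteq> D \<union> (A \<union> C)"
  proof
    fix \<tau>
    assume "\<tau> \<in> {\<tau>. \<not> (\<forall>u<n. M / 4 \<le> max (n * average Ta \<tau> u) (sqrt n) \<and>
        max (n * average Ta \<tau> u) (sqrt n) \<le> 4 * max M (sqrt n))}"
    then obtain u where u: "u < n" and
      bad: "M / 4 > max (n * average Ta \<tau> u) (sqrt n) \<or> max (n * average Ta \<tau> u) (sqrt n) > 4 * K"
      unfolding K_def by force
    show "\<tau> \<in> D \<union> (A \<union> C)"
    proof (rule ccontr)
      assume notin: "\<tau> \<notin> D \<union> (A \<union> C)"
      then have d: "\<bar>n * average Ta \<tau> u - ?S \<tau>\<bar> < 1/4" using u by (auto simp: D_def)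
      have a: "?S \<tau> \<le> 3 * K" using notin by (auto simp: A_def)
      have K1: "K \<ge> 1" "sqrt n \<le> K" using sqrt1 unfolding K_def by linarith+
      have up: "max (n * average Ta \<tau> u) (sqrt n) \<le> 4 * K" using d a K1 by (auto simp: abs_if split: if_splits)
      have "M / 4 \<le> max (n * average Ta \<tau> u) (sqrt n)"
      proof (cases "64 * M \<ge> sqrt n")
        case True
        then have "?S \<tau> \<ge> M / 2" using notin by (auto simp: C_def)
        then have "n * average Ta \<tau> u \<ge> M / 2 - 1/4" using d by linarith
        \<comment> \<open>The existence of a token absorbs the deviation of 1/4.\<close>
        also have "real M / 2 - 1/4 \<ge> M / 4" using M(2) by simp
        finally show ?thesis by simp
      qed auto
      with up bad show False by linarith
    qed
  qed
  then have "prob ?p {\<tau>. \<not> (\<forall>u<n. M / 4 \<le> max (n * average Ta \<tau> u) (sqrt n) \<and>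
        max (n * average Ta \<tau> u) (sqrt n) \<le> 4 * max M (sqrt n))} \<le> prob ?p (D \<union> (A \<union> C))"
    by (intro measure_pmf.finite_measure_mono) auto
  also have "\<dots> \<le> prob ?p D + (prob ?p A + prob ?p C)"
    by (intro order.trans[OF measure_Un_le] add_mono) auto
  finally show ?thesis using pD pA pC by linarith
qed

text \<open>The loss 64 = 8 * 4 * 2 collects the factor in \<open>guess\<close>, an overestimate by
  4 and the rounding down to a power of two.\<close>

lemma replicate_phase_whp:
  fixes M :: nat
  assumes sp: "spreading n b B (log_nat n)" and Ta: "1 \<le> Ta" "Ta < b" and b: "log_nat n < 2 ^ b"
    and settled: "all_settled n \<sigma>" and tb: "tokens_bounded n B 0 \<sigma>"
    and M: "M = total_quota n (\<lambda>_. 1) \<sigma>" "M \<ge> 1"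
  shows "prob (exec n b (replicate_phase n Ta Tb Tc) \<sigma>)
    {\<sigma>'. \<not> (all_settled n \<sigma>' \<and> (\<exists>G. (\<forall>u<n. gs (\<sigma>' u) = G # gs (\<sigma> u)) \<and>
        real M * 2 ^ G \<ge> real M * n / (64 * max M (sqrt n))))} \<le> phase_error n Ta Tb Tc"
  unfolding exec_replicate_phase phase_error_def
proof (rule prob_bind_le[OF estimate_whp[where M = M]])
  interpret spreading n b B "log_nat n" by (rule sp)
  show "0 < n" by (rule n_pos)
  have sqrt1: "1 \<le> sqrt n" using n_pos by simp
  have "quota (\<lambda>_. 1) (stk (\<sigma> u)) = acc (conf n mark \<sigma> u)" if "u < n" for u
    using settled that quota_settled by (auto simp: all_settled_def mark_def)
  then show "M = (\<Sum>u<n. acc (conf n mark \<sigma> u))"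
    using M(1) by (simp add: total_quota_def)
  show "\<forall>u<n. acc (conf n mark \<sigma> u) \<le> 1" by (simp add: mark_def)
  fix \<sigma>1
  assume 1: "\<sigma>1 \<in> set_pmf (exec n b (replicate Ta PullSum) (conf n mark \<sigma>))"
    and est: "\<forall>u<n. M / 4 \<le> max (n * average Ta \<sigma>1 u) (sqrt n) \<and>
        max (n * average Ta \<sigma>1 u) (sqrt n) \<le> 4 * max M (sqrt n)"
  define y where "y = (\<lambda>u. n / (8 * max (n * average Ta \<sigma>1 u) (sqrt n)))"
  define g where "g = (\<lambda>u. guess n Ta (acc (\<sigma>1 u)))"
  have ge1: "1 \<le> max (n * average Ta \<sigma>1 u) (sqrt n)" for u using sqrt1 by linarith
  have y: "y u > 0" for u using n_pos ge1[of u] by (simp add: y_def)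
  have g_eq: "g u = nat \<lfloor>log 2 (y u)\<rfloor>" for u by (simp add: g_def guess_def y_def average_def)
  have f1: "(\<sigma>1 u)\<lparr>acc := 0\<rparr> = (\<sigma> u)\<lparr>acc := 0\<rparr>" if "u < n" for u
    using PullSum_frame[OF 1 that] that by (simp add: mark_def)
  define G where "G = Max (g ` {..<n})"
  have ne: "g ` {..<n} \<noteq> {}" using n_pos by auto
  have "G \<in> g ` {..<n}" unfolding G_def by (rule Max_in) (use ne in auto)
  then obtain v where v: "v < n" "G = g v" by auto
  have gG: "g u \<le> G" if "u < n" for u unfolding G_def using that by (intro Max_ge) auto
  have Glog: "G \<le> log_nat n" using v n_pos by (simp add: g_def guess_le)
  \<comment> \<open>An estimate of at least M/4 turns the 8 into a 2: at most n/2 copies arise,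
    within the density 3/5 that spreading tolerates. For \<open>G\<close> = 0 nothing is claimed,
    since the input may be denser.\<close>
  have G1: "G = 0 \<or> M * 2 ^ G \<le> n / 2"
  proof (cases "G = 0")
    case False
    then have "2 ^ G \<le> y v" using two_power_nat_floor_log(2)[OF y, of v] v g_eq by auto
    also have "\<dots> \<le> n / (8 * (M / 4))"
      unfolding y_def using est v M(2) ge1[of v] by (intro divide_left_mono mult_pos_pos) auto
    finally have "2 ^ G \<le> n / (2 * real M)" by simp
    then show ?thesis using M(2) by (simp add: field_simps)
  qed simp
  have G2: "real M * 2 ^ G \<ge> real M * n / (64 * max M (sqrt n))"
  proof -
    have "n / (64 * max M (sqrt n)) = n / (8 * (4 * max M (sqrt n))) / 2" by simp
    also have "\<dots> \<le> y v / 2"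
      unfolding y_def using est v ge1[of v] by (intro divide_right_mono divide_left_mono mult_pos_pos) auto
    also have "\<dots> \<le> 2 ^ G" using two_power_nat_floor_log(1)[OF y, of v] v g_eq by auto
    finally have "M * (n / (64 * max M (sqrt n))) \<le> real M * 2 ^ G" by (intro mult_left_mono) auto
    then show ?thesis by simp
  qed
  show "prob (bind_pmf (exec n b (replicate Tb PullMax) (conf n (set_guess n Ta) \<sigma>1))
         (\<lambda>\<sigma>2. exec n b (replicate Tc Spread) (conf n inflate \<sigma>2)))
    {\<sigma>'. \<not> (all_settled n \<sigma>' \<and> (\<exists>G. (\<forall>u<n. gs (\<sigma>' u) = G # gs (\<sigma> u)) \<and>
        real M * 2 ^ G \<ge> real M * n / (64 * max M (sqrt n))))} \<le> (3/4) ^ Tb * (real n)\<^sup>2 + (24/25) ^ Tc * real n ^ 3"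
  proof (rule prob_bind_le[OF PullMax_informs_all[where m = G]])
    show "G < 2 ^ b" using Glog b by simp
    show "u < n \<Longrightarrow> acc (conf n (set_guess n Ta) \<sigma>1 u) \<le> G" for u
      using gG by (simp add: set_guess_def g_def)
    show "\<exists>u<n. acc (conf n (set_guess n Ta) \<sigma>1 u) = G"
      using v by (auto simp: set_guess_def g_def)
    fix \<sigma>2
    assume 2: "\<sigma>2 \<in> set_pmf (exec n b (replicate Tb PullMax) (conf n (set_guess n Ta) \<sigma>1))"
      and acc2: "\<forall>u<n. acc (\<sigma>2 u) = G"
    have f2: "(\<sigma>2 u)\<lparr>acc := 0\<rparr> = (\<sigma> u)\<lparr>acc := 0\<rparr>" if "u < n" for u
      using PullMax_frame[OF 2 that] f1[OF that] that by (simp add: set_guess_def)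
    have s2: "stk (\<sigma>2 u) = stk (\<sigma> u)" "gs (\<sigma>2 u) = gs (\<sigma> u)" if "u < n" for u
      using arg_cong[OF f2[OF that], of stk] arg_cong[OF f2[OF that], of gs] by simp_all
    define \<sigma>3 where "\<sigma>3 = conf n inflate \<sigma>2"
    have stk3: "stk (\<sigma>3 u) = map (\<lambda>x. (fst x, snd x + G)) (stk (\<sigma> u))"
      and gs3: "gs (\<sigma>3 u) = G # gs (\<sigma> u)" if "u < n" for u
      using that acc2 s2 by (auto simp: \<sigma>3_def inflate_def)
    have gs: "gs (\<sigma>' u) = G # gs (\<sigma> u)"
      if "\<sigma>' \<in> set_pmf (exec n b (replicate Tc Spread) \<sigma>3)" "u < n" for \<sigma>' u
      using arg_cong[OF Spread_frame[OF that], of gs] gs3[OF that(2)] by simp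
    \<comment> \<open>If \<open>G\<close> = 0, the stacks are settled already and stay so; otherwise
      the density bound applies.\<close>
    have "prob (exec n b (replicate Tc Spread) \<sigma>3) {\<sigma>'. \<not> all_settled n \<sigma>'} \<le> (24/25) ^ Tc * real n ^ 3"
    proof (cases "G = 0")
      case True
      then have "all_settled n \<sigma>3" using settled stk3 by (simp add: all_settled_def)
      then have "all_settled n \<sigma>'" if "\<sigma>' \<in> set_pmf (exec n b (replicate Tc Spread) \<sigma>3)" for \<sigma>'
        using Spread_idle[OF that] by (simp add: all_settled_def)
      then have "prob (exec n b (replicate Tc Spread) \<sigma>3) {\<sigma>'. \<not> all_settled n \<sigma>'} = 0"
        by (auto simp: measure_pmf_zero_iff)
      then show ?thesis by simp
    next
      case False
      have tb3: "tokens_bounded n B (log_nat n) \<sigma>3"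
        using tb Glog stk3 by (fastforce simp: tokens_bounded_def token_bound_def)
      have "quota (\<lambda>_. 1) (stk (\<sigma>3 u)) = 2 ^ G * quota (\<lambda>_. 1) (stk (\<sigma> u))" if "u < n" for u
        using that acc2 s2 by (simp add: \<sigma>3_def quota_inflate)
      then have "total_quota n (\<lambda>_. 1) \<sigma>3 = 2 ^ G * M"
        unfolding M(1) by (simp add: total_quota_def sum_distrib_left)
      moreover have "real (2 ^ G * M) \<le> n / 2" using G1 False by (simp add: mult.commute)
      then have "real (5 * (2 ^ G * M)) \<le> real (3 * n)" by simp
      ultimately have M3: "5 * total_quota n (\<lambda>_. 1) \<sigma>3 \<le> 3 * n" by linarith
      have "prob (exec n b (replicate Tc Spread) \<sigma>3) {\<sigma>'. \<not> all_settled n \<sigma>'}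
          \<le> (24/25) ^ Tc * (\<Sum>u<n. potential (stk (\<sigma>3 u)))"
        by (rule Spread_settles[OF tb3 M3])
      also have "(\<Sum>u<n. potential (stk (\<sigma>3 u))) \<le> (\<Sum>u<n. (real n)\<^sup>2)"
      proof (intro sum_mono)
        fix u assume "u \<in> {..<n}"
        then have "settled (stk (\<sigma> u))" "u < n" using settled by (auto simp: all_settled_def)
        then have "potential (stk (\<sigma>3 u)) \<le> (5/2) ^ G" by (auto simp: stk3 settled_def)
        also have "\<dots> \<le> 4 ^ G" by (intro power_mono) auto
        also have "\<dots> = (2 ^ G)\<^sup>2" by (simp add: power2_eq_square flip: power_mult_distrib)
        also have "\<dots> \<le> (real n)\<^sup>2"
        proof (intro power_mono)
          have "(2::real) ^ G \<le> 2 ^ log_nat n" using Glog by (intro power_increasing) auto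
          also have "\<dots> \<le> n" using two_power_log_nat[OF n_pos] by (simp flip: of_nat_le_iff)
          finally show "(2::real) ^ G \<le> n" .
        qed simp
        finally show "potential (stk (\<sigma>3 u)) \<le> (real n)\<^sup>2" .
      qed
      finally show ?thesis by (simp add: power2_eq_square power3_eq_cube)
    qed
    moreover have "prob (exec n b (replicate Tc Spread) \<sigma>3)
      {\<sigma>'. \<not> (all_settled n \<sigma>' \<and> (\<exists>G. (\<forall>u<n. gs (\<sigma>' u) = G # gs (\<sigma> u)) \<and>
        real M * 2 ^ G \<ge> real M * n / (64 * max M (sqrt n))))} \<le>
      prob (exec n b (replicate Tc Spread) \<sigma>3) {\<sigma>'. \<not> all_settled n \<sigma>'}"
      using gs G2 by (intro measure_pmf.finite_measure_mono_AE) (auto simp: AE_measure_pmf_iff)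
    ultimately show "prob (exec n b (replicate Tc Spread) (conf n inflate \<sigma>2))
      {\<sigma>'. \<not> (all_settled n \<sigma>' \<and> (\<exists>G. (\<forall>u<n. gs (\<sigma>' u) = G # gs (\<sigma> u)) \<and>
        real M * 2 ^ G \<ge> real M * n / (64 * max M (sqrt n))))} \<le> (24/25) ^ Tc * real n ^ 3"
      by (simp add: \<sigma>3_def)
  qed simp
qed (use M Ta in auto)

section \<open>Trials\<close>

text \<open>The first success is kept and never overwritten; 0 is excluded because it stands for an
  empty stack.\<close>

definition check :: "nat \<Rightarrow> data \<Rightarrow> data" where
  "check p d = d\<lparr>smp := [], cnd := (case cnd d of Some x \<Rightarrow> Some x
     | None \<Rightarrow> if \<exists>i. i \<noteq> 0 \<and> smp d = replicate p i then Some (hd (smp d)) else None)\<rparr>"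

definition trial :: "nat \<Rightarrow> instr list" where
  "trial p = replicate p Sample @ [det (check p)]"

primrec trials :: "nat \<Rightarrow> nat \<Rightarrow> instr list" where
  "trials 0 p = []"
| "trials (Suc R) p = trial p @ trials R p"

text \<open>
  As long as the stacks do not change, a node only reads the replies of the others, so that the
  nodes evolve independently.
\<close>

definition node_step :: "nat \<Rightarrow> (nat \<Rightarrow> nat) \<Rightarrow> instr \<Rightarrow> data \<Rightarrow> data pmf" where
  "node_step n \<rho> I d = (case I of Local f \<Rightarrow> f d
     | Sample \<Rightarrow> map_pmf (\<lambda>v. d\<lparr>smp := \<rho> v # smp d\<rparr>) (pmf_of_set {..<n})
     | _ \<Rightarrow> return_pmf d)"

primrec node_exec :: "nat \<Rightarrow> (nat \<Rightarrow> nat) \<Rightarrow> instr list \<Rightarrow> data \<Rightarrow> data pmf" where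
  "node_exec n \<rho> [] d = return_pmf d"
| "node_exec n \<rho> (I # P) d = bind_pmf (node_step n \<rho> I d) (node_exec n \<rho> P)"

lemma node_exec_append: "node_exec n \<rho> (P @ Q) d = bind_pmf (node_exec n \<rho> P d) (node_exec n \<rho> Q)"
  by (induction P arbitrary: d) (auto simp: bind_return_pmf bind_assoc_pmf intro!: bind_pmf_cong)

definition read_only :: "instr \<Rightarrow> bool" where
  "read_only I \<longleftrightarrow> I = Sample \<or> (\<exists>f. I = Local f \<and> (\<forall>d. \<forall>d'\<in>set_pmf (f d). stk d' = stk d))"

text \<open>In a pull round node \<open>u\<close> depends on its own target only, so the product law
  of the targets becomes a product law of the new states.\<close>

lemma rnd_read_only:
  assumes "read_only I" "0 < n" "\<And>u. u < n \<Longrightarrow> trunc b (top_value (stk (\<sigma> u))) = \<rho> u"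
  shows "rnd n b I \<sigma> = Pi_pmf {..<n} undefined (\<lambda>u. node_step n \<rho> I (\<sigma> u))"
proof (cases "I = Sample")
  case True
  have "rnd n b Sample \<sigma> = map_pmf (\<lambda>t u. if u < n then (\<sigma> u)\<lparr>smp := \<rho> (t u) # smp (\<sigma> u)\<rparr> else undefined) (targets n)"
    unfolding rnd_Sample using assms(3) targets_less by (intro map_pmf_cong refl ext) auto
  also have "\<dots> = bind_pmf (targets n) (\<lambda>t. Pi_pmf {..<n} undefined
      (\<lambda>u. return_pmf ((\<sigma> u)\<lparr>smp := \<rho> (t u) # smp (\<sigma> u)\<rparr>)))"
    by (simp only: bind_targets_return)
  also have "\<dots> = Pi_pmf {..<n} undefined (\<lambda>u. bind_pmf (pmf_of_set {..<n})
      (\<lambda>v. return_pmf ((\<sigma> u)\<lparr>smp := \<rho> v # smp (\<sigma> u)\<rparr>)))"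
    unfolding targets_def by (subst Pi_pmf_bind[where d' = 0]) auto
  finally show ?thesis using True by (simp add: node_step_def map_pmf_def)
next
  case False
  then show ?thesis using assms(1) by (auto simp: read_only_def rnd_Local node_step_def)
qed

lemma exec_read_only:
  assumes "0 < n" "\<forall>I\<in>set P. read_only I" "\<And>u. u < n \<Longrightarrow> trunc b (top_value (stk (\<sigma> u))) = \<rho> u"
    and "\<And>u. \<not> u < n \<Longrightarrow> \<sigma> u = undefined"
  shows "exec n b P \<sigma> = Pi_pmf {..<n} undefined (\<lambda>u. node_exec n \<rho> P (\<sigma> u))"
  using assms(2-4)
proof (induction P arbitrary: \<sigma>)
  case Nil
  then show ?case by (auto intro!: arg_cong[where f = return_pmf])
next
  case (Cons I P)
  have "exec n b (I # P) \<sigma> = bind_pmf (Pi_pmf {..<n} undefined (\<lambda>u. node_step n \<rho> I (\<sigma> u))) (exec n b P)"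
    using Cons.prems assms(1) by (simp add: rnd_read_only)
  also have "\<dots> = bind_pmf (Pi_pmf {..<n} undefined (\<lambda>u. node_step n \<rho> I (\<sigma> u)))
     (\<lambda>\<sigma>'. Pi_pmf {..<n} undefined (\<lambda>u. node_exec n \<rho> P (\<sigma>' u)))"
  proof (intro bind_pmf_cong refl Cons.IH)
    fix \<sigma>' u assume \<sigma>': "\<sigma>' \<in> set_pmf (Pi_pmf {..<n} undefined (\<lambda>u. node_step n \<rho> I (\<sigma> u)))"
    then show "\<not> u < n \<Longrightarrow> \<sigma>' u = undefined" by (auto simp: set_Pi_pmf PiE_dflt_def)
    assume u: "u < n"
    then have "\<sigma>' u \<in> set_pmf (node_step n \<rho> I (\<sigma> u))" using \<sigma>' by (auto simp: set_Pi_pmf PiE_dflt_def)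
    moreover have "read_only I" using Cons.prems by simp
    ultimately have "stk (\<sigma>' u) = stk (\<sigma> u)" by (auto simp: read_only_def node_step_def)
    then show "trunc b (top_value (stk (\<sigma>' u))) = \<rho> u" using Cons.prems u by simp
  qed (use Cons.prems in auto)
  also have "\<dots> = Pi_pmf {..<n} undefined (\<lambda>u. bind_pmf (node_step n \<rho> I (\<sigma> u)) (node_exec n \<rho> P))"
    by (rule Pi_pmf_bind[symmetric]) simp
  finally show ?case by simp
qed

lemma read_only_trials: "\<forall>I\<in>set (trials R p). read_only I"
  by (induction R) (auto simp: trial_def read_only_def check_def)

section \<open>The law of the candidate of one node\<close>

definition outcome :: "nat \<Rightarrow> nat list \<Rightarrow> nat option" where
  "outcome p l = (if \<exists>i. i \<noteq> 0 \<and> l = replicate p i then Some (hd l) else None)"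

definition record_outcome :: "nat option \<Rightarrow> data \<Rightarrow> data" where
  "record_outcome c d = d\<lparr>smp := [], cnd := (case cnd d of Some x \<Rightarrow> Some x | None \<Rightarrow> c)\<rparr>"

definition trial_pmf :: "nat \<Rightarrow> nat pmf \<Rightarrow> nat option pmf" where
  "trial_pmf p S = map_pmf (\<lambda>l. outcome p (rev l)) (replicate_pmf p S)"

primrec trials_pmf :: "nat \<Rightarrow> nat \<Rightarrow> nat pmf \<Rightarrow> nat option pmf" where
  "trials_pmf 0 p S = return_pmf None"
| "trials_pmf (Suc R) p S =
     bind_pmf (trial_pmf p S) (\<lambda>c. case c of None \<Rightarrow> trials_pmf R p S | Some i \<Rightarrow> return_pmf (Some i))"

lemma node_exec_samples:
  "node_exec n \<rho> (replicate k Sample) d =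
     map_pmf (\<lambda>l. d\<lparr>smp := rev l @ smp d\<rparr>) (replicate_pmf k (map_pmf \<rho> (pmf_of_set {..<n})))"
proof (induction k arbitrary: d)
  case (Suc k)
  let ?S = "map_pmf \<rho> (pmf_of_set {..<n})"
  have "node_exec n \<rho> (replicate (Suc k) Sample) d =
      bind_pmf (pmf_of_set {..<n}) (\<lambda>v. map_pmf (\<lambda>l. d\<lparr>smp := rev l @ \<rho> v # smp d\<rparr>) (replicate_pmf k ?S))"
    by (simp add: node_step_def bind_map_pmf Suc)
  also have "\<dots> = map_pmf (\<lambda>l. d\<lparr>smp := rev l @ smp d\<rparr>) (replicate_pmf (Suc k) ?S)"
    unfolding replicate_pmf.simps map_bind_pmf bind_map_pmf
    by (intro bind_pmf_cong refl) (simp add: map_pmf_def bind_return_pmf)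
  finally show ?case .
qed simp

lemma node_exec_trial:
  assumes "smp d = []"
  shows "node_exec n \<rho> (trial p) d =
    map_pmf (\<lambda>c. record_outcome c d) (trial_pmf p (map_pmf \<rho> (pmf_of_set {..<n})))"
proof -
  have "check p (d\<lparr>smp := l\<rparr>) = record_outcome (outcome p l) d" for l
    by (auto simp: check_def record_outcome_def outcome_def split: option.split)
  moreover have "node_exec n \<rho> [det (check p)] = (\<lambda>d. return_pmf (check p d))"
    by (simp add: node_step_def bind_return_pmf fun_eq_iff)
  then have "bind_pmf q (node_exec n \<rho> [det (check p)]) = map_pmf (check p) q" for q
    by (simp add: map_pmf_def)
  ultimately show ?thesis
    unfolding trial_def node_exec_append node_exec_samples
    by (simp add: trial_pmf_def assms map_pmf_comp)
qed

lemma node_exec_trials: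
  assumes "smp d = []"
  shows "node_exec n \<rho> (trials R p) d =
    map_pmf (\<lambda>c. record_outcome c d) (trials_pmf R p (map_pmf \<rho> (pmf_of_set {..<n})))"
  using assms
proof (induction R arbitrary: d)
  case 0
  then show ?case by (simp add: record_outcome_def split: option.split)
next
  case (Suc R)
  let ?S = "map_pmf \<rho> (pmf_of_set {..<n})"
  have rr: "record_outcome c' (record_outcome c d) = record_outcome (case c of None \<Rightarrow> c' | Some i \<Rightarrow> Some i) d" for c c'
    by (auto simp: record_outcome_def split: option.split)
  have "node_exec n \<rho> (trials (Suc R) p) d =
      bind_pmf (trial_pmf p ?S) (\<lambda>c. node_exec n \<rho> (trials R p) (record_outcome c d))"
    by (simp add: node_exec_append node_exec_trial Suc.prems bind_map_pmf)
  also have "\<dots> = bind_pmf (trial_pmf p ?S) (\<lambda>c. map_pmf (\<lambda>c'. record_outcome c' (record_outcome c d)) (trials_pmf R p ?S))"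
    by (intro bind_pmf_cong refl Suc.IH) (simp add: record_outcome_def)
  also have "\<dots> = bind_pmf (trial_pmf p ?S) (\<lambda>c. map_pmf (\<lambda>c'. record_outcome c' d)
      (case c of None \<Rightarrow> trials_pmf R p ?S | Some i \<Rightarrow> return_pmf (Some i)))"
    unfolding rr by (intro bind_pmf_cong refl) (auto simp: map_pmf_const split: option.split)
  finally show ?case by (simp add: map_bind_pmf)
qed

definition with_candidates :: "nat \<Rightarrow> (nat \<Rightarrow> data) \<Rightarrow> (nat \<Rightarrow> nat option) \<Rightarrow> nat \<Rightarrow> data" where
  "with_candidates n \<sigma> c = (\<lambda>u. if u < n then (\<sigma> u)\<lparr>smp := [], cnd := c u\<rparr> else undefined)"

lemma exec_trials:
  fixes b :: nat
  assumes "0 < n" "\<And>u. u < n \<Longrightarrow> smp (\<sigma> u) = [] \<and> cnd (\<sigma> u) = None" "\<And>u. \<not> u < n \<Longrightarrow> \<sigma> u = undefined"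
  defines "S \<equiv> map_pmf (\<lambda>v. trunc b (top_value (stk (\<sigma> v)))) (pmf_of_set {..<n})"
  shows "exec n b (trials R p) \<sigma> =
    map_pmf (with_candidates n \<sigma>) (Pi_pmf {..<n} None (\<lambda>_. trials_pmf R p S))"
proof -
  have "exec n b (trials R p) \<sigma> = Pi_pmf {..<n} undefined (\<lambda>u.
      node_exec n (\<lambda>v. trunc b (top_value (stk (\<sigma> v)))) (trials R p) (\<sigma> u))"
    by (intro exec_read_only assms(1,3) read_only_trials refl)
  also have "\<dots> = Pi_pmf {..<n} undefined (\<lambda>u. bind_pmf (trials_pmf R p S)
      (\<lambda>c. return_pmf ((\<sigma> u)\<lparr>smp := [], cnd := c\<rparr>)))"
  proof (intro Pi_pmf_cong refl)
    fix u assume "u \<in> {..<n}"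
    then have u: "smp (\<sigma> u) = []" "cnd (\<sigma> u) = None" using assms(2) by auto
    have "record_outcome c (\<sigma> u) = (\<sigma> u)\<lparr>smp := [], cnd := c\<rparr>" for c
      using u by (simp add: record_outcome_def)
    then show "node_exec n (\<lambda>v. trunc b (top_value (stk (\<sigma> v)))) (trials R p) (\<sigma> u) =
        bind_pmf (trials_pmf R p S) (\<lambda>c. return_pmf ((\<sigma> u)\<lparr>smp := [], cnd := c\<rparr>))"
      unfolding node_exec_trials[OF u(1)] S_def[symmetric] by (simp add: map_pmf_def[of _ "trials_pmf R p S"])
  qed
  also have "\<dots> = bind_pmf (Pi_pmf {..<n} None (\<lambda>_. trials_pmf R p S))
      (\<lambda>c. Pi_pmf {..<n} undefined (\<lambda>u. return_pmf ((\<sigma> u)\<lparr>smp := [], cnd := c u\<rparr>)))"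
    by (rule Pi_pmf_bind) simp
  finally show ?thesis
    unfolding map_pmf_def[of "with_candidates n \<sigma>"] by (simp add: with_candidates_def)
qed

lemma pmf_replicate_replicate: "pmf (replicate_pmf k S) (replicate k i) = pmf S i ^ k"
proof (induction k)
  case (Suc k)
  have "replicate_pmf (Suc k) S = map_pmf (\<lambda>(x, xs). x # xs) (pair_pmf S (replicate_pmf k S))"
    by (simp add: pair_pmf_def map_pmf_def bind_assoc_pmf bind_return_pmf)
  then have "pmf (replicate_pmf (Suc k) S) (replicate (Suc k) i) =
      pmf (map_pmf (\<lambda>(x, xs). x # xs) (pair_pmf S (replicate_pmf k S))) ((\<lambda>(x, xs). x # xs) (i, replicate k i))"
    by simp
  also have "\<dots> = pmf (pair_pmf S (replicate_pmf k S)) (i, replicate k i)"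
    by (rule pmf_map_inj') (auto simp: inj_def)
  finally show ?case using Suc by (simp add: pmf_pair)
qed simp

lemma pmf_trial:
  assumes "0 < p"
  shows "pmf (trial_pmf p S) (Some i) = (if i = 0 then 0 else pmf S i ^ p)"
proof -
  have "outcome p (rev l) = Some i \<longleftrightarrow> i \<noteq> 0 \<and> l = replicate p i" for l
  proof
    assume "outcome p (rev l) = Some i"
    then obtain j where j: "j \<noteq> 0" "rev l = replicate p j" "hd (rev l) = i"
      by (auto simp: outcome_def split: if_splits)
    then have "j = i" using assms by simp
    then show "i \<noteq> 0 \<and> l = replicate p i" using j by (simp add: rev_swap)
  next
    assume "i \<noteq> 0 \<and> l = replicate p i"
    then show "outcome p (rev l) = Some i" using assms by (auto simp: outcome_def)
  qed
  then have *: "(\<lambda>l. outcome p (rev l)) -` {Some i} = (if i = 0 then {} else {replicate p i})" by auto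
  show ?thesis
    unfolding trial_pmf_def pmf_map * by (simp add: measure_pmf_single pmf_replicate_replicate)
qed

lemma pmf_trials_None: "pmf (trials_pmf R p S) None = pmf (trial_pmf p S) None ^ R"
proof (induction R)
  case (Suc R)
  have "pmf (trials_pmf (Suc R) p S) None = expect (trial_pmf p S)
     (\<lambda>c. pmf (trials_pmf R p S) None * indicator {None} c)"
    unfolding trials_pmf.simps pmf_bind
    by (intro Bochner_Integration.integral_cong refl) (auto simp: indicator_def split: option.split)
  then show ?case using Suc by (simp add: measure_pmf_single mult.commute)
qed simp

text \<open>Repeating until the first success preserves all ratios: \<open>w\<close> is the expected
  number of trials carried out, with recursion 1 + w times the failure probability.\<close>

lemma pmf_trials_Some:
  "\<exists>w. \<forall>i. pmf (trials_pmf R p S) (Some i) = w * pmf (trial_pmf p S) (Some i)"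
proof (induction R)
  case 0
  show ?case by (intro exI[of _ 0]) simp
next
  case (Suc R)
  then obtain w where w: "\<And>i. pmf (trials_pmf R p S) (Some i) = w * pmf (trial_pmf p S) (Some i)" by auto
  have "pmf (trials_pmf (Suc R) p S) (Some i) =
      (1 + w * pmf (trial_pmf p S) None) * pmf (trial_pmf p S) (Some i)" for i
  proof -
    have "pmf (trials_pmf (Suc R) p S) (Some i) = expect (trial_pmf p S)
       (\<lambda>c. indicator {Some i} c + pmf (trials_pmf R p S) (Some i) * indicator {None} c)"
      unfolding trials_pmf.simps pmf_bind
      by (intro Bochner_Integration.integral_cong refl) (auto simp: indicator_def split: option.split)
    also have "\<dots> = pmf (trial_pmf p S) (Some i) + pmf (trials_pmf R p S) (Some i) * pmf (trial_pmf p S) None"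
      by (subst Bochner_Integration.integral_add)
        (auto simp: measure_pmf_single measure_pmf.emeasure_eq_measure)
    finally show ?thesis by (simp add: w algebra_simps)
  qed
  then show ?case by blast
qed

lemma trials_pmf_range: "Some i \<in> set_pmf (trials_pmf R p S) \<Longrightarrow> 0 < p \<Longrightarrow> i \<in> set_pmf S \<and> i \<noteq> 0"
proof -
  assume "Some i \<in> set_pmf (trials_pmf R p S)" "0 < p"
  then have "pmf (trials_pmf R p S) (Some i) \<noteq> 0" by (simp add: set_pmf_iff)
  then have "pmf (trial_pmf p S) (Some i) \<noteq> 0" using pmf_trials_Some[of R p S] by auto
  then show ?thesis using \<open>0 < p\<close> by (auto simp: pmf_trial set_pmf_iff split: if_splits)
qed

section \<open>Electing one trial\<close>

text \<open>Tickets are drawn without regard to the candidate. They are at least 1, so the 0 shown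
  by nodes without candidate never wins against one.\<close>

definition draw :: "nat \<Rightarrow> data \<Rightarrow> data pmf" where
  "draw K d = map_pmf (\<lambda>r. d\<lparr>prio := r, acc := (if cnd d = None then 0 else r)\<rparr>) (pmf_of_set {1..K})"

definition elect :: "token list \<Rightarrow> data \<Rightarrow> data" where
  "elect seeds d = d\<lparr>leader := (cnd d \<noteq> None \<and> acc d = prio d),
     stk := (if cnd d \<noteq> None \<and> acc d = prio d then seeds else [])\<rparr>"

definition election :: "token list \<Rightarrow> nat \<Rightarrow> nat \<Rightarrow> nat \<Rightarrow> instr list" where
  "election seeds K Tb Tc = Local (draw K) # replicate Tb PullMax @ det (elect seeds) # replicate Tc Spread"

text \<open>\<open>Suc\<close> separates an announcement from silence. The exponents are included so
  that each receiver can compare them with its own.\<close>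

definition announcement :: "data \<Rightarrow> nat" where
  "announcement d = Suc (prod_encode (the (cnd d), list_encode (gs d)))"

text \<open>The announced number is a parameter, so that the analysis can replace it by 1 and ask
  only whom it reaches.\<close>

definition announce :: "(data \<Rightarrow> nat) \<Rightarrow> data \<Rightarrow> data" where
  "announce a d = d\<lparr>ok := (ok d \<and> settled (stk d)), acc := (if leader d then a d else 0)\<rparr>"

definition finale :: "nat \<Rightarrow> instr list" where
  "finale Tb = det (announce announcement) # replicate Tb PullMax"

definition output_value :: "data \<Rightarrow> nat option" where
  "output_value d = (if ok d \<and> acc d \<noteq> 0 \<and> snd (prod_decode (acc d - 1)) = list_encode (gs d)
     then Some (fst (prod_decode (acc d - 1))) else None)"

section \<open>Relabelling whole runs node by node\<close>

definition hmap :: "nat \<Rightarrow> (nat \<Rightarrow> data \<Rightarrow> data) \<Rightarrow> (nat \<Rightarrow> data) \<Rightarrow> nat \<Rightarrow> data" where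
  "hmap n h \<sigma> = (\<lambda>u. if u < n then h u (\<sigma> u) else undefined)"

text \<open>A relabelling that commutes with every instruction commutes with the run. It is applied
  to the values of the candidates and to the content of the announcement, showing that neither
  influences the course of events.\<close>

lemma exec_hmap:
  assumes "\<And>I \<sigma>. I \<in> set P \<Longrightarrow> rnd n b I (hmap n h \<sigma>) = map_pmf (hmap n h) (rnd n b I \<sigma>)"
  shows "exec n b P (hmap n h \<sigma>) = map_pmf (hmap n h) (exec n b P \<sigma>)"
  using assms
proof (induction P arbitrary: \<sigma>)
  case (Cons I P)
  have "exec n b (I # P) (hmap n h \<sigma>) = bind_pmf (rnd n b I \<sigma>) (\<lambda>\<sigma>'. exec n b P (hmap n h \<sigma>'))"
    using Cons.prems by (simp add: bind_map_pmf)
  also have "\<dots> = bind_pmf (rnd n b I \<sigma>) (\<lambda>\<sigma>'. map_pmf (hmap n h) (exec n b P \<sigma>'))"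
    using Cons.prems by (intro bind_pmf_cong refl Cons.IH) auto
  finally show ?case by (simp add: map_bind_pmf)
qed simp

lemma rnd_hmap_PullMax:
  assumes "\<And>u d. acc (h u d) = \<phi> (acc d)" "\<And>u d x. h u (d\<lparr>acc := x\<rparr>) = (h u d)\<lparr>acc := \<phi> x\<rparr>"
    "\<And>x y. \<phi> (max x (trunc b y)) = max (\<phi> x) (trunc b (\<phi> y))"
  shows "rnd n b PullMax (hmap n h \<sigma>) = map_pmf (hmap n h) (rnd n b PullMax \<sigma>)"
  unfolding rnd_PullMax map_pmf_comp
  by (intro map_pmf_cong refl) (auto simp: hmap_def fun_eq_iff assms targets_less)

lemma rnd_hmap_Spread:
  assumes "\<And>u d. stk (h u d) = stk d" "\<And>u d x. h u (d\<lparr>stk := x\<rparr>) = (h u d)\<lparr>stk := x\<rparr>"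
  shows "rnd n b Spread (hmap n h \<sigma>) = map_pmf (hmap n h) (rnd n b Spread \<sigma>)"
proof -
  have "arrivals n b (\<lambda>w. stk (hmap n h \<sigma> w)) t u = arrivals n b (\<lambda>w. stk (\<sigma> w)) t u" for t u
    unfolding arrivals_def
    by (intro arg_cong[where f = "\<lambda>x. map prod_decode (sorted_list_of_multiset x)"] sum.cong)
      (auto simp: hmap_def assms)
  then show ?thesis
    unfolding rnd_Spread map_pmf_comp
    by (intro map_pmf_cong refl) (auto simp: hmap_def fun_eq_iff assms)
qed

lemma rnd_hmap_Local:
  assumes "\<And>u d. f (h u d) = map_pmf (h u) (f d)"
  shows "rnd n b (Local f) (hmap n h \<sigma>) = map_pmf (hmap n h) (rnd n b (Local f) \<sigma>)"
proof -
  have "rnd n b (Local f) (hmap n h \<sigma>) = Pi_pmf {..<n} undefined (\<lambda>u. bind_pmf (f (\<sigma> u)) (\<lambda>d. return_pmf (h u d)))"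
    unfolding rnd_Local by (intro Pi_pmf_cong refl) (auto simp: hmap_def assms map_pmf_def)
  also have "\<dots> = bind_pmf (Pi_pmf {..<n} undefined (\<lambda>u. f (\<sigma> u)))
      (\<lambda>\<sigma>'. Pi_pmf {..<n} undefined (\<lambda>u. return_pmf (h u (\<sigma>' u))))"
    by (rule Pi_pmf_bind) simp
  finally show ?thesis by (simp add: rnd_Local map_pmf_def hmap_def)
qed

definition leaders :: "nat \<Rightarrow> (nat \<Rightarrow> data) \<Rightarrow> nat set" where
  "leaders n \<sigma> = {u. u < n \<and> leader (\<sigma> u)}"

text \<open>For n \<ge> 32 a token then stands for between n/32 and n/16 copies: large enough that
  at most 17 tokens reach n/2, which keeps their potential polynomial, and small enough that
  overshooting n/2 by one token stays below 3n/5.\<close>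

definition seed_exp :: "nat \<Rightarrow> nat" where
  "seed_exp n = log_nat n - 4"

definition seed_num :: "nat \<Rightarrow> nat" where
  "seed_num n = n div 2 ^ Suc (seed_exp n) + 1"

definition seeds :: "nat \<Rightarrow> token list" where
  "seeds n = replicate (seed_num n) (0, seed_exp n)"

lemma quota_seeds: "quota (\<lambda>_. 1) (seeds n) = seed_num n * 2 ^ seed_exp n"
  by (simp add: quota_def seeds_def map_replicate_const sum_list_replicate)

text \<open>
  More than half of the nodes are needed to hold the copies that a single leader creates, which
  is how a second leader is ruled out.
\<close>

lemma quota_seeds_gt: "n < 2 * quota (\<lambda>_. 1) (seeds n)"
proof -
  have "n < (n div 2 ^ Suc (seed_exp n) + 1) * 2 ^ Suc (seed_exp n)"
    using dividend_less_div_times[of "2 ^ Suc (seed_exp n)" n] by (simp add: algebra_simps)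
  then show ?thesis unfolding quota_seeds seed_num_def by (simp add: algebra_simps)
qed

text \<open>\<open>B\<close> bounds the values, \<open>Ta\<close>, \<open>Tb\<close> and
  \<open>Tc\<close> are the rounds of averaging, broadcasting and spreading, \<open>R\<close> is the
  number of trials per node and \<open>K\<close> the number of tickets. Exponents reach
  \<open>2 * log_nat n\<close> after two replications.\<close>

locale lp_sampler =
  fixes n b B p Ta Tb Tc R K :: nat
  assumes n_ge: "32 \<le> n" and p_pos: "0 < p" and K: "0 < K" "K < 2 ^ b"
    and token_fits: "\<And>v g. v \<le> B \<Longrightarrow> g \<le> 2 * log_nat n \<Longrightarrow> prod_encode (v, g) < 2 ^ b"
    and code_fits: "\<And>v x y. v \<le> B \<Longrightarrow> x \<le> log_nat n \<Longrightarrow> y \<le> log_nat n \<Longrightarrow>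
      Suc (prod_encode (v, list_encode [x, y])) < 2 ^ b"
    and Ta: "1 \<le> Ta" "Ta < b"
begin

sublocale spreading n b B "2 * log_nat n"
  using n_ge token_fits by unfold_locales auto

lemma value_fits: "v \<le> B \<Longrightarrow> v < 2 ^ b"
  using token_fits[of v 0] le_prod_encode_1[of v 0] by simp

abbreviation "vote \<equiv> election (seeds n) K Tb Tc"

lemma exec_vote:
  "exec n b vote \<sigma> = bind_pmf (rnd n b (Local (draw K)) \<sigma>)
     (\<lambda>\<sigma>1. bind_pmf (exec n b (replicate Tb PullMax) \<sigma>1)
       (\<lambda>\<sigma>2. exec n b (replicate Tc Spread) (conf n (elect (seeds n)) \<sigma>2)))"
  unfolding election_def exec.simps(2)[of n b "Local (draw K)"] exec_append exec_det by (rule refl)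

lemma seeds_bounded: "token_bound B (2 * log_nat n) (seeds n)"
  by (auto simp: token_bound_def seeds_def seed_exp_def)

text \<open>Holds on every run, including those with several self-declared leaders or none. The last
  part turns the number of tokens into a count of the leaders.\<close>

lemma vote_sure:
  assumes "\<tau> \<in> set_pmf (exec n b vote \<sigma>)"
  shows "\<And>u. u < n \<Longrightarrow> cnd (\<tau> u) = cnd (\<sigma> u)" "\<And>u. u < n \<Longrightarrow> gs (\<tau> u) = gs (\<sigma> u)"
    "\<And>u. u < n \<Longrightarrow> ok (\<tau> u) = ok (\<sigma> u)" "\<And>u. u < n \<Longrightarrow> leader (\<tau> u) \<Longrightarrow> cnd (\<tau> u) \<noteq> None"
    "total_quota n (\<lambda>_. 1) \<tau> = quota (\<lambda>_. 1) (seeds n) * card (leaders n \<tau>)"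
proof -
  from assms obtain \<sigma>1 \<sigma>2 where
    1: "\<sigma>1 \<in> set_pmf (rnd n b (Local (draw K)) \<sigma>)" and
    2: "\<sigma>2 \<in> set_pmf (exec n b (replicate Tb PullMax) \<sigma>1)" and
    3: "\<tau> \<in> set_pmf (exec n b (replicate Tc Spread) (conf n (elect (seeds n)) \<sigma>2))"
    unfolding exec_vote by auto
  have f1: "cnd (\<sigma>1 u) = cnd (\<sigma> u)" "gs (\<sigma>1 u) = gs (\<sigma> u)" "ok (\<sigma>1 u) = ok (\<sigma> u)" if "u < n" for u
  proof -
    have "\<sigma>1 u \<in> set_pmf (draw K (\<sigma> u))" using 1 that by (auto simp: rnd_Local set_Pi_pmf PiE_dflt_def)
    then show "cnd (\<sigma>1 u) = cnd (\<sigma> u)" "gs (\<sigma>1 u) = gs (\<sigma> u)" "ok (\<sigma>1 u) = ok (\<sigma> u)"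
      by (auto simp: draw_def)
  qed
  have f2: "cnd (\<sigma>2 u) = cnd (\<sigma>1 u)" "gs (\<sigma>2 u) = gs (\<sigma>1 u)" "ok (\<sigma>2 u) = ok (\<sigma>1 u)" if "u < n" for u
    using arg_cong[OF PullMax_frame[OF 2 that], of cnd] arg_cong[OF PullMax_frame[OF 2 that], of gs]
      arg_cong[OF PullMax_frame[OF 2 that], of ok] by simp_all
  let ?\<sigma>3 = "conf n (elect (seeds n)) \<sigma>2"
  have f3: "cnd (\<tau> u) = cnd (?\<sigma>3 u)" "gs (\<tau> u) = gs (?\<sigma>3 u)" "ok (\<tau> u) = ok (?\<sigma>3 u)"
    "leader (\<tau> u) = leader (?\<sigma>3 u)" if "u < n" for u
    using arg_cong[OF Spread_frame[OF 3 that], of cnd] arg_cong[OF Spread_frame[OF 3 that], of gs]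
      arg_cong[OF Spread_frame[OF 3 that], of ok] arg_cong[OF Spread_frame[OF 3 that], of leader] by simp_all
  fix u assume u: "u < n"
  show "cnd (\<tau> u) = cnd (\<sigma> u)" "gs (\<tau> u) = gs (\<sigma> u)" "ok (\<tau> u) = ok (\<sigma> u)"
    using f1[OF u] f2[OF u] f3[OF u] u by (simp_all add: elect_def)
  show "leader (\<tau> u) \<Longrightarrow> cnd (\<tau> u) \<noteq> None"
    using f3[OF u] u by (auto simp: elect_def)
next
  from assms obtain \<sigma>2 where
    3: "\<tau> \<in> set_pmf (exec n b (replicate Tc Spread) (conf n (elect (seeds n)) \<sigma>2))"
    unfolding exec_vote by auto
  let ?\<sigma>3 = "conf n (elect (seeds n)) \<sigma>2"
  have tb: "tokens_bounded n B (2 * log_nat n) ?\<sigma>3"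
    using seeds_bounded by (auto simp: tokens_bounded_def token_bound_def elect_def)
  have lead: "leader (\<tau> u) = leader (?\<sigma>3 u)" if "u < n" for u
    using arg_cong[OF Spread_frame[OF 3 that], of leader] by simp
  have "total_quota n (\<lambda>_. 1) \<tau> = total_quota n (\<lambda>_. 1) ?\<sigma>3" by (rule Spread_invariants(2)[OF 3 tb])
  also have "\<dots> = (\<Sum>u<n. if leader (\<tau> u) then quota (\<lambda>_. 1) (seeds n) else 0)"
    unfolding total_quota_def by (intro sum.cong) (auto simp: lead elect_def quota_def)
  also have "\<dots> = quota (\<lambda>_. 1) (seeds n) * card (leaders n \<tau>)"
    by (simp add: sum.If_cases leaders_def lessThan_def Collect_conj_eq[symmetric] conj_commute)
  finally show "total_quota n (\<lambda>_. 1) \<tau> = quota (\<lambda>_. 1) (seeds n) * card (leaders n \<tau>)" .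
qed

definition recolour :: "(nat \<Rightarrow> nat) \<Rightarrow> nat \<Rightarrow> data \<Rightarrow> data" where
  "recolour a u d = d\<lparr>cnd := map_option (\<lambda>_. a u) (cnd d)\<rparr>"

text \<open>The election only asks whether \<open>cnd\<close> is \<open>None\<close>, which
  recolouring preserves.\<close>

lemma exec_vote_recolour: "exec n b vote (hmap n (recolour a) \<sigma>) = map_pmf (hmap n (recolour a)) (exec n b vote \<sigma>)"
proof (rule exec_hmap)
  fix I \<sigma> assume "I \<in> set vote"
  then consider "I = Local (draw K)" | "I = PullMax" | "I = det (elect (seeds n))" | "I = Spread"
    by (auto simp: election_def)
  then show "rnd n b I (hmap n (recolour a) \<sigma>) = map_pmf (hmap n (recolour a)) (rnd n b I \<sigma>)"
  proof cases
    case 1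
    show ?thesis unfolding 1
      by (rule rnd_hmap_Local) (auto simp: draw_def recolour_def map_pmf_comp intro!: map_pmf_cong)
  next
    case 2
    show ?thesis unfolding 2 by (rule rnd_hmap_PullMax[where \<phi> = "\<lambda>x. x"]) (auto simp: recolour_def)
  next
    case 3
    show ?thesis unfolding 3 by (rule rnd_hmap_Local) (auto simp: elect_def recolour_def)
  next
    case 4
    show ?thesis unfolding 4 by (rule rnd_hmap_Spread) (auto simp: recolour_def)
  qed
qed

text \<open>The chance that a run ends in agreement on the candidate of \<open>l\<close>, formulated
  without looking at that candidate: a broadcast of 1 stands in for the announcement.\<close>

definition win_prob :: "nat \<Rightarrow> (nat \<Rightarrow> data) \<Rightarrow> real" where
  "win_prob l \<sigma> = (if (\<forall>u<n. ok (\<sigma> u) \<and> settled (stk (\<sigma> u)) \<and> gs (\<sigma> u) = gs (\<sigma> l)) \<and> leaders n \<sigma> = {l}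
     then prob (exec n b (replicate Tb PullMax) (conf n (announce (\<lambda>_. 1)) \<sigma>)) {\<tau>. \<forall>u<n. acc (\<tau> u) \<noteq> 0}
     else 0)"

lemma win_prob_bounds: "0 \<le> win_prob l \<sigma>" "win_prob l \<sigma> \<le> 1"
  by (auto simp: win_prob_def)

lemma win_prob_recolour:
  assumes "l < n"
  shows "win_prob l (hmap n (recolour a) \<sigma>) = win_prob l \<sigma>"
proof -
  have h: "hmap n (recolour a) \<sigma> u = recolour a u (\<sigma> u)" if "u < n" for u \<sigma> using that by (simp add: hmap_def)
  have c: "conf n (announce (\<lambda>_. 1)) (hmap n (recolour a) \<sigma>) = hmap n (recolour a) (conf n (announce (\<lambda>_. 1)) \<sigma>)"
    by (auto simp: conf_def hmap_def announce_def recolour_def)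
  have e: "exec n b (replicate Tb PullMax) (hmap n (recolour a) \<sigma>') =
      map_pmf (hmap n (recolour a)) (exec n b (replicate Tb PullMax) \<sigma>')" for \<sigma>'
    by (rule exec_hmap) (auto simp: recolour_def intro!: rnd_hmap_PullMax[where \<phi> = "\<lambda>x. x"])
  have v: "hmap n (recolour a) -` {\<tau>. \<forall>u<n. acc (\<tau> u) \<noteq> 0} = {\<tau>. \<forall>u<n. acc (\<tau> u) \<noteq> 0}"
    by (auto simp: h recolour_def)
  have l: "leaders n (hmap n (recolour a) \<sigma>) = leaders n \<sigma>"
    by (auto simp: leaders_def h recolour_def)
  have "(\<forall>u<n. ok (hmap n (recolour a) \<sigma> u) \<and> settled (stk (hmap n (recolour a) \<sigma> u)) \<and>
        gs (hmap n (recolour a) \<sigma> u) = gs (hmap n (recolour a) \<sigma> l)) \<longleftrightarrow>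
      (\<forall>u<n. ok (\<sigma> u) \<and> settled (stk (\<sigma> u)) \<and> gs (\<sigma> u) = gs (\<sigma> l))"
    using assms by (auto simp: h recolour_def)
  then show ?thesis unfolding win_prob_def c e l measure_map_pmf v by simp
qed

definition unanimous :: "nat \<Rightarrow> (nat \<Rightarrow> data) set" where
  "unanimous i = {\<tau>. \<forall>u<n. output_value (\<tau> u) = Some i}"

lemma exec_finale: "exec n b (finale Tb) \<sigma> = exec n b (replicate Tb PullMax) (conf n (announce announcement) \<sigma>)"
  unfolding finale_def exec_det ..

text \<open>If some check fails or there is no leader, both sides are 0. Otherwise there is a single
  leader, and the real broadcast is an image of the broadcast of 1.\<close>

lemma finale_exact:
  assumes quota: "total_quota n (\<lambda>_. 1) \<sigma> = quota (\<lambda>_. 1) (seeds n) * card (leaders n \<sigma>)"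
    and cand: "\<And>u. u < n \<Longrightarrow> leader (\<sigma> u) \<Longrightarrow> \<exists>v\<le>B. cnd (\<sigma> u) = Some v"
    and gs: "\<And>u. u < n \<Longrightarrow> \<exists>x\<le>log_nat n. \<exists>y\<le>log_nat n. gs (\<sigma> u) = [x, y]"
  shows "prob (exec n b (finale Tb) \<sigma>) (unanimous i) =
    (\<Sum>l<n. if cnd (\<sigma> l) = Some i then win_prob l \<sigma> else 0)"
proof -
  let ?\<sigma>a = "conf n (announce announcement) \<sigma>"
  have frame: "ok (\<tau> u) \<longleftrightarrow> ok (\<sigma> u) \<and> settled (stk (\<sigma> u))" "gs (\<tau> u) = gs (\<sigma> u)"
    if "\<tau> \<in> set_pmf (exec n b (replicate Tb PullMax) (conf n (announce a) \<sigma>))" "u < n" for \<tau> u a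
    using arg_cong[OF PullMax_frame[OF that], of ok] arg_cong[OF PullMax_frame[OF that], of gs] that(2)
    by (simp_all add: announce_def)
  show ?thesis
  proof (cases "\<forall>u<n. ok (\<sigma> u) \<and> settled (stk (\<sigma> u))")
    case False
    then obtain u where u: "u < n" "\<not> (ok (\<sigma> u) \<and> settled (stk (\<sigma> u)))" by auto
    have "\<tau> \<notin> unanimous i" if "\<tau> \<in> set_pmf (exec n b (finale Tb) \<sigma>)" for \<tau>
      using frame(1)[OF that[unfolded exec_finale] u(1)] u by (auto simp: unanimous_def output_value_def)
    then have "prob (exec n b (finale Tb) \<sigma>) (unanimous i) = 0"
      by (auto simp: measure_pmf_zero_iff)
    moreover have "win_prob l \<sigma> = 0" for l using False by (auto simp: win_prob_def)
    ultimately show ?thesis by (simp cong: if_cong)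
  next
    case True
    \<comment> \<open>Settled stacks hold at most one copy each, and two leaders would create more
      than \<open>n\<close> copies.\<close>
    have "total_quota n (\<lambda>_. 1) \<sigma> \<le> (\<Sum>u<n. 1)"
      unfolding total_quota_def using True by (intro sum_mono) (simp add: quota_settled del: One_nat_def)
    then have "quota (\<lambda>_. 1) (seeds n) * card (leaders n \<sigma>) \<le> n" using quota by simp
    then have "quota (\<lambda>_. 1) (seeds n) * card (leaders n \<sigma>) < quota (\<lambda>_. 1) (seeds n) * 2"
      using quota_seeds_gt[of n] by linarith
    then have card: "card (leaders n \<sigma>) < 2" by simp
    have fin: "finite (leaders n \<sigma>)" by (simp add: leaders_def)
    show ?thesis
    proof (cases "leaders n \<sigma> = {}")
      case True
      then have acc0: "acc (?\<sigma>a u) \<le> 0" if "u < n" for u using that by (auto simp: announce_def leaders_def)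
      have "\<tau> \<notin> unanimous i" if "\<tau> \<in> set_pmf (exec n b (finale Tb) \<sigma>)" for \<tau>
        using PullMax_acc_le[OF that[unfolded exec_finale] acc0 n_pos] n_pos
        by (auto simp: unanimous_def output_value_def)
      then have "prob (exec n b (finale Tb) \<sigma>) (unanimous i) = 0"
        by (auto simp: measure_pmf_zero_iff)
      moreover have "win_prob l \<sigma> = 0" for l using True by (auto simp: win_prob_def)
      ultimately show ?thesis by (simp cong: if_cong)
    next
      case False
      then have "card (leaders n \<sigma>) = 1" using card fin by (simp add: card_eq_0_iff less_Suc_eq numeral_2_eq_2)
      then obtain l where l: "leaders n \<sigma> = {l}" by (auto simp: card_1_singleton_iff)
      then have ln: "l < n" "leader (\<sigma> l)" by (auto simp: leaders_def)
      have only: "leader (\<sigma> u) \<longleftrightarrow> u = l" if "u < n" for u using l that by (auto simp: leaders_def)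
      obtain v where v: "v \<le> B" "cnd (\<sigma> l) = Some v" using cand[OF ln] by auto
      define code where "code = announcement (\<sigma> l)"
      have code: "0 < code" "code < 2 ^ b"
        using gs[OF ln(1)] v code_fits[OF v(1)] by (auto simp: code_def announcement_def)
      \<comment> \<open>Turns a run that broadcasts 1 into one that broadcasts \<open>code\<close>:
        a node shows 0 or the announcement, and maxima respect this.\<close>
      define h where "h = (\<lambda>(u::nat) (d::data). d\<lparr>acc := (if acc d = 0 then 0 else code)\<rparr>)"
      have \<sigma>a: "?\<sigma>a = hmap n h (conf n (announce (\<lambda>_. 1)) \<sigma>)"
      proof
        fix u show "?\<sigma>a u = hmap n h (conf n (announce (\<lambda>_. 1)) \<sigma>) u"
          using only[of u] by (cases "u < n") (auto simp: hmap_def conf_def h_def announce_def code_def)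
      qed
      \<comment> \<open>As a positive \<open>code\<close> fits, \<open>b\<close> is positive, so
        truncation does not silence a nonzero number.\<close>
      have tr: "trunc b x = 0 \<longleftrightarrow> x = 0" for x
      proof -
        have "(2::nat) ^ b - 1 > 0" using code by linarith
        then show ?thesis by (auto simp: trunc_def min_def)
      qed
      have "exec n b (finale Tb) \<sigma> = map_pmf (hmap n h) (exec n b (replicate Tb PullMax) (conf n (announce (\<lambda>_. 1)) \<sigma>))"
        unfolding exec_finale \<sigma>a
      proof (rule exec_hmap)
        fix I \<sigma>' assume "I \<in> set (replicate Tb PullMax)"
        then have I: "I = PullMax" by auto
        show "rnd n b I (hmap n h \<sigma>') = map_pmf (hmap n h) (rnd n b I \<sigma>')"
          unfolding I
          by (rule rnd_hmap_PullMax[where \<phi> = "\<lambda>x. if x = 0 then 0 else code"])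
            (use tr code in \<open>auto simp: h_def trunc_id max_def\<close>)
      qed
      then have "prob (exec n b (finale Tb) \<sigma>) (unanimous i) = prob
          (exec n b (replicate Tb PullMax) (conf n (announce (\<lambda>_. 1)) \<sigma>)) (hmap n h -` unanimous i)" by simp
      also have "\<dots> = (if cnd (\<sigma> l) = Some i then win_prob l \<sigma> else 0)"
      proof -
        have eq: "output_value (hmap n h \<tau> u) = Some i \<longleftrightarrow> acc (\<tau> u) \<noteq> 0 \<and> gs (\<sigma> u) = gs (\<sigma> l) \<and> v = i"
          if "\<tau> \<in> set_pmf (exec n b (replicate Tb PullMax) (conf n (announce (\<lambda>_. 1)) \<sigma>))" "u < n" for \<tau> u
        proof -
          have "ok (\<tau> u)" using frame(1)[OF that] True that(2) by auto
          moreover have "gs (\<tau> u) = gs (\<sigma> u)" by (rule frame(2)[OF that])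
          ultimately show ?thesis
            using that(2) v(2) by (auto simp: output_value_def hmap_def h_def code_def announcement_def list_encode_eq)
        qed
        show ?thesis
        proof (cases "v = i \<and> (\<forall>u<n. gs (\<sigma> u) = gs (\<sigma> l))")
          case True': True
          have "prob (exec n b (replicate Tb PullMax) (conf n (announce (\<lambda>_. 1)) \<sigma>)) (hmap n h -` unanimous i) =
            prob (exec n b (replicate Tb PullMax) (conf n (announce (\<lambda>_. 1)) \<sigma>)) {\<tau>. \<forall>u<n. acc (\<tau> u) \<noteq> 0}"
            using True' eq by (intro measure_pmf.finite_measure_eq_AE) (auto simp: AE_measure_pmf_iff unanimous_def)
          then show ?thesis using True' True l v by (simp add: win_prob_def)
        next
          case False
          then have "prob (exec n b (replicate Tb PullMax) (conf n (announce (\<lambda>_. 1)) \<sigma>)) (hmap n h -` unanimous i) = 0"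
            using eq n_pos by (auto simp: measure_pmf_zero_iff unanimous_def)
          then show ?thesis using False v by (auto simp: win_prob_def)
        qed
      qed
      also have "\<dots> = (\<Sum>k<n. if k = l then (if cnd (\<sigma> l) = Some i then win_prob l \<sigma> else 0) else 0)"
        using ln by simp
      also have "\<dots> = (\<Sum>k<n. if cnd (\<sigma> k) = Some i then win_prob k \<sigma> else 0)"
        using l by (intro sum.cong) (auto simp: win_prob_def)
      finally show ?thesis .
    qed
  qed
qed

end

section \<open>Exactness\<close>

lemma integrable_pmf_bounded:
  fixes f :: "'a \<Rightarrow> real"
  assumes "\<And>x. 0 \<le> f x" "\<And>x. f x \<le> 1"
  shows "integrable (measure_pmf p) f"
  using assms by (intro measure_pmf.integrable_const_bound[where B = 1]) auto

text \<open>The election will overwrite the stacks, so the success of the replication is saved in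
  \<open>ok\<close> beforehand.\<close>

definition freeze :: "data \<Rightarrow> data" where
  "freeze d = d\<lparr>ok := settled (stk d), smp := [], cnd := None\<rparr>"

definition fresh :: "nat option \<Rightarrow> data" where
  "fresh v = \<lparr>stk = (case v of None \<Rightarrow> [] | Some x \<Rightarrow> [(x, 0)]), acc = 0, gs = [], smp = [],
     cnd = None, prio = 0, leader = False, ok = False\<rparr>"

context lp_sampler
begin

definition pattern :: "(nat \<Rightarrow> nat option) \<Rightarrow> nat \<Rightarrow> nat option" where
  "pattern c u = map_option (\<lambda>_. 0) (c u)"

definition elected :: "(nat \<Rightarrow> data) \<Rightarrow> nat \<Rightarrow> (nat \<Rightarrow> nat option) \<Rightarrow> real" where
  "elected \<sigma> l c = expect (exec n b vote (with_candidates n \<sigma> c)) (win_prob l)"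

text \<open>Recolouring the pattern by the actual values gives back \<open>c\<close>, and neither
  the election nor \<open>win_prob\<close> reacts to it.\<close>

lemma elected_pattern:
  assumes "l < n"
  shows "elected \<sigma> l c = elected \<sigma> l (pattern c)"
proof -
  have "map_option (\<lambda>_. the (c u)) (pattern c u) = c u" for u
    by (cases "c u") (auto simp: pattern_def)
  then have "with_candidates n \<sigma> c = hmap n (recolour (\<lambda>u. the (c u))) (with_candidates n \<sigma> (pattern c))"
    by (auto simp: with_candidates_def hmap_def recolour_def fun_eq_iff)
  then show ?thesis
    unfolding elected_def by (simp only: exec_vote_recolour integral_map_pmf win_prob_recolour[OF assms])
qed

lemma vote_exact:
  assumes c: "\<And>u v. u < n \<Longrightarrow> c u = Some v \<Longrightarrow> v \<le> B"
    and gs: "\<And>u. u < n \<Longrightarrow> \<exists>x\<le>log_nat n. \<exists>y\<le>log_nat n. gs (\<sigma> u) = [x, y]"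
  shows "prob (exec n b (vote @ finale Tb) (with_candidates n \<sigma> c)) (unanimous i) =
    (\<Sum>l<n. if c l = Some i then elected \<sigma> l (pattern c) else 0)"
proof -
  let ?p = "exec n b vote (with_candidates n \<sigma> c)"
  have "prob (exec n b (vote @ finale Tb) (with_candidates n \<sigma> c)) (unanimous i) =
      expect ?p (\<lambda>\<tau>. prob (exec n b (finale Tb) \<tau>) (unanimous i))"
    by (simp add: exec_append prob_bind_pmf)
  also have "\<dots> = expect ?p (\<lambda>\<tau>. \<Sum>l<n. if c l = Some i then win_prob l \<tau> else 0)"
  proof (rule integral_cong_AE)
    show "AE \<tau> in measure_pmf ?p. prob (exec n b (finale Tb) \<tau>) (unanimous i) =
        (\<Sum>l<n. if c l = Some i then win_prob l \<tau> else 0)"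
    proof (simp only: AE_measure_pmf_iff, intro ballI)
      fix \<tau> assume \<tau>: "\<tau> \<in> set_pmf ?p"
      have cnd: "cnd (\<tau> u) = c u" if "u < n" for u
        using vote_sure(1)[OF \<tau> that] that by (simp add: with_candidates_def)
      have "prob (exec n b (finale Tb) \<tau>) (unanimous i) =
          (\<Sum>l<n. if cnd (\<tau> l) = Some i then win_prob l \<tau> else 0)"
      proof (rule finale_exact[OF vote_sure(5)[OF \<tau>]])
        fix u assume u: "u < n"
        show "\<exists>x\<le>log_nat n. \<exists>y\<le>log_nat n. gs (\<tau> u) = [x, y]"
          using gs[OF u] vote_sure(2)[OF \<tau> u] u by (simp add: with_candidates_def)
        assume "leader (\<tau> u)"
        then show "\<exists>v\<le>B. cnd (\<tau> u) = Some v"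
          using vote_sure(4)[OF \<tau> u] cnd[OF u] c[OF u] by auto
      qed
      also have "\<dots> = (\<Sum>l<n. if c l = Some i then win_prob l \<tau> else 0)"
        by (intro sum.cong) (auto simp: cnd)
      finally show "prob (exec n b (finale Tb) \<tau>) (unanimous i) =
          (\<Sum>l<n. if c l = Some i then win_prob l \<tau> else 0)" .
    qed
  qed auto
  also have "\<dots> = (\<Sum>l<n. expect ?p (\<lambda>\<tau>. if c l = Some i then win_prob l \<tau> else 0))"
    by (intro Bochner_Integration.integral_sum integrable_pmf_bounded) (auto simp: win_prob_bounds)
  also have "\<dots> = (\<Sum>l<n. if c l = Some i then elected \<sigma> l (pattern c) else 0)"
  proof (intro sum.cong refl)
    fix l assume "l \<in> {..<n}"
    then show "expect ?p (\<lambda>\<tau>. if c l = Some i then win_prob l \<tau> else 0) =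
        (if c l = Some i then elected \<sigma> l (pattern c) else 0)"
      using elected_pattern[of l \<sigma> c] by (cases "c l = Some i") (simp_all add: elected_def)
  qed
  finally show ?thesis .
qed

text \<open>Splits node \<open>l\<close> off the product measure. What remains sees \<open>l\<close>
  merely as the owner of some candidate and is thus the same for all \<open>i\<close>; this is the
  source of exactness.\<close>

lemma candidate_expectation:
  fixes g :: "(nat \<Rightarrow> nat option) \<Rightarrow> real"
  assumes "finite (set_pmf C)" "l < n"
  shows "expect (Pi_pmf {..<n} None (\<lambda>_. C)) (\<lambda>c. if c l = Some i then g (pattern c) else 0) =
    pmf C (Some i) * expect (Pi_pmf ({..<n} - {l}) None (\<lambda>_. C)) (\<lambda>f. g (pattern (f(l := Some 0))))"
proof -
  let ?A = "{..<n} - {l}"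
  have A: "{..<n} = insert l ?A" using assms(2) by auto
  have fin: "finite (set_pmf (Pi_pmf ?A None (\<lambda>_. C)))"
    using assms(1) by (auto simp: set_Pi_pmf intro!: finite_PiE_dflt)
  have pat: "pattern (f(l := Some i)) = pattern (f(l := Some 0))" for f
    by (auto simp: pattern_def fun_eq_iff)
  have "Pi_pmf {..<n} None (\<lambda>_. C) =
      bind_pmf C (\<lambda>y. map_pmf (\<lambda>f. f(l := y)) (Pi_pmf ?A None (\<lambda>_. C)))"
    by (subst A, subst Pi_pmf_insert') (auto simp: map_pmf_def)
  then have "expect (Pi_pmf {..<n} None (\<lambda>_. C)) (\<lambda>c. if c l = Some i then g (pattern c) else 0) =
     expect C (\<lambda>y. expect (Pi_pmf ?A None (\<lambda>_. C))
       (\<lambda>f. if y = Some i then g (pattern (f(l := y))) else 0))"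
    using assms(1) fin by (simp add: expectation_bind_finite)
  also have "\<dots> = expect C (\<lambda>y. indicator {Some i} y *
     expect (Pi_pmf ?A None (\<lambda>_. C)) (\<lambda>f. g (pattern (f(l := Some 0)))))"
    by (intro Bochner_Integration.integral_cong refl) (auto simp: indicator_def pat)
  also have "\<dots> = pmf C (Some i) * expect (Pi_pmf ?A None (\<lambda>_. C)) (\<lambda>f. g (pattern (f(l := Some 0))))"
    by (simp add: measure_pmf_single)
  finally show ?thesis .
qed

definition draw_pmf :: "(nat \<Rightarrow> data) \<Rightarrow> nat pmf" where
  "draw_pmf \<sigma> = map_pmf (\<lambda>v. trunc b (top_value (stk (\<sigma> v)))) (pmf_of_set {..<n})"

definition ready :: "(nat \<Rightarrow> data) \<Rightarrow> bool" where
  "ready \<sigma> \<longleftrightarrow> (\<forall>u<n. smp (\<sigma> u) = [] \<and> cnd (\<sigma> u) = None) \<and> (\<forall>u. \<not> u < n \<longrightarrow> \<sigma> u = undefined) \<and>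
     (\<forall>u<n. \<exists>x\<le>log_nat n. \<exists>y\<le>log_nat n. gs (\<sigma> u) = [x, y]) \<and> tokens_bounded n B (2 * log_nat n) \<sigma>"

lemma set_draw_pmf:
  assumes "ready \<sigma>" "v \<in> set_pmf (draw_pmf \<sigma>)"
  shows "v \<le> B"
proof -
  obtain u where u: "u < n" "v = trunc b (top_value (stk (\<sigma> u)))"
    using assms(2) n_pos by (auto simp: draw_pmf_def set_pmf_of_set lessThan_empty_iff)
  then have "token_bound B (2 * log_nat n) (stk (\<sigma> u))"
    using assms(1) by (auto simp: ready_def tokens_bounded_def)
  then have "top_value (stk (\<sigma> u)) \<le> B"
    by (cases "stk (\<sigma> u)") (auto simp: top_value_def token_bound_def)
  then show ?thesis using u trunc_le le_trans by blast
qed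

lemma finite_trials: "finite (set_pmf (trials_pmf R p (draw_pmf \<sigma>)))"
proof (rule finite_subset)
  show "set_pmf (trials_pmf R p (draw_pmf \<sigma>)) \<subseteq> insert None (Some ` set_pmf (draw_pmf \<sigma>))"
  proof
    fix x assume "x \<in> set_pmf (trials_pmf R p (draw_pmf \<sigma>))"
    then show "x \<in> insert None (Some ` set_pmf (draw_pmf \<sigma>))"
      using trials_pmf_range[OF _ p_pos] by (cases x) auto
  qed
  show "finite (insert None (Some ` set_pmf (draw_pmf \<sigma>)))"
    using n_pos by (auto simp: draw_pmf_def set_pmf_of_set lessThan_empty_iff)
qed

abbreviation "endgame \<equiv> trials R p @ vote @ finale Tb"

lemma exec_endgame:
  assumes "ready \<sigma>"
  shows "exec n b endgame \<sigma> = bind_pmf (Pi_pmf {..<n} None (\<lambda>_. trials_pmf R p (draw_pmf \<sigma>)))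
    (\<lambda>c. exec n b (vote @ finale Tb) (with_candidates n \<sigma> c))"
  using assms n_pos by (subst exec_append, subst exec_trials) (auto simp: ready_def bind_map_pmf draw_pmf_def)

lemma candidates_le:
  assumes "ready \<sigma>" "c \<in> set_pmf (Pi_pmf {..<n} None (\<lambda>_. trials_pmf R p (draw_pmf \<sigma>)))" "u < n" "c u = Some v"
  shows "v \<le> B"
proof -
  have "c u \<in> set_pmf (trials_pmf R p (draw_pmf \<sigma>))"
    using assms(2,3) by (auto simp: set_Pi_pmf PiE_dflt_def)
  then have "v \<in> set_pmf (draw_pmf \<sigma>)" using assms(4) trials_pmf_range[OF _ p_pos] by auto
  then show ?thesis using set_draw_pmf assms(1) by blast
qed

text \<open>Summing over the possible leaders leaves a factor \<kappa> without \<open>i\<close>. Its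
  second part lets the replicated frequencies be evaluated only on runs where all stacks settled and
  all exponents agree.\<close>

lemma endgame_exact:
  assumes ready: "ready \<sigma>"
  shows "\<exists>\<kappa>. (\<forall>i. prob (exec n b endgame \<sigma>) (unanimous i) =
      \<kappa> * pmf (trials_pmf R p (draw_pmf \<sigma>)) (Some i)) \<and>
    (\<kappa> \<noteq> 0 \<longrightarrow> (\<forall>u<n. ok (\<sigma> u)) \<and> (\<forall>u<n. \<forall>w<n. gs (\<sigma> u) = gs (\<sigma> w)))"
proof -
  let ?C = "trials_pmf R p (draw_pmf \<sigma>)"
  let ?P = "Pi_pmf {..<n} None (\<lambda>_. ?C)"
  define \<kappa> where "\<kappa> = (\<Sum>l<n. expect (Pi_pmf ({..<n} - {l}) None (\<lambda>_. ?C))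
    (\<lambda>f. elected \<sigma> l (pattern (f(l := Some 0)))))"
  have finP: "finite (set_pmf ?P)"
    using finite_trials by (auto simp: set_Pi_pmf intro!: finite_PiE_dflt)
  have "prob (exec n b endgame \<sigma>) (unanimous i) = \<kappa> * pmf ?C (Some i)" for i
  proof -
    have "prob (exec n b endgame \<sigma>) (unanimous i) =
        expect ?P (\<lambda>c. prob (exec n b (vote @ finale Tb) (with_candidates n \<sigma> c)) (unanimous i))"
      by (simp only: exec_endgame[OF ready] prob_bind_pmf)
    also have "\<dots> = expect ?P (\<lambda>c. \<Sum>l<n. if c l = Some i then elected \<sigma> l (pattern c) else 0)"
      using ready candidates_le[OF ready]
      by (intro integral_cong_AE) (auto simp: AE_measure_pmf_iff ready_def intro!: vote_exact)
    also have "\<dots> = (\<Sum>l<n. expect ?P (\<lambda>c. if c l = Some i then elected \<sigma> l (pattern c) else 0))"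
      using finP by (intro Bochner_Integration.integral_sum integrable_measure_pmf_finite)
    also have "\<dots> = (\<Sum>l<n. pmf ?C (Some i) * expect (Pi_pmf ({..<n} - {l}) None (\<lambda>_. ?C))
        (\<lambda>f. elected \<sigma> l (pattern (f(l := Some 0)))))"
      using finite_trials by (intro sum.cong refl candidate_expectation) auto
    finally show ?thesis by (simp add: \<kappa>_def sum_distrib_left mult.commute)
  qed
  moreover have "\<kappa> = 0" if bad: "\<not> ((\<forall>u<n. ok (\<sigma> u)) \<and> (\<forall>u<n. \<forall>w<n. gs (\<sigma> u) = gs (\<sigma> w)))"
  proof -
    have "elected \<sigma> l c = 0" if l: "l < n" for l c
    proof -
      have "win_prob l \<tau> = 0" if \<tau>: "\<tau> \<in> set_pmf (exec n b vote (with_candidates n \<sigma> c))" for \<tau>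
      proof (rule ccontr)
        assume "win_prob l \<tau> \<noteq> 0"
        then have "\<forall>u<n. ok (\<tau> u) \<and> gs (\<tau> u) = gs (\<tau> l)" by (auto simp: win_prob_def split: if_splits)
        moreover have "ok (\<tau> u) = ok (\<sigma> u)" "gs (\<tau> u) = gs (\<sigma> u)" if "u < n" for u
          using vote_sure(2,3)[OF \<tau> that] that by (simp_all add: with_candidates_def)
        ultimately have "\<forall>u<n. ok (\<sigma> u) \<and> gs (\<sigma> u) = gs (\<sigma> l)" using l by metis
        then show False using bad by metis
      qed
      then have "elected \<sigma> l c = expect (exec n b vote (with_candidates n \<sigma> c)) (\<lambda>_. 0)"
        unfolding elected_def by (intro integral_cong_AE) (auto simp: AE_measure_pmf_iff)
      then show ?thesis by simp
    qed
    then show ?thesis by (simp add: \<kappa>_def)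
  qed
  ultimately show ?thesis by (intro exI[of _ \<kappa>]) blast
qed

subsection \<open>The whole program\<close>

abbreviation "phase \<equiv> replicate_phase n Ta Tb Tc"

definition program :: "instr list" where
  "program = phase @ phase @ det freeze # endgame"

lemma exec_program: "exec n b program \<sigma> = bind_pmf (exec n b phase \<sigma>)
    (\<lambda>\<sigma>1. bind_pmf (exec n b phase \<sigma>1) (\<lambda>\<sigma>2. exec n b endgame (conf n freeze \<sigma>2)))"
  unfolding program_def exec_append[of n b phase] exec_det by (rule refl)

lemma phase_locales: "spreading n b B (0 + log_nat n)" "spreading n b B (log_nat n + log_nat n)" "spreading n b B (log_nat n)"
  using n_pos token_fits by (unfold_locales; auto)+

lemma fresh_config:
  assumes "valid_input n N val" "N \<le> B"
  shows "tokens_bounded n B 0 (start_config n fresh val)" "all_settled n (start_config n fresh val)"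
    "total_quota n f (start_config n fresh val) = (\<Sum>u<n. case val u of None \<Rightarrow> 0 | Some v \<Rightarrow> f v)"
    "u < n \<Longrightarrow> gs (start_config n fresh val u) = []"
proof -
  show "all_settled n (start_config n fresh val)"
    by (auto simp: all_settled_def settled_def start_config_def fresh_def split: option.split)
  show "total_quota n f (start_config n fresh val) = (\<Sum>u<n. case val u of None \<Rightarrow> 0 | Some v \<Rightarrow> f v)"
    unfolding total_quota_def
    by (intro sum.cong) (auto simp: start_config_def fresh_def quota_def split: option.split)
  show "tokens_bounded n B 0 (start_config n fresh val)"
    using assms by (force simp: tokens_bounded_def token_bound_def start_config_def fresh_def valid_input_def split: option.split)
qed (simp add: start_config_def fresh_def)

lemma phases_sure:
  assumes "valid_input n N val" "N \<le> B"
    and 1: "\<sigma>1 \<in> set_pmf (exec n b phase (start_config n fresh val))"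
    and 2: "\<sigma>2 \<in> set_pmf (exec n b phase \<sigma>1)"
  shows "ready (conf n freeze \<sigma>2)"
    "\<And>X Y f. (\<And>u. u < n \<Longrightarrow> gs (\<sigma>2 u) = [Y, X]) \<Longrightarrow>
       total_quota n f \<sigma>2 = 2 ^ (X + Y) * (\<Sum>u<n. case val u of None \<Rightarrow> 0 | Some v \<Rightarrow> f v)"
proof -
  let ?\<sigma> = "start_config n fresh val"
  obtain x where x: "\<And>u. u < n \<Longrightarrow> x u \<le> log_nat n"
    "\<And>u. u < n \<Longrightarrow> (\<sigma>1 u)\<lparr>stk := [], acc := 0\<rparr> = (?\<sigma> u)\<lparr>stk := [], acc := 0, gs := x u # gs (?\<sigma> u)\<rparr>"
    "tokens_bounded n B (0 + log_nat n) \<sigma>1"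
    "\<And>f. total_quota n f \<sigma>1 = (\<Sum>u<n. 2 ^ x u * quota f (stk (?\<sigma> u)))"
    using replicate_phase_sure[OF phase_locales(1) 1 fresh_config(1)[OF assms(1,2)]] by auto
  obtain y where y: "\<And>u. u < n \<Longrightarrow> y u \<le> log_nat n"
    "\<And>u. u < n \<Longrightarrow> (\<sigma>2 u)\<lparr>stk := [], acc := 0\<rparr> = (\<sigma>1 u)\<lparr>stk := [], acc := 0, gs := y u # gs (\<sigma>1 u)\<rparr>"
    "tokens_bounded n B (log_nat n + log_nat n) \<sigma>2"
    "\<And>f. total_quota n f \<sigma>2 = (\<Sum>u<n. 2 ^ y u * quota f (stk (\<sigma>1 u)))"
    using replicate_phase_sure[OF phase_locales(2) 2] x(3) by auto
  have gs1: "gs (\<sigma>1 u) = [x u]" if "u < n" for u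
    using arg_cong[OF x(2)[OF that], of gs] fresh_config(4)[OF assms(1,2) that] by simp
  have gs2: "gs (\<sigma>2 u) = [y u, x u]" if "u < n" for u
    using arg_cong[OF y(2)[OF that], of gs] gs1[OF that] by simp
  show "ready (conf n freeze \<sigma>2)"
    unfolding ready_def
  proof (intro conjI allI impI)
    show "tokens_bounded n B (2 * log_nat n) (conf n freeze \<sigma>2)"
      using y(3) by (simp add: tokens_bounded_def freeze_def mult_2)
    fix u assume u: "u < n"
    show "\<exists>x\<le>log_nat n. \<exists>y\<le>log_nat n. gs (conf n freeze \<sigma>2 u) = [x, y]"
      using x(1)[OF u] y(1)[OF u] gs2[OF u] u by (auto simp: freeze_def)
  qed (auto simp: freeze_def conf_def)
  fix X Y f assume gs: "\<And>u. u < n \<Longrightarrow> gs (\<sigma>2 u) = [Y, X]"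
  have xy: "x u = X" "y u = Y" if "u < n" for u using gs[OF that] gs2[OF that] by auto
  have "(\<Sum>u<n. 2 ^ y u * quota f (stk (\<sigma>1 u))) = 2 ^ Y * total_quota n f \<sigma>1"
    unfolding total_quota_def sum_distrib_left by (intro sum.cong) (auto simp: xy)
  moreover have "(\<Sum>u<n. 2 ^ x u * quota f (stk (?\<sigma> u))) = 2 ^ X * total_quota n f ?\<sigma>"
    unfolding total_quota_def sum_distrib_left by (intro sum.cong) (auto simp: xy)
  ultimately have "total_quota n f \<sigma>2 = 2 ^ Y * (2 ^ X * total_quota n f ?\<sigma>)"
    using x(4)[of f] y(4)[of f] by simp
  then show "total_quota n f \<sigma>2 = 2 ^ (X + Y) * (\<Sum>u<n. case val u of None \<Rightarrow> 0 | Some v \<Rightarrow> f v)"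
    by (simp add: fresh_config(3)[OF assms(1,2)] power_add)
qed

lemma pmf_draw:
  assumes "ready \<sigma>" "all_settled n \<sigma>" "i \<noteq> 0"
  shows "pmf (draw_pmf \<sigma>) i = total_quota n (\<lambda>v. of_bool (v = i)) \<sigma> / n"
proof -
  have ne: "{..<n} \<noteq> {}" using n_pos by auto
  have "trunc b (top_value (stk (\<sigma> u))) = i \<longleftrightarrow> stk (\<sigma> u) = [(i, 0)]"
    "quota (\<lambda>v. of_bool (v = i)) (stk (\<sigma> u)) = of_bool (stk (\<sigma> u) = [(i, 0)])" if u: "u < n" for u
  proof -
    have s: "settled (stk (\<sigma> u))" "token_bound B (2 * log_nat n) (stk (\<sigma> u))"
      using assms(1,2) u by (auto simp: all_settled_def ready_def tokens_bounded_def)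
    show "trunc b (top_value (stk (\<sigma> u))) = i \<longleftrightarrow> stk (\<sigma> u) = [(i, 0)]"
    proof (cases "stk (\<sigma> u)")
      case Nil
      then show ?thesis using assms(3) by (auto simp: top_value_def trunc_def)
    next
      case (Cons x xs)
      then obtain v where v: "stk (\<sigma> u) = [(v, 0)]" using s(1) by (auto simp: settled_def)
      then have "trunc b v = v" using s(2) by (intro trunc_id value_fits) (simp add: token_bound_def)
      then show ?thesis using v by (simp add: top_value_def)
    qed
    show "quota (\<lambda>v. of_bool (v = i)) (stk (\<sigma> u)) = of_bool (stk (\<sigma> u) = [(i, 0)])"
      using s(1) by (auto simp: settled_def quota_def)
  qed
  then have "{..<n} \<inter> (\<lambda>v. trunc b (top_value (stk (\<sigma> v)))) -` {i} = {..<n} \<inter> {u. stk (\<sigma> u) = [(i, 0)]}"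
    "total_quota n (\<lambda>v. of_bool (v = i)) \<sigma> = card ({..<n} \<inter> {u. stk (\<sigma> u) = [(i, 0)]})"
    by (auto simp: total_quota_def)
  then show ?thesis
    using ne by (simp add: draw_pmf_def pmf_map measure_pmf_of_set)
qed

lemma freq_eq: "(\<Sum>u<n. case val u of None \<Rightarrow> 0 | Some v \<Rightarrow> of_bool (v = i)) = freq n val i"
proof -
  have "(\<Sum>u<n. case val u of None \<Rightarrow> 0 | Some v \<Rightarrow> of_bool (v = i)) = (\<Sum>u<n. of_bool (val u = Some i))"
    by (intro sum.cong) (auto split: option.split)
  also have "\<dots> = card ({..<n} \<inter> {u. val u = Some i})" by simp
  also have "{..<n} \<inter> {u. val u = Some i} = {v. v < n \<and> val v = Some i}" by auto
  finally show ?thesis by (simp add: freq_def)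
qed

lemma pmf_draw_freq:
  assumes "valid_input n N val" "N \<le> B"
    and 1: "\<sigma>1 \<in> set_pmf (exec n b phase (start_config n fresh val))"
    and 2: "\<sigma>2 \<in> set_pmf (exec n b phase \<sigma>1)"
    and settled: "all_settled n \<sigma>2" and gs: "\<And>u. u < n \<Longrightarrow> gs (\<sigma>2 u) = [Y, X]" and "i \<noteq> 0"
  shows "pmf (draw_pmf (conf n freeze \<sigma>2)) i = 2 ^ (X + Y) * freq n val i / n"
proof -
  have "all_settled n (conf n freeze \<sigma>2)" using settled by (simp add: all_settled_def freeze_def)
  then have "pmf (draw_pmf (conf n freeze \<sigma>2)) i = total_quota n (\<lambda>v. of_bool (v = i)) (conf n freeze \<sigma>2) / n"
    by (intro pmf_draw phases_sure(1)[OF assms(1-4)] \<open>i \<noteq> 0\<close>)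
  also have "total_quota n (\<lambda>v. of_bool (v = i)) (conf n freeze \<sigma>2) = total_quota n (\<lambda>v. of_bool (v = i)) \<sigma>2"
    by (simp add: total_quota_def freeze_def)
  also have "\<dots> = 2 ^ (X + Y) * freq n val i"
    by (subst phases_sure(2)[OF assms(1-4) gs]) (simp_all add: freq_eq)
  finally show ?thesis by simp
qed

lemma freq_0:
  assumes "valid_input n N val"
  shows "freq n val 0 = 0"
  using assms by (force simp: freq_def valid_input_def)

text \<open>For each state after the replications the probability is a multiple of the
  \<open>p\<close>-th power of the frequency. The multiple depends on that state but not on
  \<open>i\<close>, so averaging over the states keeps this form.\<close>

lemma program_exact:
  assumes "valid_input n N val" "N \<le> B"
  shows "\<exists>\<kappa>::real. \<forall>i. prob (exec n b program (start_config n fresh val)) (unanimous i) = \<kappa> * real (freq n val i) ^ p"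
proof -
  let ?\<sigma> = "start_config n fresh val"
  let ?pre = "bind_pmf (exec n b phase ?\<sigma>) (exec n b phase)"
  have "\<exists>\<kappa>::real. \<forall>i. prob (exec n b endgame (conf n freeze \<sigma>2)) (unanimous i) = \<kappa> * real (freq n val i) ^ p"
    if \<sigma>2: "\<sigma>2 \<in> set_pmf ?pre" for \<sigma>2
  proof -
    obtain \<sigma>1 where \<sigma>1: "\<sigma>1 \<in> set_pmf (exec n b phase ?\<sigma>)" and \<sigma>12: "\<sigma>2 \<in> set_pmf (exec n b phase \<sigma>1)"
      using \<sigma>2 by auto
    define \<tau> where "\<tau> = conf n freeze \<sigma>2"
    have ready: "ready \<tau>" unfolding \<tau>_def by (rule phases_sure(1)[OF assms \<sigma>1 \<sigma>12])
    obtain \<kappa> where \<kappa>: "\<And>i. prob (exec n b endgame \<tau>) (unanimous i) =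
        \<kappa> * pmf (trials_pmf R p (draw_pmf \<tau>)) (Some i)"
      "\<kappa> \<noteq> 0 \<Longrightarrow> (\<forall>u<n. ok (\<tau> u)) \<and> (\<forall>u<n. \<forall>w<n. gs (\<tau> u) = gs (\<tau> w))"
      using endgame_exact[OF ready] by blast
    obtain w where w: "\<And>i. pmf (trials_pmf R p (draw_pmf \<tau>)) (Some i) = w * pmf (trial_pmf p (draw_pmf \<tau>)) (Some i)"
      using pmf_trials_Some by blast
    show ?thesis
    proof (cases "\<kappa> = 0")
      case True
      then show ?thesis using \<kappa>(1) by (intro exI[of _ 0]) (simp add: \<tau>_def)
    next
      case False
      then have ok: "\<forall>u<n. ok (\<tau> u)" and eq: "\<forall>u<n. \<forall>w<n. gs (\<tau> u) = gs (\<tau> w)" using \<kappa>(2) by blast+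
      have settled: "all_settled n \<sigma>2" using ok by (simp add: \<tau>_def freeze_def all_settled_def)
      obtain X Y where XY: "gs (\<tau> 0) = [Y, X]" using ready n_pos unfolding ready_def by blast
      have gs: "gs (\<sigma>2 u) = [Y, X]" if "u < n" for u
      proof -
        have "gs (\<tau> u) = [Y, X]" using eq that n_pos XY by metis
        then show ?thesis using that by (simp add: \<tau>_def freeze_def)
      qed
      have "pmf (trial_pmf p (draw_pmf \<tau>)) (Some i) = (2 ^ (X + Y) / n) ^ p * real (freq n val i) ^ p" for i
        using p_pos freq_0[OF assms(1)]
        by (auto simp: pmf_trial pmf_draw_freq[OF assms \<sigma>1 \<sigma>12 settled gs] \<tau>_def power_mult_distrib power_divide)
      then have "prob (exec n b endgame \<tau>) (unanimous i) = (\<kappa> * w * (2 ^ (X + Y) / n) ^ p) * real (freq n val i) ^ p" for i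
        by (simp add: \<kappa>(1) w)
      then show ?thesis unfolding \<tau>_def by blast
    qed
  qed
  then have "\<forall>\<sigma>2\<in>set_pmf ?pre. \<exists>\<kappa>::real. \<forall>i.
      prob (exec n b endgame (conf n freeze \<sigma>2)) (unanimous i) = \<kappa> * real (freq n val i) ^ p" by blast
  from bchoice[OF this] obtain \<kappa> :: "(nat \<Rightarrow> data) \<Rightarrow> real" where \<kappa>: "\<forall>\<sigma>2\<in>set_pmf ?pre. \<forall>i.
      prob (exec n b endgame (conf n freeze \<sigma>2)) (unanimous i) = \<kappa> \<sigma>2 * real (freq n val i) ^ p" ..
  have "prob (exec n b program ?\<sigma>) (unanimous i) = expect ?pre \<kappa> * real (freq n val i) ^ p" for i
  proof -
    have "exec n b program ?\<sigma> = bind_pmf ?pre (\<lambda>\<sigma>2. exec n b endgame (conf n freeze \<sigma>2))"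
      by (simp only: exec_program bind_assoc_pmf)
    then have "prob (exec n b program ?\<sigma>) (unanimous i) =
        expect ?pre (\<lambda>\<sigma>2. prob (exec n b endgame (conf n freeze \<sigma>2)) (unanimous i))"
      by (simp only: prob_bind_pmf)
    also have "\<dots> = expect ?pre (\<lambda>\<sigma>2. \<kappa> \<sigma>2 * real (freq n val i) ^ p)"
    proof (rule integral_cong_AE)
      show "AE \<sigma>2 in measure_pmf ?pre.
          prob (exec n b endgame (conf n freeze \<sigma>2)) (unanimous i) = \<kappa> \<sigma>2 * real (freq n val i) ^ p"
        using \<kappa> unfolding AE_measure_pmf_iff by blast
    qed simp_all
    finally show ?thesis by simp
  qed
  then show ?thesis by blast
qed

end

section \<open>Success with high probability\<close>

lemma potential_replicate:
  "potential (replicate r (v, g)) \<le> r * (5/2) ^ g * ((5/4) ^ Suc g) ^ r"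
proof (induction r)
  case (Suc r)
  define w :: real where "w = (5/4) ^ Suc g"
  define h :: real where "h = (5/2) ^ g"
  have w: "w \<ge> 1" unfolding w_def by (rule one_le_power) simp
  have h: "h \<ge> 0" by (simp add: h_def)
  have "potential (replicate (Suc r) (v, g)) \<le> h + w * potential (replicate r (v, g))"
    by (simp add: w_def h_def)
  also have "\<dots> \<le> h * w ^ Suc r + w * (r * h * w ^ r)"
  proof (intro add_mono mult_left_mono)
    show "potential (replicate r (v, g)) \<le> r * h * w ^ r" using Suc by (simp add: w_def h_def)
    have "h * 1 \<le> h * w ^ Suc r" using w h by (intro mult_left_mono one_le_power)
    then show "h \<le> h * w ^ Suc r" by simp
  qed (use w in simp)
  also have "\<dots> = Suc r * h * w ^ Suc r" by (simp add: algebra_simps)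
  finally show ?case by (simp add: w_def h_def)
qed simp

lemma seeds_facts:
  assumes "32 \<le> n"
  shows "5 * quota (\<lambda>_. 1) (seeds n) \<le> 3 * n" "potential (seeds n) \<le> real n ^ 20"
proof -
  define q where "q = (2::nat) ^ seed_exp n"
  have n0: "0 < n" using assms by simp
  have le: "2 ^ log_nat n \<le> n" by (rule two_power_log_nat[OF n0])
  have "real n / 2 \<le> 2 ^ log_nat n"
    using two_power_nat_floor_log(1)[of "real n"] n0 by (simp add: log_nat_def)
  then have "real n \<le> real (2 * 2 ^ log_nat n)" by simp
  then have ge: "n \<le> 2 * 2 ^ log_nat n" by (simp only: of_nat_le_iff)
  \<comment> \<open>Makes the natural subtraction in \<open>seed_exp\<close> exact.\<close>
  have "4 \<le> log_nat n"
  proof (rule ccontr)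
    assume "\<not> 4 \<le> log_nat n"
    then have "(2::nat) ^ log_nat n \<le> 2 ^ 3" by (intro power_increasing) auto
    then show False using ge assms by simp
  qed
  then have "log_nat n = 4 + seed_exp n" by (simp add: seed_exp_def)
  then have "2 ^ log_nat n = 16 * q" by (simp only: q_def power_add) simp
  then have q: "16 * q \<le> n" "n \<le> 32 * q" using le ge by simp_all
  have q0: "0 < q" by (simp add: q_def)
  have num: "seed_num n = n div (2 * q) + 1" by (simp add: seed_num_def q_def)
  have "2 * (n div (2 * q) * q) \<le> n" using div_times_less_eq_dividend[of n "2 * q"] by (simp add: mult_ac)
  \<comment> \<open>At most n/2 plus one token of size q \<le> n/16, that is 9n/16, which is below
    3n/5.\<close>
  then show "5 * quota (\<lambda>_. 1) (seeds n) \<le> 3 * n"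
    unfolding quota_seeds num q_def[symmetric] using q by (simp add: algebra_simps)
  have "n div (2 * q) \<le> 32 * q div (2 * q)" using q by (intro div_le_mono)
  also have "\<dots> = 16" using q0 by simp
  finally have r: "seed_num n \<le> 17" using num by simp
  have q_real: "real q = 2 ^ seed_exp n" by (simp add: q_def)
  have h: "(5/2 :: real) ^ seed_exp n \<le> real n ^ 2"
  proof -
    have "(5/2 :: real) ^ seed_exp n \<le> 4 ^ seed_exp n" by (intro power_mono) auto
    also have "\<dots> = real q ^ 2" by (simp add: q_real power2_eq_square flip: power_mult_distrib)
    also have "\<dots> \<le> real n ^ 2" using q by (intro power_mono) auto
    finally show ?thesis .
  qed
  have w: "(5/4 :: real) ^ Suc (seed_exp n) \<le> n"
  proof -
    have "(5/4 :: real) ^ Suc (seed_exp n) \<le> 2 ^ Suc (seed_exp n)" by (intro power_mono) auto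
    also have "\<dots> = 2 * real q" by (simp add: q_real)
    also have "\<dots> \<le> n" using q by linarith
    finally show ?thesis .
  qed
  have "potential (seeds n) \<le> seed_num n * (5/2) ^ seed_exp n * ((5/4) ^ Suc (seed_exp n)) ^ seed_num n"
    unfolding seeds_def by (rule potential_replicate)
  also have "\<dots> \<le> n * real n ^ 2 * real n ^ 17"
  proof (intro mult_mono h)
    show "real (seed_num n) \<le> n" using r assms by linarith
    have "((5/4 :: real) ^ Suc (seed_exp n)) ^ seed_num n \<le> real n ^ seed_num n" by (intro power_mono w) auto
    also have "\<dots> \<le> real n ^ 17" using r assms by (intro power_increasing) auto
    finally show "((5/4 :: real) ^ Suc (seed_exp n)) ^ seed_num n \<le> real n ^ 17" .
  qed auto
  also have "\<dots> = real n ^ 20" by (simp flip: power_Suc power_add)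
  finally show "potential (seeds n) \<le> real n ^ 20" .
qed

text \<open>Bernoulli's inequality is the tangent of the \<open>p\<close>-th power at the mean; when
  the tangents are summed, the linear terms cancel.\<close>

lemma power_mean:
  fixes f :: "'a \<Rightarrow> real"
  assumes "finite A" "\<And>i. i \<in> A \<Longrightarrow> f i \<ge> 0" "0 < p"
  shows "(\<Sum>i\<in>A. f i) ^ p \<le> real (card A) ^ (p - 1) * (\<Sum>i\<in>A. f i ^ p)"
proof (cases "(\<Sum>i\<in>A. f i) = 0")
  case True
  have "0 \<le> real (card A) ^ (p - 1) * (\<Sum>i\<in>A. f i ^ p)"
    using assms by (intro mult_nonneg_nonneg sum_nonneg) auto
  then show ?thesis using True assms(3) by (simp add: zero_power)
next
  case False
  define k where "k = real (card A)"
  define a where "a = (\<Sum>i\<in>A. f i) / k"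
  have k: "k > 0" using False assms(1) by (auto simp: k_def card_gt_0_iff)
  have "0 \<le> (\<Sum>i\<in>A. f i)" by (intro sum_nonneg assms(2))
  then have "(\<Sum>i\<in>A. f i) > 0" using False by linarith
  then have a: "a > 0" using k by (simp add: a_def)
  have tangent: "a ^ p + p * a ^ (p - 1) * (f i - a) \<le> f i ^ p" if "i \<in> A" for i
  proof -
    have "1 + real p * (f i / a - 1) \<le> (1 + (f i / a - 1)) ^ p"
      using assms(2)[OF that] a by (intro Bernoulli_inequality) simp
    then have "a ^ p * (1 + real p * (f i / a - 1)) \<le> a ^ p * (f i / a) ^ p"
      using a by (intro mult_left_mono) auto
    moreover have "a ^ p * (f i / a) ^ p = f i ^ p" using a by (simp add: power_divide)
    moreover have "a ^ p * (1 + real p * (f i / a - 1)) = a ^ p + p * a ^ (p - 1) * (f i - a)"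
    proof -
      have "a ^ p = a ^ (p - 1) * a" by (rule power_minus_mult[OF assms(3), symmetric])
      then show ?thesis using a by (simp add: field_simps)
    qed
    ultimately show ?thesis by simp
  qed
  have "k * a ^ p = (\<Sum>i\<in>A. a ^ p + p * a ^ (p - 1) * (f i - a))"
    unfolding sum.distrib sum_distrib_left[symmetric] sum_subtractf using k by (simp add: k_def a_def)
  also have "\<dots> \<le> (\<Sum>i\<in>A. f i ^ p)" by (intro sum_mono tangent)
  finally have "k ^ (p - 1) * (k * a ^ p) \<le> k ^ (p - 1) * (\<Sum>i\<in>A. f i ^ p)"
    using k by (intro mult_left_mono) auto
  moreover have "k ^ (p - 1) * (k * a ^ p) = (\<Sum>i\<in>A. f i) ^ p"
  proof -
    have "k ^ p = k ^ (p - 1) * k" by (rule power_minus_mult[OF assms(3), symmetric])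
    then have "k ^ (p - 1) * (k * a ^ p) = (k * a) ^ p" by (simp add: power_mult_distrib)
    then show ?thesis using k by (simp add: a_def)
  qed
  ultimately show ?thesis by (simp add: k_def)
qed

context lp_sampler
begin

definition failure :: "(nat \<Rightarrow> data) set" where
  "failure = {\<tau>. \<not> (\<exists>i. \<tau> \<in> unanimous i)}"

lemma finale_whp:
  assumes l: "leaders n \<sigma> = {l}" and ok: "\<And>u. u < n \<Longrightarrow> ok (\<sigma> u)" and settled: "all_settled n \<sigma>"
    and gs: "\<And>u. u < n \<Longrightarrow> gs (\<sigma> u) = [y, x]" "x \<le> log_nat n" "y \<le> log_nat n"
    and v: "cnd (\<sigma> l) = Some v" "v \<le> B"
  shows "prob (exec n b (finale Tb) \<sigma>) failure \<le> (3/4) ^ Tb * (real n)\<^sup>2"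
proof -
  define code where "code = announcement (\<sigma> l)"
  have ln: "l < n" "leader (\<sigma> l)" using l by (auto simp: leaders_def)
  have only: "leader (\<sigma> u) \<longleftrightarrow> u = l" if "u < n" for u using l that by (auto simp: leaders_def)
  have code: "code = Suc (prod_encode (v, list_encode [y, x]))"
    using v gs(1)[OF ln(1)] by (simp add: code_def announcement_def)
  let ?\<sigma>a = "conf n (announce announcement) \<sigma>"
  have acc: "acc (?\<sigma>a u) = (if u = l then code else 0)" if "u < n" for u
    using only[OF that] that by (simp add: announce_def code_def)
  have un: "\<tau> \<in> unanimous v"
    if \<tau>: "\<tau> \<in> set_pmf (exec n b (replicate Tb PullMax) ?\<sigma>a)" and all: "\<forall>u<n. acc (\<tau> u) = code" for \<tau>
    unfolding unanimous_def
  proof (intro CollectI allI impI)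
    fix u assume u: "u < n"
    have "ok (\<tau> u)" "gs (\<tau> u) = [y, x]"
      using arg_cong[OF PullMax_frame[OF \<tau> u], of ok] arg_cong[OF PullMax_frame[OF \<tau> u], of gs]
        ok[OF u] gs(1)[OF u] settled u by (simp_all add: announce_def all_settled_def)
    then show "output_value (\<tau> u) = Some v"
      using all u code by (simp add: output_value_def)
  qed
  have "prob (exec n b (finale Tb) \<sigma>) failure \<le>
      prob (exec n b (replicate Tb PullMax) ?\<sigma>a) {\<tau>. \<not> (\<forall>u<n. acc (\<tau> u) = code)}"
    unfolding exec_finale using un
    by (intro measure_pmf.finite_measure_mono_AE) (auto simp: AE_measure_pmf_iff failure_def)
  also have "\<dots> \<le> (3/4) ^ Tb * (real n)\<^sup>2"
    using acc ln code code_fits[OF v(2) gs(3) gs(2)] by (intro PullMax_informs_all) auto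
  finally show ?thesis .
qed

text \<open>Once the ticket of \<open>u\<close> is fixed, that of \<open>w\<close> is still uniform
  on \<open>K\<close> numbers.\<close>

lemma draw_collision:
  assumes "u < n" "w < n" "u \<noteq> w"
  shows "prob (rnd n b (Local (draw K)) \<sigma>) {\<tau>. prio (\<tau> u) = prio (\<tau> w)} \<le> 1 / K"
proof -
  let ?A = "{..<n} - {u}"
  let ?Q = "\<lambda>y. bind_pmf (Pi_pmf ?A undefined (\<lambda>u. draw K (\<sigma> u))) (\<lambda>f. return_pmf (f(u := y)))"
  have A: "{..<n} = insert u ?A" using assms(1) by auto
  have "rnd n b (Local (draw K)) \<sigma> = bind_pmf (draw K (\<sigma> u)) ?Q"
    unfolding rnd_Local by (subst A, subst Pi_pmf_insert') auto
  moreover have "prob (bind_pmf (draw K (\<sigma> u)) ?Q) {\<tau>. prio (\<tau> u) = prio (\<tau> w)} \<le> 0 + 1 / K"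
  proof (rule prob_bind_le[where E = "\<lambda>_. True"])
    fix y
    have "?Q y = map_pmf (\<lambda>f. f(u := y)) (Pi_pmf ?A undefined (\<lambda>u. draw K (\<sigma> u)))"
      by (simp add: map_pmf_def)
    moreover have "(\<lambda>f. f(u := y)) -` {\<tau>. prio (\<tau> u) = prio (\<tau> w)} = (\<lambda>f. f w) -` {d. prio d = prio y}"
      using assms(3) by auto
    ultimately have "prob (?Q y) {\<tau>. prio (\<tau> u) = prio (\<tau> w)} =
        prob (map_pmf (\<lambda>f. f w) (Pi_pmf ?A undefined (\<lambda>u. draw K (\<sigma> u)))) {d. prio d = prio y}"
      by simp
    also have "map_pmf (\<lambda>f. f w) (Pi_pmf ?A undefined (\<lambda>u. draw K (\<sigma> u))) = draw K (\<sigma> w)"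
      using assms by (simp add: Pi_pmf_component)
    also have "prob (draw K (\<sigma> w)) {d. prio d = prio y} = prob (pmf_of_set {1..K}) {prio y}"
      unfolding draw_def by (simp add: vimage_def)
    also have "\<dots> \<le> 1 / K"
      using K(1) by (simp add: measure_pmf_single indicator_def)
    finally show "prob (?Q y) {\<tau>. prio (\<tau> u) = prio (\<tau> w)} \<le> 1 / K" .
  qed auto
  ultimately show ?thesis by simp
qed

lemma draw_distinct:
  "prob (rnd n b (Local (draw K)) \<sigma>) {\<tau>. \<not> inj_on (\<lambda>u. prio (\<tau> u)) {..<n}} \<le> (real n)\<^sup>2 / K"
proof -
  let ?p = "rnd n b (Local (draw K)) \<sigma>"
  let ?I = "{x \<in> {..<n} \<times> {..<n}. fst x \<noteq> snd x}"
  have fin: "finite ?I" by simp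
  have "prob ?p {\<tau>. \<not> inj_on (\<lambda>u. prio (\<tau> u)) {..<n}} \<le>
      prob ?p (\<Union>x\<in>?I. {\<tau>. prio (\<tau> (fst x)) = prio (\<tau> (snd x))})"
    by (intro measure_pmf.finite_measure_mono) (auto simp: inj_on_def)
  also have "\<dots> \<le> (\<Sum>x\<in>?I. prob ?p {\<tau>. prio (\<tau> (fst x)) = prio (\<tau> (snd x))})"
    by (intro measure_pmf.finite_measure_subadditive_finite fin) auto
  also have "\<dots> \<le> (\<Sum>x\<in>?I. 1 / K)" by (intro sum_mono draw_collision) auto
  also have "\<dots> = card ?I * (1 / K)" by simp
  also have "\<dots> \<le> (real n)\<^sup>2 * (1 / K)"
  proof (intro mult_right_mono)
    have "card ?I \<le> card ({..<n} \<times> {..<n})" by (intro card_mono) auto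
    then have "real (card ?I) \<le> real (n * n)" by (simp only: of_nat_le_iff card_cartesian_product card_lessThan)
    then show "real (card ?I) \<le> (real n)\<^sup>2" by (simp add: power2_eq_square)
  qed simp
  finally show ?thesis by simp
qed

definition vote_error :: real where
  "vote_error = (real n)\<^sup>2 / K + ((3/4) ^ Tb * (real n)\<^sup>2 + ((24/25) ^ Tc * real n ^ 20 + (3/4) ^ Tb * (real n)\<^sup>2))"

lemma vote_error_nonneg: "0 \<le> vote_error"
  by (simp add: vote_error_def)

text \<open>Tickets may collide, their maximum may fail to reach everybody, the tokens of the leader
  may not settle, or the announcement may miss a node; these are the summands of
  \<open>vote_error\<close> in this order.\<close>

lemma vote_whp:
  assumes ok: "\<And>u. u < n \<Longrightarrow> ok (\<sigma> u)"
    and gs: "\<And>u. u < n \<Longrightarrow> gs (\<sigma> u) = [y, x]" "x \<le> log_nat n" "y \<le> log_nat n"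
    and ex: "\<exists>u<n. cnd (\<sigma> u) \<noteq> None" and le: "\<And>u v. u < n \<Longrightarrow> cnd (\<sigma> u) = Some v \<Longrightarrow> v \<le> B"
  shows "prob (exec n b (vote @ finale Tb) \<sigma>) failure \<le> vote_error"
  unfolding vote_error_def exec_append exec_vote bind_assoc_pmf
proof (rule prob_bind_le[OF draw_distinct])
  fix \<sigma>1 assume 1: "\<sigma>1 \<in> set_pmf (rnd n b (Local (draw K)) \<sigma>)" and inj: "inj_on (\<lambda>u. prio (\<sigma>1 u)) {..<n}"
  have f1: "cnd (\<sigma>1 u) = cnd (\<sigma> u)" "gs (\<sigma>1 u) = gs (\<sigma> u)" "ok (\<sigma>1 u) = ok (\<sigma> u)"
    "acc (\<sigma>1 u) = (if cnd (\<sigma> u) = None then 0 else prio (\<sigma>1 u))" "1 \<le> prio (\<sigma>1 u)" "prio (\<sigma>1 u) \<le> K" if "u < n" for u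
  proof -
    have "\<sigma>1 u \<in> set_pmf (draw K (\<sigma> u))" using 1 that by (auto simp: rnd_Local set_Pi_pmf PiE_dflt_def)
    then show "cnd (\<sigma>1 u) = cnd (\<sigma> u)" "gs (\<sigma>1 u) = gs (\<sigma> u)" "ok (\<sigma>1 u) = ok (\<sigma> u)"
      "acc (\<sigma>1 u) = (if cnd (\<sigma> u) = None then 0 else prio (\<sigma>1 u))" "1 \<le> prio (\<sigma>1 u)" "prio (\<sigma>1 u) \<le> K"
      using K(1) by (auto simp: draw_def set_pmf_of_set)
  qed
  define m where "m = Max ((\<lambda>u. acc (\<sigma>1 u)) ` {..<n})"
  have m_ge: "acc (\<sigma>1 u) \<le> m" if "u < n" for u using that by (auto simp: m_def intro!: Max_ge)
  have "m \<in> (\<lambda>u. acc (\<sigma>1 u)) ` {..<n}" unfolding m_def using n_pos by (intro Max_in) auto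
  then obtain l where l: "l < n" "acc (\<sigma>1 l) = m" by auto
  obtain u0 where u0: "u0 < n" "cnd (\<sigma> u0) \<noteq> None" using ex by auto
  have "1 \<le> acc (\<sigma>1 u0)" using f1(4,5)[OF u0(1)] u0(2) by simp
  then have m1: "1 \<le> m" using m_ge[OF u0(1)] by simp
  then have lc: "cnd (\<sigma> l) \<noteq> None" "prio (\<sigma>1 l) = m" using f1(4)[OF l(1)] l(2) by (auto split: if_splits)
  then have mK: "m < 2 ^ b" using f1(6)[OF l(1)] K(2) by simp
  show "prob (bind_pmf (exec n b (replicate Tb PullMax) \<sigma>1)
      (\<lambda>\<sigma>2. bind_pmf (exec n b (replicate Tc Spread) (conf n (elect (seeds n)) \<sigma>2)) (exec n b (finale Tb)))) failure
    \<le> (3/4) ^ Tb * (real n)\<^sup>2 + ((24/25) ^ Tc * real n ^ 20 + (3/4) ^ Tb * (real n)\<^sup>2)"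
  proof (rule prob_bind_le[OF PullMax_informs_all[where m = m]])
    show "\<exists>u<n. acc (\<sigma>1 u) = m" using l by auto
    fix \<sigma>2 assume 2: "\<sigma>2 \<in> set_pmf (exec n b (replicate Tb PullMax) \<sigma>1)" and all: "\<forall>u<n. acc (\<sigma>2 u) = m"
    have f2: "cnd (\<sigma>2 u) = cnd (\<sigma> u)" "gs (\<sigma>2 u) = gs (\<sigma> u)" "ok (\<sigma>2 u) = ok (\<sigma> u)" "prio (\<sigma>2 u) = prio (\<sigma>1 u)" if "u < n" for u
      using arg_cong[OF PullMax_frame[OF 2 that], of cnd] arg_cong[OF PullMax_frame[OF 2 that], of gs]
        arg_cong[OF PullMax_frame[OF 2 that], of ok] arg_cong[OF PullMax_frame[OF 2 that], of prio] f1[OF that] by simp_all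
    define \<sigma>3 where "\<sigma>3 = conf n (elect (seeds n)) \<sigma>2"
    have win: "cnd (\<sigma>2 u) \<noteq> None \<and> acc (\<sigma>2 u) = prio (\<sigma>2 u) \<longleftrightarrow> u = l" if u: "u < n" for u
    proof
      assume "cnd (\<sigma>2 u) \<noteq> None \<and> acc (\<sigma>2 u) = prio (\<sigma>2 u)"
      then have "prio (\<sigma>1 u) = prio (\<sigma>1 l)" using all f2[OF u] lc u by simp
      then show "u = l" using inj u l(1) by (auto simp: inj_on_def)
    next
      assume "u = l"
      then show "cnd (\<sigma>2 u) \<noteq> None \<and> acc (\<sigma>2 u) = prio (\<sigma>2 u)" using all f2[OF u] lc u by simp
    qed
    have s3: "stk (\<sigma>3 u) = (if u = l then seeds n else [])" "leader (\<sigma>3 u) \<longleftrightarrow> u = l"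
      "cnd (\<sigma>3 u) = cnd (\<sigma> u)" "gs (\<sigma>3 u) = gs (\<sigma> u)" "ok (\<sigma>3 u) = ok (\<sigma> u)" if u: "u < n" for u
      using win[OF u] f2[OF u] u by (simp_all add: \<sigma>3_def elect_def)
    have tb: "tokens_bounded n B (2 * log_nat n) \<sigma>3"
      using seeds_bounded s3(1) by (auto simp: tokens_bounded_def token_bound_def)
    have "total_quota n (\<lambda>_. 1) \<sigma>3 = (\<Sum>u<n. if u = l then quota (\<lambda>_. 1) (seeds n) else 0)"
      unfolding total_quota_def by (intro sum.cong) (auto simp: s3 quota_def)
    also have "\<dots> = quota (\<lambda>_. 1) (seeds n)" using l(1) by simp
    finally have Q: "5 * total_quota n (\<lambda>_. 1) \<sigma>3 \<le> 3 * n" using seeds_facts(1)[OF n_ge] by simp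
    have "(\<Sum>u<n. potential (stk (\<sigma>3 u))) = (\<Sum>u<n. if u = l then potential (seeds n) else 0)"
      by (intro sum.cong) (auto simp: s3)
    also have "\<dots> = potential (seeds n)" using l(1) by simp
    also have "\<dots> \<le> real n ^ 20" by (rule seeds_facts(2)[OF n_ge])
    finally have pot: "(\<Sum>u<n. potential (stk (\<sigma>3 u))) \<le> real n ^ 20" .
    have "prob (bind_pmf (exec n b (replicate Tc Spread) \<sigma>3) (exec n b (finale Tb))) failure
      \<le> (24/25) ^ Tc * (\<Sum>u<n. potential (stk (\<sigma>3 u))) + (3/4) ^ Tb * (real n)\<^sup>2"
    proof (rule prob_bind_le[OF Spread_settles[OF tb Q]])
      fix \<tau> assume 3: "\<tau> \<in> set_pmf (exec n b (replicate Tc Spread) \<sigma>3)" and settled: "all_settled n \<tau>"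
      have f3: "leader (\<tau> u) \<longleftrightarrow> u = l" "cnd (\<tau> u) = cnd (\<sigma> u)" "gs (\<tau> u) = gs (\<sigma> u)" "ok (\<tau> u) = ok (\<sigma> u)" if u: "u < n" for u
        using arg_cong[OF Spread_frame[OF 3 u], of leader] arg_cong[OF Spread_frame[OF 3 u], of cnd]
          arg_cong[OF Spread_frame[OF 3 u], of gs] arg_cong[OF Spread_frame[OF 3 u], of ok] s3[OF u] by simp_all
      obtain v where v: "cnd (\<sigma> l) = Some v" using lc by auto
      show "prob (exec n b (finale Tb) \<tau>) failure \<le> (3/4) ^ Tb * (real n)\<^sup>2"
      proof (rule finale_whp[where l = l and v = v and x = x and y = y])
        show "leaders n \<tau> = {l}" using f3(1) l(1) by (auto simp: leaders_def)
        show "cnd (\<tau> l) = Some v" "v \<le> B" using f3(2)[OF l(1)] v le[OF l(1)] by auto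
      qed (use f3 ok gs settled in auto)
    qed simp
    also have "\<dots> \<le> (24/25) ^ Tc * real n ^ 20 + (3/4) ^ Tb * (real n)\<^sup>2"
      using pot by (intro add_mono mult_left_mono) auto
    finally show "prob (bind_pmf (exec n b (replicate Tc Spread) (conf n (elect (seeds n)) \<sigma>2)) (exec n b (finale Tb))) failure
      \<le> (24/25) ^ Tc * real n ^ 20 + (3/4) ^ Tb * (real n)\<^sup>2"
      by (simp add: \<sigma>3_def)
  qed (use m_ge mK in auto)
qed simp

lemma endgame_whp:
  assumes ready: "ready \<sigma>" and ok: "\<And>u. u < n \<Longrightarrow> ok (\<sigma> u)"
    and gs: "\<And>u. u < n \<Longrightarrow> gs (\<sigma> u) = [y, x]" "x \<le> log_nat n" "y \<le> log_nat n"
  shows "prob (exec n b endgame \<sigma>) failure \<le> pmf (trial_pmf p (draw_pmf \<sigma>)) None ^ (R * n) + vote_error"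
  unfolding exec_endgame[OF ready]
proof (rule prob_bind_le[where E = "\<lambda>c. \<exists>u<n. c u \<noteq> None"])
  let ?C = "trials_pmf R p (draw_pmf \<sigma>)"
  let ?P = "Pi_pmf {..<n} None (\<lambda>_. ?C)"
  have "prob ?P {c. \<not> (\<exists>u<n. c u \<noteq> None)} \<le> prob ?P {\<lambda>_. None}"
    by (intro measure_pmf.finite_measure_mono_AE)
      (auto simp: AE_measure_pmf_iff set_Pi_pmf PiE_dflt_def fun_eq_iff)
  also have "\<dots> = (\<Prod>u<n. pmf ?C None)" by (simp add: measure_pmf_single pmf_Pi')
  also have "\<dots> = pmf (trial_pmf p (draw_pmf \<sigma>)) None ^ (R * n)"
    by (simp add: pmf_trials_None power_mult)
  finally show "prob ?P {c. \<not> (\<exists>u<n. c u \<noteq> None)} \<le> pmf (trial_pmf p (draw_pmf \<sigma>)) None ^ (R * n)" .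
  fix c assume c: "c \<in> set_pmf ?P" "\<exists>u<n. c u \<noteq> None"
  show "prob (exec n b (vote @ finale Tb) (with_candidates n \<sigma> c)) failure \<le> vote_error"
    using ok gs c(2) candidates_le[OF ready c(1)]
    by (intro vote_whp[where x = x and y = y]) (auto simp: with_candidates_def)
qed (rule vote_error_nonneg)

text \<open>Used twice: one token is c = 1 / \<open>sqrt n\<close> times \<open>sqrt n\<close>, so
  the first replication reaches \<open>sqrt n\<close>/64 tokens; then c = 1/64 shows that the second
  one reaches n/4096.\<close>

lemma replication_gain:
  assumes "c * sqrt n \<le> M" "0 \<le> c" "c \<le> 1"
  shows "c * n / 64 \<le> M * n / (64 * max M (sqrt n))"
proof (cases "M \<ge> sqrt n")
  case True
  have "sqrt n > 0" using n_pos by simp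
  then have "M > 0" using True by linarith
  then have "M * n / (64 * max M (sqrt n)) = n / 64" using True by (simp add: max_def)
  then show ?thesis using mult_right_mono[OF assms(3), of n] by simp
next
  case False
  have sq: "real n = sqrt n * sqrt n" by simp
  have "c * n / 64 = (c * sqrt n) * sqrt n / 64" by (subst sq) simp
  also have "\<dots> \<le> M * sqrt n / 64" using assms(1) by (intro divide_right_mono mult_right_mono) auto
  also have "\<dots> = M * n / (64 * max M (sqrt n))" using False n_pos by (simp add: max_def field_simps)
  finally show ?thesis .
qed

lemma sum_freq:
  assumes "valid_input n N val"
  shows "(\<Sum>u<n. case val u of None \<Rightarrow> 0 | Some v \<Rightarrow> 1) = (\<Sum>i = 1..N. freq n val i)"
proof -
  have "(\<Sum>i = 1..N. freq n val i) = (\<Sum>u<n. \<Sum>i = 1..N. case val u of None \<Rightarrow> 0 | Some v \<Rightarrow> of_bool (v = i))"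
    unfolding freq_eq[symmetric] by (rule sum.swap)
  also have "\<dots> = (\<Sum>u<n. case val u of None \<Rightarrow> 0 | Some v \<Rightarrow> 1)"
  proof (intro sum.cong refl)
    fix u assume "u \<in> {..<n}"
    then have "val u = None \<or> (\<exists>v\<in>{1..N}. val u = Some v)"
      using assms by (auto simp: valid_input_def)
    then show "(\<Sum>i = 1..N. case val u of None \<Rightarrow> 0 | Some v \<Rightarrow> of_bool (v = i)) =
        (case val u of None \<Rightarrow> 0 | Some v \<Rightarrow> (1::nat))"
      by (auto simp: of_bool_def)
  qed
  finally show ?thesis by simp
qed

text \<open>The success probability of a trial is the sum of (k f_i / n)^p, which by the power mean
  inequality is at least (k m / n)^p / D^(p-1). The \<open>R * n\<close> independent trials
  contribute the exponent.\<close>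

lemma trial_failure:
  fixes val N
  defines "m \<equiv> \<Sum>u<n. case val u of None \<Rightarrow> 0 | Some v \<Rightarrow> (1::nat)" and "D \<equiv> distinct_values n N val"
  assumes valid: "valid_input n N val" and m: "1 \<le> m"
    and draw: "\<And>i. i \<noteq> 0 \<Longrightarrow> pmf S i = k * freq n val i / n"
    and k: "n / 4096 \<le> k * m" "0 \<le> k"
  shows "pmf (trial_pmf p S) None ^ (R * n) \<le> exp (- (R * n / (4096 ^ p * real D ^ (p - 1))))"
proof -
  define A where "A = {i \<in> {1..N}. freq n val i > 0}"
  define s where "s = (\<Sum>i = 1..N. pmf (trial_pmf p S) (Some i))"
  define s0 where "s0 = 1 / (4096 ^ p * real D ^ (p - 1))"
  have cardA: "card A = D" by (simp add: A_def D_def distinct_values_def)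
  have finA: "finite A" by (simp add: A_def)
  have "real m = (\<Sum>i = 1..N. real (freq n val i))" by (simp add: m_def sum_freq[OF valid])
  also have "\<dots> = (\<Sum>i\<in>A. real (freq n val i))"
    by (intro sum.mono_neutral_right) (auto simp: A_def)
  finally have mA: "real m = (\<Sum>i\<in>A. real (freq n val i))" .
  then have "A \<noteq> {}" using m by auto
  then have D1: "1 \<le> D" using cardA finA by (simp add: Suc_le_eq card_gt_0_iff flip: cardA)
  have "real m ^ p \<le> real D ^ (p - 1) * (\<Sum>i\<in>A. real (freq n val i) ^ p)"
    unfolding mA cardA[symmetric] by (intro power_mean finA p_pos) simp
  also have "(\<Sum>i\<in>A. real (freq n val i) ^ p) = (\<Sum>i = 1..N. real (freq n val i) ^ p)"
    using p_pos by (intro sum.mono_neutral_left) (auto simp: A_def zero_power)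
  finally have pm: "real m ^ p / real D ^ (p - 1) \<le> (\<Sum>i = 1..N. real (freq n val i) ^ p)"
    using D1 by (simp add: field_simps)
  have "(1 / 4096) ^ p \<le> (k * m / n) ^ p"
    using k(1) n_pos by (intro power_mono) (auto simp: field_simps)
  then have "s0 \<le> (k * m / n) ^ p / real D ^ (p - 1)"
    unfolding s0_def using D1 by (simp add: power_one_over field_simps)
  also have "\<dots> = (k / n) ^ p * (real m ^ p / real D ^ (p - 1))"
    by (simp add: power_mult_distrib power_divide)
  also have "\<dots> \<le> (k / n) ^ p * (\<Sum>i = 1..N. real (freq n val i) ^ p)"
    using k(2) by (intro mult_left_mono pm) auto
  also have "\<dots> = s"
    unfolding s_def sum_distrib_left
    by (intro sum.cong) (auto simp: pmf_trial[OF p_pos] draw power_mult_distrib power_divide)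
  finally have s: "s0 \<le> s" .
  have "pmf (trial_pmf p S) None + s = (\<Sum>x\<in>insert None (Some ` {1..N}). pmf (trial_pmf p S) x)"
    unfolding s_def by (subst sum.insert) (auto simp: sum.reindex)
  also have "\<dots> = prob (trial_pmf p S) (insert None (Some ` {1..N}))"
    by (intro measure_measure_pmf_finite[symmetric]) auto
  also have "\<dots> \<le> 1" by simp
  finally have "pmf (trial_pmf p S) None \<le> 1 + (- s0)" using s by linarith
  also have "\<dots> \<le> exp (- s0)" by (rule exp_ge_add_one_self)
  finally have "pmf (trial_pmf p S) None ^ (R * n) \<le> exp (- s0) ^ (R * n)" by (intro power_mono) auto
  also have "\<dots> = exp (- (R * n / (4096 ^ p * real D ^ (p - 1))))"
    by (simp add: s0_def flip: exp_of_nat_mult)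
  finally show ?thesis .
qed

lemma phase_error_nonneg: "0 \<le> phase_error n Ta Tb Tc"
  by (simp add: phase_error_def)

lemma program_whp:
  fixes val N
  defines "D \<equiv> distinct_values n N val"
  assumes valid: "valid_input n N val" and N: "N \<le> B" and ex: "\<exists>u<n. val u \<noteq> None"
  shows "prob (exec n b program (start_config n fresh val)) failure \<le>
    phase_error n Ta Tb Tc + (phase_error n Ta Tb Tc +
      (exp (- (R * n / (4096 ^ p * real D ^ (p - 1)))) + vote_error))"
  unfolding exec_program
proof (rule prob_bind_le)
  let ?\<sigma> = "start_config n fresh val"
  define m where "m = (\<Sum>u<n. case val u of None \<Rightarrow> 0 | Some v \<Rightarrow> (1::nat))"
  have L: "log_nat n < 2 ^ b" using token_fits[of 0 "log_nat n"] le_prod_encode_2[of "log_nat n" 0] by simp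
  have m0: "m = total_quota n (\<lambda>_. 1) ?\<sigma>" unfolding m_def by (rule fresh_config(3)[OF valid N, symmetric])
  obtain u0 where u0: "u0 < n" "val u0 \<noteq> None" using ex by auto
  have "(case val u0 of None \<Rightarrow> 0 | Some v \<Rightarrow> (1::nat)) \<le> m"
    unfolding m_def using u0 by (intro member_le_sum) auto
  then have m1: "1 \<le> m" using u0 by (auto split: option.splits)
  show "prob (exec n b phase ?\<sigma>) {\<sigma>'. \<not> (all_settled n \<sigma>' \<and> (\<exists>G. (\<forall>u<n. gs (\<sigma>' u) = G # gs (?\<sigma> u)) \<and>
        real m * 2 ^ G \<ge> real m * n / (64 * max m (sqrt n))))} \<le> phase_error n Ta Tb Tc"
    by (rule replicate_phase_whp[OF phase_locales(3) Ta L fresh_config(2)[OF valid N] fresh_config(1)[OF valid N] m0 m1])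
  fix \<sigma>1 assume 1: "\<sigma>1 \<in> set_pmf (exec n b phase ?\<sigma>)"
    and E1: "all_settled n \<sigma>1 \<and> (\<exists>G. (\<forall>u<n. gs (\<sigma>1 u) = G # gs (?\<sigma> u)) \<and>
        real m * 2 ^ G \<ge> real m * n / (64 * max m (sqrt n)))"
  then obtain G1 where G1: "\<And>u. u < n \<Longrightarrow> gs (\<sigma>1 u) = [G1]" "real m * n / (64 * max m (sqrt n)) \<le> real m * 2 ^ G1"
    using fresh_config(4)[OF valid N] by auto
  obtain x where x:
    "\<And>u. u < n \<Longrightarrow> (\<sigma>1 u)\<lparr>stk := [], acc := 0\<rparr> = (?\<sigma> u)\<lparr>stk := [], acc := 0, gs := x u # gs (?\<sigma> u)\<rparr>"
    "tokens_bounded n B (0 + log_nat n) \<sigma>1"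
    "\<And>f. total_quota n f \<sigma>1 = (\<Sum>u<n. 2 ^ x u * quota f (stk (?\<sigma> u)))"
    using replicate_phase_sure[OF phase_locales(1) 1 fresh_config(1)[OF valid N]] by auto
  have xG: "x u = G1" if "u < n" for u
    using arg_cong[OF x(1)[OF that], of gs] G1(1)[OF that] by simp
  define M1 where "M1 = total_quota n (\<lambda>_. 1) \<sigma>1"
  have "M1 = (\<Sum>u<n. 2 ^ x u * quota (\<lambda>_. 1) (stk (?\<sigma> u)))" unfolding M1_def by (rule x(3))
  also have "\<dots> = 2 ^ G1 * m" unfolding m0 total_quota_def sum_distrib_left by (intro sum.cong) (auto simp: xG)
  finally have M1: "M1 = 2 ^ G1 * m" .
  have M1_ge: "1 \<le> M1" using M1 m1 by simp
  have settled1: "all_settled n \<sigma>1" using E1 by simp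
  \<comment> \<open>Settled tokens have exponent 0 again, so the second replication starts under the
    same conditions as the first.\<close>
  have tb1: "tokens_bounded n B 0 \<sigma>1"
    unfolding tokens_bounded_def
  proof (intro allI impI)
    fix u assume "u < n"
    then have "settled (stk (\<sigma>1 u))" "token_bound B (log_nat n) (stk (\<sigma>1 u))"
      using settled1 x(2) by (auto simp: all_settled_def tokens_bounded_def)
    then show "token_bound B 0 (stk (\<sigma>1 u))" by (auto simp: settled_def token_bound_def)
  qed
  have "1 / sqrt n * n / 64 \<le> real m * n / (64 * max m (sqrt n))"
    using n_pos m1 by (intro replication_gain) auto
  then have "1 / sqrt n * n / 64 \<le> M1" using G1(2) M1 by (simp add: mult.commute)
  moreover have "1 / sqrt n * n = sqrt n" using n_pos by (simp add: real_div_sqrt)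
  ultimately have M1_sqrt: "1 / 64 * sqrt n \<le> M1" by simp
  show "prob (bind_pmf (exec n b phase \<sigma>1) (\<lambda>\<sigma>2. exec n b endgame (conf n freeze \<sigma>2))) failure
    \<le> phase_error n Ta Tb Tc + (exp (- (R * n / (4096 ^ p * real D ^ (p - 1)))) + vote_error)"
  proof (rule prob_bind_le)
    show "prob (exec n b phase \<sigma>1) {\<sigma>'. \<not> (all_settled n \<sigma>' \<and> (\<exists>G. (\<forall>u<n. gs (\<sigma>' u) = G # gs (\<sigma>1 u)) \<and>
        real M1 * 2 ^ G \<ge> real M1 * n / (64 * max M1 (sqrt n))))} \<le> phase_error n Ta Tb Tc"
      by (rule replicate_phase_whp[OF phase_locales(3) Ta L settled1 tb1 M1_def M1_ge])
    fix \<sigma>2 assume 2: "\<sigma>2 \<in> set_pmf (exec n b phase \<sigma>1)"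
      and E2: "all_settled n \<sigma>2 \<and> (\<exists>G. (\<forall>u<n. gs (\<sigma>2 u) = G # gs (\<sigma>1 u)) \<and>
        real M1 * 2 ^ G \<ge> real M1 * n / (64 * max M1 (sqrt n)))"
    then obtain G2 where G2: "\<And>u. u < n \<Longrightarrow> gs (\<sigma>2 u) = [G2, G1]"
      "real M1 * n / (64 * max M1 (sqrt n)) \<le> real M1 * 2 ^ G2"
      using G1(1) by auto
    define \<tau> where "\<tau> = conf n freeze \<sigma>2"
    have ready: "ready \<tau>" unfolding \<tau>_def by (rule phases_sure(1)[OF valid N 1 2])
    have gs: "gs (\<tau> u) = [G2, G1]" "ok (\<tau> u)" if "u < n" for u
      using that G2(1)[OF that] E2 by (simp_all add: \<tau>_def freeze_def all_settled_def)
    have "\<exists>x\<le>log_nat n. \<exists>y\<le>log_nat n. gs (\<tau> 0) = [x, y]" using ready n_pos unfolding ready_def by blast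
    then have G_le: "G1 \<le> log_nat n" "G2 \<le> log_nat n" using gs(1)[OF n_pos] by auto
    have "1 / 64 * n / 64 \<le> real M1 * n / (64 * max M1 (sqrt n))"
      using M1_sqrt by (intro replication_gain) auto
    then have "1 / 64 * n / 64 \<le> real M1 * 2 ^ G2" using G2(2) by linarith
    moreover have "real M1 * 2 ^ G2 = 2 ^ (G1 + G2) * real m" using M1 by (simp add: power_add)
    ultimately have k: "n / 4096 \<le> 2 ^ (G1 + G2) * real m" by simp
    have "prob (exec n b endgame \<tau>) failure \<le> pmf (trial_pmf p (draw_pmf \<tau>)) None ^ (R * n) + vote_error"
      using gs G_le by (intro endgame_whp[where x = G1 and y = G2] ready) auto
    also have "pmf (trial_pmf p (draw_pmf \<tau>)) None ^ (R * n) \<le> exp (- (R * n / (4096 ^ p * real D ^ (p - 1))))"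
      unfolding D_def
    proof (rule trial_failure[where k = "2 ^ (G1 + G2)"])
      fix i :: nat assume "i \<noteq> 0"
      then show "pmf (draw_pmf \<tau>) i = 2 ^ (G1 + G2) * freq n val i / n"
        unfolding \<tau>_def using E2 G2(1) pmf_draw_freq[OF valid N 1 2, of G2 G1 i] by simp
    qed (use valid m1 k in \<open>auto simp: m_def\<close>)
    finally show "prob (exec n b endgame (conf n freeze \<sigma>2)) failure \<le>
        exp (- (R * n / (4096 ^ p * real D ^ (p - 1)))) + vote_error" by (simp add: \<tau>_def)
  qed (simp add: vote_error_nonneg)
qed (simp add: vote_error_nonneg phase_error_nonneg)

end

section \<open>Asymptotics\<close>

lemma prod_encode_le: "prod_encode (x, y) \<le> (x + y + 1)\<^sup>2"
proof -
  have "2 * triangle (x + y) \<le> (x + y) * Suc (x + y)" by (simp add: triangle_def)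
  then have "triangle (x + y) \<le> (x + y) * Suc (x + y)" by linarith
  then have "prod_encode (x, y) \<le> (x + y) * Suc (x + y) + x" by (simp add: prod_encode_def)
  also have "\<dots> \<le> (x + y + 1)\<^sup>2" by (simp add: power2_eq_square)
  finally show ?thesis .
qed

lemma log_nat_le: "0 < n \<Longrightarrow> log_nat n \<le> n"
  using two_power_log_nat[of n] less_exp[of "log_nat n"] by linarith

text \<open>Pairing is at most quadratic: both exponents together are coded within
  \<open>n ^ 8 + 1\<close>, and pairing with a value up to \<open>n ^ (a + 1)\<close> stays within
  the square of \<open>n ^ (a + 10)\<close>. As n \<ge> 4, one more power of \<open>n\<close>
  absorbs constant factors.\<close>

lemma codes_fit:
  fixes n a :: nat
  assumes n: "4 \<le> n" and N: "N \<le> n ^ (a + 1)" and b: "n ^ (2 * a + 20) < 2 ^ b div 2"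
  shows "v \<le> N \<Longrightarrow> g \<le> 2 * log_nat n \<Longrightarrow> prod_encode (v, g) < 2 ^ b"
    "v \<le> N \<Longrightarrow> x \<le> log_nat n \<Longrightarrow> y \<le> log_nat n \<Longrightarrow> Suc (prod_encode (v, list_encode [x, y])) < 2 ^ b"
proof -
  have log: "log_nat n \<le> n" using n by (intro log_nat_le) simp
  have mono: "n ^ j \<le> n ^ k" if "j \<le> k" for j k using n that by (intro power_increasing) auto
  have pw: "4 * n ^ j \<le> n ^ k" if "j < k" for j k
  proof -
    have "4 * n ^ j \<le> n ^ Suc j" using n by simp
    also have "\<dots> \<le> n ^ k" using that by (intro mono) simp
    finally show ?thesis .
  qed
  have key: "Suc (prod_encode (v, z)) < 2 ^ b" if "v \<le> N" "z \<le> n ^ 8 + 1" for v z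
  proof -
    have "v + z + 1 \<le> n ^ (a + 9) + n ^ (a + 9) + 2 * n ^ (a + 9)"
      using that N mono[of "a + 1" "a + 9"] mono[of 8 "a + 9"] mono[of 0 "a + 9"] by simp
    also have "\<dots> \<le> n ^ (a + 10)" using pw[of "a + 9" "a + 10"] by simp
    finally have "(v + z + 1)\<^sup>2 \<le> (n ^ (a + 10))\<^sup>2" by (intro power_mono) auto
    also have "\<dots> = n ^ (2 * a + 20)" by (simp add: algebra_simps flip: power_mult)
    finally have "prod_encode (v, z) \<le> n ^ (2 * a + 20)" using prod_encode_le[of v z] by linarith
    then show ?thesis using b mono[of 0 "2 * a + 20"] by linarith
  qed
  show "prod_encode (v, g) < 2 ^ b" if "v \<le> N" "g \<le> 2 * log_nat n"
  proof -
    have "g \<le> 4 * n ^ 1" using that log by simp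
    then have "g \<le> n ^ 8 + 1" using pw[of 1 8] by simp
    then show ?thesis using key[OF that(1)] by (simp add: Suc_lessD)
  qed
  show "Suc (prod_encode (v, list_encode [x, y])) < 2 ^ b" if "v \<le> N" "x \<le> log_nat n" "y \<le> log_nat n"
  proof (rule key[OF that(1)])
    have xy: "x \<le> n" "y \<le> n" using that log by auto
    have "prod_encode (y, 0) \<le> (y + 0 + 1)\<^sup>2" by (rule prod_encode_le)
    also have "\<dots> \<le> (2 * n)\<^sup>2" using xy n by (intro power_mono) auto
    also have "\<dots> \<le> n ^ 3" using pw[of 2 3] by (simp add: power_mult_distrib)
    finally have y: "prod_encode (y, 0) \<le> n ^ 3" .
    have "prod_encode (x, Suc (prod_encode (y, 0))) \<le> (x + Suc (prod_encode (y, 0)) + 1)\<^sup>2" by (rule prod_encode_le)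
    also have "\<dots> \<le> (n ^ 4)\<^sup>2"
    proof (intro power_mono)
      have "x + Suc (prod_encode (y, 0)) + 1 \<le> n + n ^ 3 + 2" using xy y by simp
      also have "\<dots> \<le> n ^ 3 + n ^ 3 + 2 * n ^ 3" using mono[of 1 3] mono[of 0 3] by simp
      also have "\<dots> \<le> n ^ 4" using pw[of 3 4] by simp
      finally show "x + Suc (prod_encode (y, 0)) + 1 \<le> n ^ 4" .
    qed simp
    also have "\<dots> = n ^ 8" by (simp flip: power_mult)
    finally show "list_encode [x, y] \<le> n ^ 8 + 1" by simp
  qed
qed

definition log_time :: "real \<Rightarrow> nat \<Rightarrow> nat" where
  "log_time \<kappa> n = nat \<lceil>\<kappa> * ln n\<rceil>"

lemma log_time_bounds:
  assumes "\<kappa> \<ge> 0" "n \<ge> 1"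
  shows "\<kappa> * ln n \<le> log_time \<kappa> n" "log_time \<kappa> n \<le> \<kappa> * ln n + 1"
proof -
  have "0 \<le> \<kappa> * ln n" using assms by simp
  then show "\<kappa> * ln n \<le> log_time \<kappa> n" "log_time \<kappa> n \<le> \<kappa> * ln n + 1"
    unfolding log_time_def by linarith+
qed

lemma log_time_bigo:
  assumes "\<kappa> \<ge> 0"
  shows "(\<lambda>n. real (log_time \<kappa> n)) \<in> O(\<lambda>n. ln (real n))"
proof (rule bigoI[where c = "\<kappa> + 1"])
  have "eventually (\<lambda>n. 3 \<le> n) sequentially" by (rule eventually_ge_at_top)
  then show "\<forall>\<^sub>F n in sequentially. norm (real (log_time \<kappa> n)) \<le> (\<kappa> + 1) * norm (ln (real n))"
  proof eventually_elim
    case (elim n)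
    have "exp 1 \<le> real n" using exp_le elim by linarith
    then have "1 \<le> ln (real n)" using elim by (subst ln_ge_iff) auto
    then show ?case using log_time_bounds(2)[OF assms, of n] elim by (simp add: algebra_simps)
  qed
qed

lemma log_nat_bigo: "(\<lambda>n. real (log_nat n)) \<in> O(\<lambda>n. ln (real n))"
proof (rule bigoI[where c = 2])
  have "eventually (\<lambda>n. 1 \<le> n) sequentially" by (rule eventually_ge_at_top)
  then show "\<forall>\<^sub>F n in sequentially. norm (real (log_nat n)) \<le> 2 * norm (ln (real n))"
  proof eventually_elim
    case (elim n)
    have "0 \<le> ln (real n)" using elim by simp
    have "real (log_nat n) \<le> log 2 n" using elim by (simp add: log_nat_def)
    also have "\<dots> = ln n / ln 2" by (simp add: log_def)
    also have "\<dots> \<le> ln n / (1/2)"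
      using \<open>0 \<le> ln (real n)\<close> ln2_ge_two_thirds by (intro divide_left_mono) auto
    finally show ?case using \<open>0 \<le> ln (real n)\<close> by simp
  qed
qed

text \<open>The 25 comes from 24/25 \<le> exp(-1/25).\<close>

lemma power_time:
  assumes "\<kappa> \<ge> 0" "n \<ge> 1"
  shows "(24/25) ^ log_time (25 * \<kappa>) n \<le> real n powr - \<kappa>"
proof -
  let ?T = "log_time (25 * \<kappa>) n"
  have "(24/25 :: real) = 1 + (- 1/25)" by simp
  also have "\<dots> \<le> exp (- 1/25)" by (rule exp_ge_add_one_self)
  finally have "(24/25) ^ ?T \<le> exp (- 1/25 :: real) ^ ?T" by (intro power_mono) auto
  also have "\<dots> = exp (- ?T / 25)" by (simp flip: exp_of_nat_mult)
  also have "\<dots> \<le> exp (- \<kappa> * ln n)" using log_time_bounds(1)[of "25 * \<kappa>" n] assms by simp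
  also have "\<dots> = real n powr - \<kappa>" using assms by (simp add: powr_def)
  finally show ?thesis .
qed

lemma length_replicate_phase: "length (replicate_phase n Ta Tb Tc) = Ta + Tb + Tc + 3"
  by (simp add: replicate_phase_def)

lemma length_trials: "length (trials R p) = R * (p + 1)"
  by (induction R) (simp_all add: trial_def)

lemma (in lp_sampler) length_program: "length program = 2 * Ta + 4 * Tb + 3 * Tc + R * (p + 1) + 10"
  by (simp add: program_def length_replicate_phase length_trials election_def finale_def)

text \<open>With \<open>s\<close> = n^(-(c+1)), each replication costs at most (16 + 2 + 1 + 1) s,
  and the five remaining terms cost s each, 45 s in all, which n \<ge> 45 absorbs. The exponent c +
  25 pays for the factor n^20.\<close>

lemma total_error:
  fixes n :: nat and c q :: real
  assumes c: "c > 0" and n: "45 \<le> n" and T: "(24/25) ^ T \<le> real n powr - (c + 25)"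
    and e: "exp (- sqrt n / (256 * real T)) \<le> real n powr - (c + 1)"
    and q: "q \<le> real n powr - (c + 1)" and K: "(real n)\<^sup>2 / K \<le> real n powr - (c + 1)"
  shows "phase_error n T T T + (phase_error n T T T + (q + ((real n)\<^sup>2 / K +
    ((3/4) ^ T * (real n)\<^sup>2 + ((24/25) ^ T * real n ^ 20 + (3/4) ^ T * (real n)\<^sup>2))))) \<le> real n powr - c"
proof -
  define s where "s = real n powr - (c + 1)"
  have n1: "1 \<le> real n" using n by simp
  have summand: "x ^ T * real n ^ k \<le> s" if "0 \<le> x" "x \<le> 24/25" "k \<le> 20" for x k
  proof -
    have "x ^ T * real n ^ k \<le> (24/25) ^ T * real n ^ 20"
      using that n1 by (intro mult_mono power_mono power_increasing) auto
    also have "\<dots> \<le> real n powr - (c + 25) * real n ^ 20" using T by (intro mult_right_mono) auto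
    also have "real n ^ 20 = real n powr 20" using n1 by (simp add: powr_numeral)
    also have "real n powr - (c + 25) * real n powr 20 = real n powr (- (c + 25) + 20)" by (rule powr_add[symmetric])
    also have "\<dots> \<le> s" unfolding s_def using n1 by (intro powr_mono) auto
    finally show ?thesis .
  qed
  have a: "16 * real n ^ 3 / 2 ^ T \<le> 16 * s"
    using summand[of "1/2" 3] by (simp add: power_one_over field_simps)
  have b: "(3/4) ^ T * (real n)\<^sup>2 \<le> s" using summand[of "3/4" 2] by simp
  have d: "(24/25) ^ T * real n ^ 3 \<le> s" "(24/25) ^ T * real n ^ 20 \<le> s"
    using summand[of "24/25" 3] summand[of "24/25" 20] by simp_all
  have ph: "phase_error n T T T \<le> 20 * s"
    using a b d e unfolding phase_error_def s_def by linarith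
  have "phase_error n T T T + (phase_error n T T T + (q + ((real n)\<^sup>2 / K +
    ((3/4) ^ T * (real n)\<^sup>2 + ((24/25) ^ T * real n ^ 20 + (3/4) ^ T * (real n)\<^sup>2))))) \<le> 45 * s"
    using ph b d q K unfolding s_def by linarith
  also have "\<dots> \<le> real n * s" using n by (intro mult_right_mono) (auto simp: s_def)
  also have "\<dots> = real n powr 1 * real n powr - (c + 1)" using n1 by (simp add: s_def)
  also have "\<dots> = real n powr - c" by (subst powr_add[symmetric]) simp
  finally show ?thesis .
qed

text \<open>Values outside \<open>1..N\<close> have frequency 0 and are never agreed upon, so
  summing over \<open>1..N\<close> identifies the probability of success as \<kappa> times the
  moment. It is positive since \<epsilon> < 1, and \<kappa> cancels.\<close>

lemma (in lp_sampler) program_obtains_sample: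
  fixes val N
  defines "A \<equiv> program_alg b program fresh output_value"
  assumes valid: "valid_input n N val" and N: "N \<le> B"
    and whp: "prob (exec n b program (start_config n fresh val)) failure \<le> \<epsilon>" and eps: "\<epsilon> < 1"
  shows "obtains_lp_sample p n N A val (length program) \<epsilon>"
proof -
  let ?q = "exec n b program (start_config n fresh val)"
  let ?g = "gossip_run n A val (length program)"
  let ?enc = "encode_config n (length program)"
  have run: "?g = map_pmf ?enc ?q" unfolding A_def by (subst gossip_run_program_alg) auto
  have all: "?enc -` {\<sigma>. all_output n A i \<sigma>} = unanimous i" for i
    by (auto simp: A_def all_output_program_alg unanimous_def)
  have succ: "?enc -` {\<sigma>. success n A \<sigma>} = - failure"
    by (auto simp: success_def A_def all_output_program_alg unanimous_def failure_def)
  have P_all: "prob ?g {\<sigma>. all_output n A i \<sigma>} = prob ?q (unanimous i)" for i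
    unfolding run measure_map_pmf all ..
  have P_succ: "prob ?g {\<sigma>. success n A \<sigma>} = prob ?q (- failure)"
    unfolding run measure_map_pmf succ ..
  have s: "prob ?q (- failure) \<ge> 1 - \<epsilon>"
    using whp measure_pmf.prob_compl[of failure ?q] by (simp add: Compl_eq_Diff_UNIV)
  obtain \<kappa> where \<kappa>: "\<And>i. prob ?q (unanimous i) = \<kappa> * real (freq n val i) ^ p"
    using program_exact[OF valid N] by blast
  have disj: "unanimous i \<inter> unanimous j = {}" if "i \<noteq> j" for i j
    using that n_pos by (auto simp: unanimous_def)
  have out: "\<tau> \<notin> unanimous i" if "\<tau> \<in> set_pmf ?q" "i \<notin> {1..N}" for \<tau> i
  proof -
    have "freq n val i = 0" using valid that(2) by (force simp: freq_def valid_input_def)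
    then have "prob ?q (unanimous i) = 0" using \<kappa> p_pos by (simp add: zero_power)
    then show ?thesis using that(1) by (auto simp: measure_pmf_zero_iff)
  qed
  have "prob ?q (- failure) = prob ?q (\<Union>i\<in>{1..N}. unanimous i)"
  proof (rule measure_pmf.finite_measure_eq_AE)
    show "AE \<tau> in measure_pmf ?q. \<tau> \<in> - failure \<longleftrightarrow> \<tau> \<in> (\<Union>i\<in>{1..N}. unanimous i)"
      unfolding AE_measure_pmf_iff failure_def using out by blast
  qed auto
  also have "\<dots> = (\<Sum>i = 1..N. prob ?q (unanimous i))"
    using disj by (intro measure_pmf.finite_measure_finite_Union) (auto simp: disjoint_family_on_def)
  also have "\<dots> = \<kappa> * real (moment p n N val)" by (simp add: \<kappa> moment_def sum_distrib_left)
  finally have total: "prob ?q (- failure) = \<kappa> * real (moment p n N val)" .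
  then have "\<kappa> \<noteq> 0" using s eps by auto
  moreover have "{\<sigma>. all_output n A i \<sigma> \<and> success n A \<sigma>} = {\<sigma>. all_output n A i \<sigma>}" for i
    by (auto simp: success_def)
  ultimately have "\<P>(\<sigma> in measure_pmf ?g. all_output n A i \<sigma> \<bar> success n A \<sigma>) =
      real (freq n val i) ^ p / real (moment p n N val)" for i
    by (simp add: cond_prob_def P_all P_succ total \<kappa>)
  then show ?thesis using s by (simp add: obtains_lp_sample_def P_succ)
qed

text \<open>\<open>C\<close> is the constant hidden in the bound on the number of distinct values,
  and \<open>c\<close> is the exponent of the failure probability. The algorithms are fixed before
  the input is. Inputs without any value are left out because their moment is 0 and there is nothing
  to sample.\<close>

theorem theorem13:
  fixes p a :: nat and N :: "nat \<Rightarrow> nat" and C c :: real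
  assumes "p \<ge> 2"
    and "(\<lambda>n. real (N n)) \<in> O(\<lambda>n. real n ^ a)"
    and "c > 0"
  shows "\<exists>(A :: nat \<Rightarrow> nat gossip_algorithm) (T :: nat \<Rightarrow> nat) (b :: nat \<Rightarrow> nat).
    (\<lambda>n. real (T n)) \<in> O(\<lambda>n. ln (real n)) \<and>
    (\<lambda>n. real (b n)) \<in> O(\<lambda>n. ln (real n)) \<and>
    (\<forall>\<^sub>F n in sequentially.
       message_length_bounded (b n) (A n) \<and>
       (\<forall>val. valid_input n (N n) val \<and> (\<exists>v<n. val v \<noteq> None) \<and>
          real (distinct_values n (N n) val) \<le> C * real n powr (1 / (real p - 1)) \<longrightarrow>
          obtains_lp_sample p n (N n) (A n) val (T n) (real n powr - c)))"
proof -
  define C' where "C' = max C 1"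
  define T where "T = log_time (25 * (c + 25))"
  \<comment> \<open>A trial succeeds with probability at least 1 / (4096^p C'^(p-1) n), so the
    \<open>R n * n\<close> trials are expected to bring at least (c + 1) ln n successes.\<close>
  define R where "R = log_time ((c + 1) * 4096 ^ p * C' ^ (p - 1))"
  \<comment> \<open>The exponent k \<ge> c + 3 makes the collision term n^2 / n^k at most
    n^(-(c+1)).\<close>
  define k where "k = nat \<lceil>c\<rceil> + 3"
  define K where "K = (\<lambda>n::nat. n ^ k)"
  define e where "e = 2 * a + 20 + k"
  \<comment> \<open>Each block of \<open>log_nat n + 1\<close> bits outweighs a factor
    \<open>n\<close>, so \<open>e\<close> blocks hold all codes and tickets; the 2 further bits keep
    \<open>n ^ e\<close> below half of \<open>2 ^ b n\<close>, and \<open>T n\<close> leaves room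
    for the sums.\<close>
  define b where "b = (\<lambda>n. T n + 2 + e * (log_nat n + 1))"
  define P where "P = (\<lambda>n. lp_sampler.program n p (T n) (T n) (T n) (R n) (K n))"
  define A where "A = (\<lambda>n. program_alg (b n) (P n) fresh output_value)"
  define T' where "T' = (\<lambda>n. 9 * T n + R n * (p + 1) + 10)"
  have C': "C' \<ge> 1" "C \<le> C'" by (auto simp: C'_def)
  have const: "(\<lambda>n. x :: real) \<in> O(\<lambda>n. ln (real n))" for x by real_asymp
  have TO: "(\<lambda>n. real (T n)) \<in> O(\<lambda>n. ln (real n))"
    unfolding T_def using assms(3) by (intro log_time_bigo) auto
  have RO: "(\<lambda>n. real (R n)) \<in> O(\<lambda>n. ln (real n))"
    unfolding R_def using assms(3) C' by (intro log_time_bigo) auto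
  have T'O: "(\<lambda>n. real (T' n)) \<in> O(\<lambda>n. ln (real n))"
  proof -
    have "(\<lambda>n. 9 * real (T n) + (real p + 1) * real (R n) + 10) \<in> O(\<lambda>n. ln (real n))"
      by (intro sum_in_bigo const) (use TO RO in auto)
    then show ?thesis by (simp add: T'_def algebra_simps)
  qed
  have bO: "(\<lambda>n. real (b n)) \<in> O(\<lambda>n. ln (real n))"
  proof -
    have "(\<lambda>n. real (T n) + (2 + real e) + real e * real (log_nat n)) \<in> O(\<lambda>n. ln (real n))"
      by (intro sum_in_bigo const) (use TO log_nat_bigo in \<open>auto simp: e_def\<close>)
    then show ?thesis by (simp add: b_def algebra_simps)
  qed
  \<comment> \<open>One additional power of \<open>n\<close> eventually dominates the unknown
    constant of the polynomial bound.\<close>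
  have evN: "\<forall>\<^sub>F n in sequentially. N n \<le> n ^ (a + 1)"
  proof -
    obtain c0 where "\<forall>\<^sub>F n in sequentially. norm (real (N n)) \<le> c0 * norm (real n ^ a)"
      using assms(2) by (elim landau_o.bigE)
    moreover have "\<forall>\<^sub>F n in sequentially. nat \<lceil>c0\<rceil> \<le> n" by (rule eventually_ge_at_top)
    ultimately show ?thesis
    proof eventually_elim
      case (elim n)
      have "real (N n) \<le> c0 * real n ^ a" using elim(1) by simp
      also have "\<dots> \<le> real n * real n ^ a" using elim(2) by (intro mult_right_mono) (linarith, simp)
      finally have "real (N n) \<le> real (n ^ (a + 1))" by simp
      then show ?case by (simp only: of_nat_le_iff)
    qed
  qed
  \<comment> \<open>Since \<open>T n\<close> is of order ln n, this reduces to ln^2 n =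
    o(\<open>sqrt n\<close>).\<close>
  have evT: "\<forall>\<^sub>F n in sequentially. exp (- sqrt n / (256 * real (T n))) \<le> real n powr - (c + 1)"
  proof -
    define \<kappa> where "\<kappa> = 25 * (c + 25)"
    have \<kappa>: "\<kappa> > 0" using assms(3) by (simp add: \<kappa>_def)
    have "(\<lambda>n. ln (real n) * ln (real n)) \<in> o(\<lambda>n. sqrt (real n))" "(\<lambda>n. ln (real n)) \<in> o(\<lambda>n. sqrt (real n))"
      by real_asymp+
    then have "(\<lambda>n. (c + 1) * 256 * \<kappa> * (ln (real n) * ln (real n)) + (c + 1) * 256 * ln (real n)) \<in> o(\<lambda>n. sqrt (real n))"
      by (intro sum_in_smallo) auto
    from landau_o.smallD[OF this zero_less_one]
    have "\<forall>\<^sub>F n in sequentially.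
        \<bar>(c + 1) * 256 * \<kappa> * (ln (real n) * ln (real n)) + (c + 1) * 256 * ln (real n)\<bar> \<le> sqrt n" by simp
    moreover have "\<forall>\<^sub>F n in sequentially. 3 \<le> n" by (rule eventually_ge_at_top)
    ultimately show ?thesis
    proof eventually_elim
      case (elim n)
      have "exp 1 \<le> real n" using exp_le elim(2) by linarith
      then have l: "1 \<le> ln (real n)" using elim(2) by (subst ln_ge_iff) auto
      have T: "\<kappa> * ln n \<le> T n" "T n \<le> \<kappa> * ln n + 1"
        unfolding T_def \<kappa>_def using assms(3) elim(2) by (intro log_time_bounds; simp)+
      have "0 < \<kappa> * ln n" using \<kappa> l by simp
      then have Tpos: "0 < real (T n)" using T(1) by linarith
      have "(c + 1) * ln n * (256 * T n) \<le> (c + 1) * ln n * (256 * (\<kappa> * ln n + 1))"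
        using T(2) l assms(3) by (intro mult_left_mono) auto
      also have "\<dots> = (c + 1) * 256 * \<kappa> * (ln (real n) * ln (real n)) + (c + 1) * 256 * ln (real n)"
        by (simp add: algebra_simps)
      also have "\<dots> \<le> sqrt n" using elim(1) by linarith
      finally have "(c + 1) * ln n \<le> sqrt n / (256 * T n)" using Tpos by (simp add: field_simps)
      then have "exp (- sqrt n / (256 * real (T n))) \<le> exp (- ((c + 1) * ln n))" by simp
      also have "\<dots> = real n powr - (c + 1)" using elim(2) by (simp add: powr_def algebra_simps)
      finally show ?case .
    qed
  qed
  have "\<forall>\<^sub>F n in sequentially. 45 \<le> n" by (rule eventually_ge_at_top)
  with evN evT have "\<forall>\<^sub>F n in sequentially.
       message_length_bounded (b n) (A n) \<and>
       (\<forall>val. valid_input n (N n) val \<and> (\<exists>v<n. val v \<noteq> None) \<and>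
          real (distinct_values n (N n) val) \<le> C * real n powr (1 / (real p - 1)) \<longrightarrow>
          obtains_lp_sample p n (N n) (A n) val (T' n) (real n powr - c))"
  proof eventually_elim
    case (elim n)
    have n1: "1 \<le> n" "32 \<le> n" "4 \<le> n" using elim by auto
    have "n \<le> 2 * 2 ^ log_nat n"
    proof -
      have "real n / 2 \<le> 2 ^ log_nat n"
        using two_power_nat_floor_log(1)[of "real n"] n1 by (simp add: log_nat_def)
      then have "real n \<le> real (2 * 2 ^ log_nat n)" by simp
      then show ?thesis by (simp only: of_nat_le_iff)
    qed
    then have "n ^ e \<le> (2 ^ (log_nat n + 1)) ^ e" by (intro power_mono) auto
    also have "\<dots> = 2 ^ (e * (log_nat n + 1))" by (simp only: power_mult[symmetric] mult.commute)
    also have "\<dots> \<le> 2 ^ (T n + e * (log_nat n + 1))" by (intro power_increasing) auto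
    finally have "n ^ e \<le> 2 ^ b n div 4" by (simp add: b_def power_add)
    moreover have "0 < n ^ e" using n1 by simp
    ultimately have be: "n ^ e < 2 ^ b n div 2" by linarith
    have mono: "n ^ i \<le> n ^ j" if "i \<le> j" for i j using n1 that by (intro power_increasing) auto
    have fit: "n ^ (2 * a + 20) < 2 ^ b n div 2" using be mono[of "2 * a + 20" e] by (simp add: e_def)
    interpret lp_sampler n "b n" "N n" p "T n" "T n" "T n" "R n" "K n"
    proof
      show "32 \<le> n" "0 < p" "0 < K n" using n1 assms(1) by (auto simp: K_def)
      show "K n < 2 ^ b n" using be mono[of k e] by (simp add: K_def e_def)
      show "prod_encode (v, g) < 2 ^ b n" if "v \<le> N n" "g \<le> 2 * log_nat n" for v g
        by (rule codes_fit(1)[OF n1(3) elim(1) fit that])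
      show "Suc (prod_encode (v, list_encode [x, y])) < 2 ^ b n"
        if "v \<le> N n" "x \<le> log_nat n" "y \<le> log_nat n" for v x y
        by (rule codes_fit(2)[OF n1(3) elim(1) fit that])
      show "T n < b n" by (simp add: b_def)
      have "1 * 1 \<le> (25 * (c + 25)) * ln n"
      proof (intro mult_mono)
        have "exp 1 \<le> real n" using exp_le n1 by linarith
        then show "1 \<le> ln (real n)" using n1 by (subst ln_ge_iff) auto
      qed (use assms(3) in auto)
      also have "\<dots> \<le> T n" unfolding T_def using assms(3) n1 by (intro log_time_bounds) auto
      finally show "1 \<le> T n" by simp
    qed
    have P: "P n = program" by (simp add: P_def)
    have T': "T' n = length program" by (simp add: T'_def length_program)
    have "obtains_lp_sample p n (N n) (A n) val (T' n) (real n powr - c)"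
      if valid: "valid_input n (N n) val" and ex: "\<exists>v<n. val v \<noteq> None"
        and D: "real (distinct_values n (N n) val) \<le> C * real n powr (1 / (real p - 1))" for val
      unfolding A_def P T'
    proof (rule program_obtains_sample[OF valid order.refl])
      define d where "d = real (distinct_values n (N n) val)"
      have "d ^ (p - 1) \<le> (C' * real n powr (1 / (real p - 1))) ^ (p - 1)"
        using D mult_right_mono[OF C'(2), of "real n powr (1 / (real p - 1))"]
        unfolding d_def by (intro power_mono) auto
      also have "\<dots> = C' ^ (p - 1) * (real n powr (1 / (real p - 1))) ^ (p - 1)"
        by (simp add: power_mult_distrib)
      \<comment> \<open>Here the exponent 1/(p-1) enters: D^(p-1) is at most linear in
        \<open>n\<close>, and the \<open>n\<close> nodes trying in parallel compensate for exactly
        this factor.\<close>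
      also have "(real n powr (1 / (real p - 1))) ^ (p - 1) = real n"
        using n1 assms(1) by (simp add: powr_powr of_nat_diff flip: powr_realpow)
      finally have dp: "d ^ (p - 1) \<le> C' ^ (p - 1) * n" .
      show "prob (exec n (b n) program (start_config n fresh val)) failure \<le> real n powr - c"
      proof (rule order.trans[OF program_whp[OF valid order.refl ex]])
        obtain u where u: "u < n" "val u \<noteq> None" using ex by auto
        then obtain i where i: "val u = Some i" "i \<in> {1..N n}" using valid by (auto simp: valid_input_def)
        have "freq n val i > 0" using u i by (auto simp: freq_def card_gt_0_iff)
        then have "distinct_values n (N n) val > 0" using i by (auto simp: distinct_values_def card_gt_0_iff)
        then have d0: "d > 0" by (simp add: d_def)
        have Rge: "(c + 1) * 4096 ^ p * C' ^ (p - 1) * ln n \<le> R n"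
          unfolding R_def by (rule log_time_bounds(1)) (use assms(3) C' n1 in auto)
        have "(c + 1) * ln n = (c + 1) * 4096 ^ p * C' ^ (p - 1) * ln n * n / (4096 ^ p * (C' ^ (p - 1) * n))"
          using C' n1 by simp
        also have "\<dots> \<le> R n * n / (4096 ^ p * (C' ^ (p - 1) * n))"
          using C' mult_right_mono[OF Rge, of "real n"] by (intro divide_right_mono) auto
        also have "\<dots> \<le> R n * n / (4096 ^ p * d ^ (p - 1))"
          using dp d0 C' n1 by (intro divide_left_mono mult_left_mono mult_pos_pos) auto
        finally have "exp (- (R n * n / (4096 ^ p * d ^ (p - 1)))) \<le> exp (- ((c + 1) * ln n))" by simp
        also have "\<dots> = real n powr - (c + 1)" using n1 by (simp add: powr_def algebra_simps)
        finally have q: "exp (- (R n * n / (4096 ^ p * d ^ (p - 1)))) \<le> real n powr - (c + 1)" .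
        have "(real n)\<^sup>2 / K n = real n powr (2 - real k)"
          using n1 by (simp add: K_def powr_diff powr_realpow)
        also have "\<dots> \<le> real n powr - (c + 1)"
        proof (intro powr_mono)
          have "c \<le> real (nat \<lceil>c\<rceil>)" by linarith
          then show "2 - real k \<le> - (c + 1)" by (simp add: k_def)
        qed (use n1 in auto)
        finally have K: "(real n)\<^sup>2 / K n \<le> real n powr - (c + 1)" .
        have "(24/25) ^ T n \<le> real n powr - (c + 25)"
          unfolding T_def using assms(3) n1 by (intro power_time) auto
        from total_error[OF assms(3) elim(3) this elim(2) q K]
        show "phase_error n (T n) (T n) (T n) + (phase_error n (T n) (T n) (T n) +
            (exp (- (R n * n / (4096 ^ p * real (distinct_values n (N n) val) ^ (p - 1)))) + vote_error)) \<le> real n powr - c"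
          by (simp add: vote_error_def d_def)
      qed
      have "real n powr - c < real n powr 0" using n1 assms(3) by (intro powr_less_mono) auto
      then show "real n powr - c < 1" using n1 by simp
    qed
    then show ?case by (auto simp: A_def message_length_program_alg)
  qed
  then show ?thesis using T'O bO by blast
qed

end
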